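(* Let $h\ge 1$, $i\ge 1$ and $1<k<n$ be integers such that the $i$-th ordered configuration space $\mathcal{F}_h^i(k,n)$ is non-empty. Then $\mathcal{F}_h^i(k,n)$ is simply connected.
   Context: For $0<k<n$, $Gr(k,n)$ denotes the Grassmannian manifold of $k$-dimensional complex linear subspaces of $\mathbb{C}^n$. For $h\ge 1$, $\mathcal{F}_h^i(k,n)$ is the space of all ordered $h$-tuples $(H_1,\ldots,H_h)$ of pairwise distinct points of $Gr(k,n)$ such that $\dim(H_1+\cdots+H_h)=i$, topologized as a subspace of $Gr(k,n)^h$. *)

theory Defs
  imports "HOL-Analysis.Analysis"
begin

text \<open>The dimension \<open>n\<close> of the ambient space is \<open>CARD('n)\<close>. The names \<open>vec.subspace\<close>, \<open>vec.span\<close>,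
  \<open>vec.dim\<close> and \<open>vec.independent\<close> refer to the scalar multiplication \<open>*s\<close>, hence here to complex
  (not real) linear algebra.\<close>

definition Gr :: "nat \<Rightarrow> (complex ^ 'n) set set" where
  "Gr k = {V. vec.subspace V \<and> vec.dim V = k}"

text \<open>Ordered, linearly independent \<open>k\<close>-tuples of vectors, topologized as a subspace of
  \<open>(\<complex>\<^sup>n)\<^sup>k\<close>.\<close>

definition frames :: "nat \<Rightarrow> (nat \<Rightarrow> complex ^ 'n) topology" where
  "frames k = subtopology (product_topology (\<lambda>_. euclidean) {..<k})
     {v. inj_on v {..<k} \<and> vec.independent (v ` {..<k})}"

definition span_frame :: "nat \<Rightarrow> (nat \<Rightarrow> complex ^ 'n) \<Rightarrow> (complex ^ 'n) set" where
  "span_frame k v = vec.span (v ` {..<k})"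

text \<open>The usual topology of the Grassmannian: the quotient topology of the frame space; see
  \<open>quotient_map_span_frame\<close> below.\<close>

definition grassmannian :: "nat \<Rightarrow> (complex ^ 'n) set topology" where
  "grassmannian k = topology (\<lambda>U. U \<subseteq> Gr k \<and>
     openin (frames k) {v \<in> topspace (frames k). span_frame k v \<in> U})"

lemma openin_grassmannian:
  "openin (grassmannian k) U \<longleftrightarrow> U \<subseteq> (Gr k :: (complex ^ 'n) set set) \<and>
     openin (frames k) {v \<in> topspace (frames k). span_frame k v \<in> U}"
proof -
  let ?P = "\<lambda>U. {v \<in> topspace (frames k). span_frame k v \<in> (U :: (complex ^ 'n) set set)}"
  have "?P (S \<inter> T) = ?P S \<inter> ?P T" for S T
    by auto
  moreover have "?P (\<Union>\<K>) = (\<Union>K\<in>\<K>. ?P K)" for \<K>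
    by auto
  ultimately have "istopology (\<lambda>U. U \<subseteq> Gr k \<and> openin (frames k) (?P U))"
    unfolding istopology_def by (auto simp only: intro!: openin_Int openin_Union)
  then show ?thesis
    by (simp add: grassmannian_def topology_inverse')
qed

lemma span_frame_image:
  "span_frame k ` topspace (frames k) = (Gr k :: (complex ^ 'n) set set)"
proof (intro equalityI subsetI)
  fix V :: "(complex ^ 'n) set" assume "V \<in> span_frame k ` topspace (frames k)"
  then obtain v where v: "inj_on v {..<k}" "vec.independent (v ` {..<k})"
      "V = vec.span (v ` {..<k})"
    by (auto simp: frames_def span_frame_def)
  then have "vec.dim V = card (v ` {..<k})"
    using vec.dim_span_eq_card_independent by blast
  with v show "V \<in> Gr k"
    by (simp add: Gr_def card_image)
next
  fix V :: "(complex ^ 'n) set" assume "V \<in> Gr k"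
  then have V: "vec.subspace V" "vec.dim V = k"
    by (auto simp: Gr_def)
  obtain B where B: "B \<subseteq> V" "vec.independent B" "V \<subseteq> vec.span B" "card B = vec.dim V"
    using vec.basis_exists[of V] by blast
  have "finite B"
    using B(2) vec.finiteI_independent by blast
  then obtain f where "bij_betw f {..<k} B"
    using B(4) V(2) by (metis atLeast0LessThan ex_bij_betw_nat_finite)
  then have f: "bij_betw (restrict f {..<k}) {..<k} B"
    using bij_betw_cong[of "{..<k}" "restrict f {..<k}" f B] by simp
  then have im: "restrict f {..<k} ` {..<k} = B" "inj_on (restrict f {..<k}) {..<k}"
    by (auto simp: bij_betw_def)
  have "vec.span B = V"
    using B V(1) by (metis subset_antisym vec.span_minimal)
  moreover have "restrict f {..<k} \<in> topspace (frames k)"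
    unfolding frames_def topspace_subtopology topspace_product_topology
    using im B(2) by simp
  ultimately show "V \<in> span_frame k ` topspace (frames k)"
    using im(1) by (metis imageI span_frame_def)
qed

lemma topspace_grassmannian [simp]:
  "topspace (grassmannian k) = (Gr k :: (complex ^ 'n) set set)"
proof -
  have "{v \<in> topspace (frames k). span_frame k v \<in> (Gr k :: (complex ^ 'n) set set)}
      = topspace (frames k)"
    using span_frame_image by blast
  then have "openin (grassmannian k) (Gr k :: (complex ^ 'n) set set)"
    unfolding openin_grassmannian by (simp only: order_refl openin_topspace simp_thms)
  then show ?thesis
    by (metis openin_grassmannian openin_subset openin_topspace subset_antisym)
qed

lemma quotient_map_span_frame: "quotient_map (frames k) (grassmannian k) (span_frame k)"
  by (simp add: quotient_map_def span_frame_image openin_grassmannian)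

text \<open>The space \<open>\<F>\<^sub>h\<^sup>i(k,n)\<close>; tuples are indexed by \<open>{..<h}\<close>, and the sum is
  the elementwise sum of sets.\<close>

definition grassmann_config :: "nat \<Rightarrow> nat \<Rightarrow> nat \<Rightarrow> (nat \<Rightarrow> (complex ^ 'n) set) topology" where
  "grassmann_config h i k = subtopology (product_topology (\<lambda>_. grassmannian k) {..<h})
     {H. inj_on H {..<h} \<and> vec.dim (\<Sum>j<h. H j) = i}"

text \<open>The library's \<^const>\<open>simply_connected\<close> is restricted to subsets of a topological type;
  \<open>simply_connected_space_top_of_set\<close> below relates the two notions.\<close>

definition simply_connected_space :: "'a topology \<Rightarrow> bool" where
  "simply_connected_space X \<longleftrightarrow> path_connected_space X \<and>
     (\<forall>p. pathin X p \<and> p 1 = p 0 \<longrightarrow>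
        homotopic_with (\<lambda>r. r 0 = p 0 \<and> r 1 = p 0) (top_of_set {0..1}) X p (\<lambda>_. p 0))"

lemma simply_connected_space_top_of_set:
  fixes S :: "'a::real_normed_vector set"
  shows "simply_connected_space (top_of_set S) \<longleftrightarrow> simply_connected S"
proof -
  have "linepath a a = (\<lambda>_. a)" for a :: 'a
    by (auto simp: linepath_def algebra_simps)
  moreover have "pathin (top_of_set S) p \<longleftrightarrow> path p \<and> path_image p \<subseteq> S" for p
    by (auto simp: pathin_def path_def path_image_def)
  ultimately show ?thesis
    unfolding simply_connected_space_def simply_connected_eq_contractible_path homotopic_paths_def
    by (auto simp: pathstart_def pathfinish_def path_connectedin_topspace
        simp flip: path_connectedin_iff_path_connected_real)
qed

end

theory Submission
  imports Defs
begin

text \<open>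
  Represent \<open>h\<close> subspaces by \<open>N = h k\<close> vectors, grouped in blocks of \<open>k\<close>. A loop of configurations lifts to a
  path of such families, which closes up to a loop because any two frames of a complex vector space can be joined.
  The only general position argument needed is that finitely many real curves of proper complex subspaces
  do not cover \<open>\<complex>\<^sup>n\<close>, since complex hyperplanes have real codimension two.

  The loop is contracted by replacing one vector after the other by a constant generic one. First this is done
  for a frame of the \<open>i\<close>-dimensional sum, unless the sum is everything; after that the sum is a constant space \<open>E\<close>.
  If \<open>i = N\<close>, all \<open>N\<close> vectors are independent; rescaling a vector (which does not change its block) makes its
  component along the new constant vector equal to one, and then the segment between the two is harmless. If
  \<open>i < N\<close>, then \<open>k < i\<close>, and after a small perturbation any \<open>i\<close> of the vectors are independent. Then a
  single vector can be moved freely: the other \<open>N - 1 \<ge> i\<close> vectors still span \<open>E\<close>, and, as \<open>k \<ge> 2\<close>, the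
  other vectors of its block still keep the subspaces apart.
\<close>

subsection \<open>Independent families\<close>

text \<open>The avoidance argument fails for merely continuous curves, which can fill space: it
  rests on differentiable maps sending negligible sets to negligible sets. Hence every curve is
  first replaced by a polynomial one with the same endpoints, so that loops stay loops, and
  compactness supplies one \<epsilon> for which the straight segment to the approximation stays
  admissible. Since the sum of the subspaces varies with time, there is at first no fixed space to
  choose generic vectors in; so the coordinates with respect to a moving frame of the sum are frozen
  while that frame is exchanged for a constant one. A lifted loop ends in another frame of the
  configuration it starts from, so it is closed up by a path along which the configuration stands
  still. All contractions are free, the endpoints of the loop moving together; the base point is
  restored at the end. The bound \<open>k >= 2\<close> is essential: for \<open>k = 1\<close> a
  block is just its moving vector, and ordered triples of distinct points of the complex projective
  line form a copy of PGL_2(C), whose fundamental group has order two.\<close>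

definition indep :: "'b set \<Rightarrow> ('b \<Rightarrow> complex ^ 'n) \<Rightarrow> bool" where
  "indep J x \<longleftrightarrow> inj_on x J \<and> vec.independent (x ` J)"

lemma indep_cong: "(\<And>c. c \<in> J \<Longrightarrow> x c = y c) \<Longrightarrow> indep J x \<longleftrightarrow> indep J y"
  unfolding indep_def by (metis image_cong inj_on_cong)

lemma indep_empty [simp]: "indep {} x"
  by (simp add: indep_def vec.independent_empty)

lemma indep_insert:
  assumes "c \<notin> J"
  shows "indep (insert c J) x \<longleftrightarrow> indep J x \<and> x c \<notin> vec.span (x ` J)"
proof -
  have "J - {c} = J" using assms by blast
  then show ?thesis
    unfolding indep_def by (auto simp: vec.independent_insert intro: vec.span_base)
qed

lemma indep_remove:
  assumes "c \<in> J"
  shows "indep J x \<longleftrightarrow> indep (J - {c}) x \<and> x c \<notin> vec.span (x ` (J - {c}))"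
  using indep_insert[of c "J - {c}" x] assms by (simp add: insert_absorb)

lemma indep_mono: "indep J x \<Longrightarrow> I \<subseteq> J \<Longrightarrow> indep I x"
  unfolding indep_def by (meson image_mono inj_on_subset vec.independent_mono)

lemma indep_finite: "indep J (x :: 'b \<Rightarrow> complex ^ 'n) \<Longrightarrow> finite J"
  unfolding indep_def using finite_imageD vec.finiteI_independent by blast

lemma dim_indep:
  assumes "indep J (x :: 'b \<Rightarrow> complex ^ 'n)"
  shows "vec.dim (x ` J) = card J"
  using assms unfolding indep_def by (metis card_image vec.dim_eq_card_independent)

lemma indep_bij_betw:
  assumes "bij_betw f I J"
  shows "indep I (\<lambda>c. x (f c)) \<longleftrightarrow> indep J x"
proof -
  have "f ` I = J" "inj_on f I" using assms by (auto simp: bij_betw_def)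
  then show ?thesis
    using comp_inj_on_iff[of f I x] image_image[of x f I] by (simp add: indep_def comp_def)
qed

lemma sum_eq_0_indepD:
  assumes "indep J x" "(\<Sum>c\<in>J. u c *s x c) = 0" "c \<in> J"
  shows "u c = 0"
proof -
  let ?g = "the_inv_into J x"
  have inj: "inj_on x J" using assms by (simp add: indep_def)
  have "(\<Sum>v\<in>x ` J. u (?g v) *s v) = (\<Sum>c\<in>J. u c *s x c)"
    using inj by (simp add: sum.reindex the_inv_into_f_f)
  with assms(2) have "(\<Sum>v\<in>x ` J. u (?g v) *s v) = 0" by simp
  moreover have "vec.independent (x ` J)" using assms by (simp add: indep_def)
  ultimately have "\<forall>v\<in>x ` J. u (?g v) = 0"
    unfolding vec.independent_explicit by (elim conjE allE[of _ "\<lambda>v. u (?g v)"] mp) 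
  then have "u (?g (x c)) = 0" using assms(3) by blast
  then show ?thesis using inj assms(3) by (simp add: the_inv_into_f_f)
qed

lemma indepI_sum:
  assumes "finite J" "\<And>u. (\<Sum>c\<in>J. u c *s x c) = 0 \<Longrightarrow> \<forall>c\<in>J. u c = 0"
  shows "indep J (x :: 'b \<Rightarrow> complex ^ 'n)"
proof -
  have inj: "inj_on x J"
  proof (rule inj_onI, rule ccontr)
    fix a b assume ab: "a \<in> J" "b \<in> J" "x a = x b" "a \<noteq> b"
    let ?u = "\<lambda>c. if c = a then 1 else if c = b then -1 else (0::complex)"
    have "(\<Sum>c\<in>J. ?u c *s x c) = (\<Sum>c\<in>{a,b}. ?u c *s x c)"
      using ab assms(1) by (intro sum.mono_neutral_right) auto
    also have "\<dots> = 0" using ab by simp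
    finally have "\<forall>c\<in>J. ?u c = 0" by (rule assms(2))
    then show False using ab(1) by auto
  qed
  have "vec.independent (x ` J)"
    unfolding vec.independent_explicit
  proof (intro conjI allI impI)
    fix u assume "(\<Sum>v\<in>x ` J. u v *s v) = 0"
    then have "(\<Sum>c\<in>J. u (x c) *s x c) = 0"
      using inj by (simp add: sum.reindex)
    from assms(2)[OF this] show "\<forall>v\<in>x ` J. u v = 0" by blast
  qed (use assms in auto)
  with inj show ?thesis by (simp add: indep_def)
qed

lemma indep_inj_linear:
  assumes "Vector_Spaces.linear (*s) (*s) f" "inj f" "indep J (x :: 'b \<Rightarrow> complex ^ 'n)"
  shows "indep J (\<lambda>c. f (x c) :: complex ^ 'n)"
proof (rule indepI_sum)
  interpret f: Vector_Spaces.linear "(*s)" "(*s)" f by (rule assms(1))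
  fix u assume "(\<Sum>c\<in>J. u c *s f (x c)) = 0"
  then have "f (\<Sum>c\<in>J. u c *s x c) = f 0"
    by (simp add: f.sum f.scale)
  then have "(\<Sum>c\<in>J. u c *s x c) = 0" using assms(2) by (blast dest: injD)
  then show "\<forall>c\<in>J. u c = 0" using sum_eq_0_indepD[OF assms(3)] by blast
qed (use assms indep_finite in blast)

lemma in_span_image_iff:
  assumes "finite J"
  shows "v \<in> vec.span (x ` J) \<longleftrightarrow> (\<exists>u. v = (\<Sum>c\<in>J. u c *s x c))"
proof
  show "\<exists>u. v = (\<Sum>c\<in>J. u c *s x c)" if "v \<in> vec.span (x ` J)"
    using assms(1) that
  proof (induction J arbitrary: v rule: finite_induct)
    case (insert c J)
    from insert.prems obtain a where "v - a *s x c \<in> vec.span (x ` J)"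
      by (auto simp: vec.span_insert)
    then obtain u where u: "v - a *s x c = (\<Sum>c\<in>J. u c *s x c)" using insert.IH by blast
    have "(\<Sum>d\<in>J. (u(c := a)) d *s x d) = (\<Sum>c\<in>J. u c *s x c)"
      using insert.hyps by (intro sum.cong) auto
    then have "v = (\<Sum>d\<in>insert c J. (u(c := a)) d *s x d)"
      using insert.hyps u by (simp add: algebra_simps)
    then show ?case by blast
  qed simp
next
  assume "\<exists>u. v = (\<Sum>c\<in>J. u c *s x c)"
  then show "v \<in> vec.span (x ` J)"
    by (auto intro!: vec.span_sum vec.span_scale intro: vec.span_base)
qed

section \<open>Frames as rows of invertible matrices, and continuity of coordinates\<close>

lemma indep_rows_iff_det:
  fixes A :: "complex ^ 'n ^ 'n"
  shows "indep UNIV (\<lambda>r. A $ r) \<longleftrightarrow> det A \<noteq> 0"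
proof -
  have "indep UNIV (\<lambda>r. A $ r) \<longleftrightarrow> (\<forall>c. (\<Sum>i\<in>UNIV. c i *s row i A) = 0 \<longrightarrow> (\<forall>i. c i = 0))"
  proof -
    have "row i A = A $ i" for i by (simp add: row_def)
    then show ?thesis
      using indepI_sum[of UNIV "\<lambda>r. A $ r"] sum_eq_0_indepD[of UNIV "\<lambda>r. A $ r"] by auto
  qed
  also have "\<dots> \<longleftrightarrow> (\<exists>B. A ** B = mat 1)"
    by (simp add: matrix_right_invertible_independent_rows)
  also have "\<dots> \<longleftrightarrow> det A \<noteq> 0"
    by (metis invertible_det_nz invertible_right_inverse)
  finally show ?thesis .
qed

text \<open>Extend the vectors to a basis and index it by the type \<open>'n\<close>. This turns
  independence into a determinant condition and supplies a complement, spanned by the remaining rows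
  of \<open>A\<close>.\<close>

lemma indep_imp_inj_index:
  assumes "indep J (x :: 'b \<Rightarrow> complex ^ 'n)"
  obtains \<iota> :: "'b \<Rightarrow> 'n::finite" and A :: "complex ^ 'n ^ 'n"
  where "inj_on \<iota> J" "\<And>c. c \<in> J \<Longrightarrow> A $ \<iota> c = x c" "det A \<noteq> 0"
proof -
  obtain B where B: "x ` J \<subseteq> B" "vec.independent B" "vec.span B = UNIV"
    using assms vec.extend_basis_superset vec.independent_extend_basis vec.span_extend_basis
    unfolding indep_def by metis
  have fin: "finite B" using B vec.finiteI_independent by blast
  have "card B = vec.dim (UNIV :: (complex ^ 'n) set)"
    using B by (metis vec.dim_span_eq_card_independent)
  then have "card B = card (UNIV :: 'n set)" by (simp add: vec.dim_UNIV card_cart_basis)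
  then obtain g where g: "bij_betw g (UNIV :: 'n set) B"
    using fin by (metis finite_class.finite_UNIV finite_same_card_bij)
  define \<iota> where "\<iota> = (\<lambda>c. inv_into UNIV g (x c))"
  have gi: "g (\<iota> c) = x c" if "c \<in> J" for c
    unfolding \<iota>_def using g B(1) that by (metis bij_betw_inv_into_right image_subset_iff)
  have "inj_on \<iota> J"
    using gi assms unfolding indep_def inj_on_def by metis
  moreover have "indep UNIV (\<lambda>r. (\<chi> r. g r) $ r)"
    using g B by (simp add: indep_def bij_betw_def)
  ultimately show ?thesis
    using that[of \<iota> "\<chi> r. g r"] gi unfolding indep_rows_iff_det by simp
qed

text \<open>Overwriting rows of a fixed \<open>A\<close> keeps the other rows as a fixed complement;
  the families with nonzero determinant form a chart around the one that \<open>A\<close> was built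
  from.\<close>

definition replace_rows :: "('b \<Rightarrow> 'n::finite) \<Rightarrow> 'b set \<Rightarrow> complex ^ 'n ^ 'n \<Rightarrow> ('b \<Rightarrow> complex ^ 'n) \<Rightarrow> complex ^ 'n ^ 'n"
  where "replace_rows \<iota> J A y = (\<chi> r. if r \<in> \<iota> ` J then y (inv_into J \<iota> r) else A $ r)"

lemma replace_rows_index [simp]: "inj_on \<iota> J \<Longrightarrow> c \<in> J \<Longrightarrow> replace_rows \<iota> J A y $ \<iota> c = y c"
  by (simp add: replace_rows_def)

lemma replace_rows_self:
  assumes "inj_on \<iota> J" "\<And>c. c \<in> J \<Longrightarrow> A $ \<iota> c = x c"
  shows "replace_rows \<iota> J A x = A"
  using assms by (auto simp: replace_rows_def vec_eq_iff)

text \<open>Only this direction holds: the span of an independent \<open>y\<close> may meet the span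
  of the rows kept from \<open>A\<close>.\<close>

lemma indep_if_det_replace_rows:
  assumes "inj_on \<iota> J" "det (replace_rows \<iota> J A y) \<noteq> 0"
  shows "indep J y"
proof -
  have "indep UNIV (\<lambda>r. replace_rows \<iota> J A y $ r)" using assms by (simp add: indep_rows_iff_det)
  then have "indep (\<iota> ` J) (\<lambda>r. replace_rows \<iota> J A y $ r)" by (rule indep_mono) simp
  then have "indep J (\<lambda>c. replace_rows \<iota> J A y $ \<iota> c)"
    using indep_bij_betw[of \<iota> J "\<iota> ` J" "\<lambda>r. replace_rows \<iota> J A y $ r"] assms(1) by (simp add: bij_betw_def)
  then show ?thesis using assms(1) by (simp cong: indep_cong)
qed

lemma continuous_on_det:
  fixes f :: "'a::topological_space \<Rightarrow> complex ^ 'n ^ 'n"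
  assumes "continuous_on S f"
  shows "continuous_on S (\<lambda>x. det (f x))"
  unfolding det_def by (intro continuous_intros assms)

lemma matrix_mul_matrix_inv:
  fixes A :: "complex ^ 'n ^ 'n"
  assumes "det A \<noteq> 0"
  shows "A ** matrix_inv A = mat 1"
proof -
  have "\<exists>A'. A ** A' = mat 1 \<and> A' ** A = mat 1"
    using assms unfolding invertible_det_nz[symmetric] invertible_def .
  from someI_ex[OF this] show ?thesis by (simp add: matrix_inv_def)
qed

text \<open>Column \<open>l\<close> of the inverse solves a linear system with right-hand side
  \<open>axis l 1\<close>. The quotient of determinants given by Cramer's rule makes the continuity
  of inversion visible.\<close>

lemma matrix_inv_cramer:
  fixes A :: "complex ^ 'n ^ 'n"
  assumes "det A \<noteq> 0"
  shows "matrix_inv A = (\<chi> k l. det (\<chi> i j. if j = k then axis l 1 $ i else A $ i $ j) / det A)"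
proof -
  have inv: "A ** matrix_inv A = mat 1"
    using assms by (rule matrix_mul_matrix_inv)
  have "A *v (matrix_inv A *v axis l 1) = axis l 1" for l
    using inv by (simp add: matrix_vector_mul_assoc)
  then have "matrix_inv A *v axis l 1 = (\<chi> k. det (\<chi> i j. if j = k then axis l 1 $ i else A $ i $ j) / det A)" for l
    using cramer[OF assms] by blast
  moreover have "(matrix_inv A *v axis l 1) $ k = matrix_inv A $ k $ l" for k l
    by (simp add: matrix_vector_mult_def axis_def if_distrib cong: if_cong)
  ultimately have "matrix_inv A $ k $ l = det (\<chi> i j. if j = k then axis l 1 $ i else A $ i $ j) / det A" for k l
    by (metis (lifting) vec_lambda_beta)
  then show ?thesis by (simp add: vec_eq_iff)
qed

lemma continuous_on_matrix_inv:
  "continuous_on {A :: complex ^ 'n ^ 'n. det A \<noteq> 0} matrix_inv"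
proof -
  have "continuous_on {A :: complex ^ 'n ^ 'n. det A \<noteq> 0}
    (\<lambda>A. \<chi> k l. det (\<chi> i j. if j = k then axis l 1 $ i else A $ i $ j) / det A)"
  proof (intro continuous_on_vec_lambda continuous_on_divide continuous_on_det)
    fix j k l i :: 'n
    show "continuous_on {A :: complex ^ 'n ^ 'n. det A \<noteq> 0} (\<lambda>A. if j = k then axis l 1 $ i else A $ i $ j)"
      by (cases "j = k") (simp_all add: continuous_on_component continuous_on_id)
  qed (simp_all add: continuous_on_id)
  then show ?thesis
    by (rule continuous_on_eq) (simp add: matrix_inv_cramer)
qed

text \<open>Cramer's rule, for a frame completed to a basis by the remaining rows of a fixed matrix.\<close>

lemma coefficient_via_matrix_inv:
  fixes \<iota> :: "'b \<Rightarrow> 'n::finite" and y :: "'b \<Rightarrow> complex ^ 'n"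
  assumes "inj_on \<iota> J" "finite J" "det (replace_rows \<iota> J A y) \<noteq> 0" "c \<in> J"
  shows "((\<Sum>c\<in>J. u c *s y c) v* matrix_inv (replace_rows \<iota> J A y)) $ \<iota> c = u c"
proof -
  let ?M = "replace_rows \<iota> J A y"
  define U :: "complex ^ 'n" where "U = (\<chi> r. if r \<in> \<iota> ` J then u (inv_into J \<iota> r) else 0)"
  have "U v* ?M = (\<Sum>r\<in>UNIV. U $ r *s ?M $ r)"
    by (simp add: vec_eq_iff vector_matrix_mult_def mult.commute)
  also have "\<dots> = (\<Sum>r\<in>\<iota> ` J. U $ r *s ?M $ r)"
    by (rule sum.mono_neutral_right) (auto simp: U_def)
  also have "\<dots> = (\<Sum>c\<in>J. u c *s y c)"
    using assms(1) by (subst sum.reindex) (auto simp: U_def)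
  finally have "(\<Sum>c\<in>J. u c *s y c) v* matrix_inv ?M = (U v* ?M) v* matrix_inv ?M" by simp
  also have "\<dots> = U v* (?M ** matrix_inv ?M)"
    by (simp add: vector_matrix_mul_assoc)
  also have "\<dots> = U"
    using assms(3) by (simp add: matrix_mul_matrix_inv)
  finally show ?thesis using assms by (simp add: U_def)
qed

lemma continuous_on_replace_rows:
  assumes "\<And>c. c \<in> J \<Longrightarrow> continuous_on S (\<lambda>t. y t c)"
  shows "continuous_on S (\<lambda>t. replace_rows \<iota> J A (y t))"
  unfolding replace_rows_def
proof (rule continuous_on_vec_lambda)
  fix r
  show "continuous_on S (\<lambda>t. if r \<in> \<iota> ` J then y t (inv_into J \<iota> r) else A $ r)"
    by (cases "r \<in> \<iota> ` J") (auto intro!: assms inv_into_into)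
qed

text \<open>Complete \<open>x\<close> to an invertible matrix; a nonzero determinant is an open
  condition, and it forces the overwritten rows to be independent.\<close>

lemma indep_open:
  fixes x :: "'b \<Rightarrow> complex ^ 'n"
  assumes "indep J x"
  obtains \<epsilon> where "\<epsilon> > 0" "\<And>y. (\<And>c. c \<in> J \<Longrightarrow> dist (y c) (x c) < \<epsilon>) \<Longrightarrow> indep J y"
proof -
  obtain \<iota> :: "'b \<Rightarrow> 'n::finite" and A where A: "inj_on \<iota> J" "\<And>c. c \<in> J \<Longrightarrow> A $ \<iota> c = x c" "det A \<noteq> 0"
    using indep_imp_inj_index[OF assms] by metis
  have "open {M :: complex ^ 'n ^ 'n. det M \<noteq> 0}"
    by (intro open_Collect_neq continuous_on_det continuous_intros)
  then obtain e where e: "e > 0" "ball A e \<subseteq> {M. det M \<noteq> 0}"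
    using A(3) open_contains_ball by blast
  \<comment> \<open>The norm of a matrix is at most the sum of the norms of its
    \<open>CARD('n)\<close> rows; the extra one makes the final inequality strict.\<close>
  define \<epsilon> where "\<epsilon> = e / (CARD('n) + 1)"
  have "\<epsilon> > 0" using e by (simp add: \<epsilon>_def)
  moreover have "indep J y" if y: "\<And>c. c \<in> J \<Longrightarrow> dist (y c) (x c) < \<epsilon>" for y
  proof -
    let ?M = "replace_rows \<iota> J A y"
    have "norm ((?M - A) $ r) \<le> \<epsilon>" for r
    proof (cases "r \<in> \<iota> ` J")
      case True
      then obtain c where c: "c \<in> J" "r = \<iota> c" by blast
      then have "(?M - A) $ r = y c - x c" using A by simp
      then show ?thesis using y[OF c(1)] by (simp add: dist_norm)
    qed (use \<open>\<epsilon> > 0\<close> in \<open>simp add: replace_rows_def\<close>)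
    then have "(\<Sum>r\<in>UNIV. norm ((?M - A) $ r)) \<le> (\<Sum>r\<in>(UNIV :: 'n set). \<epsilon>)"
      by (intro sum_mono) auto
    then have "norm (?M - A) \<le> (\<Sum>r\<in>(UNIV :: 'n set). \<epsilon>)"
      unfolding norm_vec_def[of "?M - A"] by (rule order_trans[OF L2_set_le_sum, rotated]) simp
    also have "\<dots> < e"
      using e(1) by (simp add: \<epsilon>_def field_simps)
    finally have "det ?M \<noteq> 0" using e(2) by (auto simp: dist_norm norm_minus_commute)
    then show ?thesis using indep_if_det_replace_rows A(1) by blast
  qed
  ultimately show ?thesis using that by blast
qed

text \<open>Near each \<open>s\<close> the coefficients are given by a formula through an inverse
  matrix that is continuous in \<open>t\<close>. Independence makes them unique, so any
  \<open>u\<close> obeys the formula; in particular coefficients picked by \<open>SOME\<close> at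
  each time are continuous.\<close>

lemma continuous_on_coefficients:
  fixes e :: "'a::topological_space \<Rightarrow> 'b \<Rightarrow> complex ^ 'n"
  assumes "\<And>c. c \<in> J \<Longrightarrow> continuous_on S (\<lambda>t. e t c)"
    and "continuous_on S v" and "\<And>t. t \<in> S \<Longrightarrow> indep J (e t)"
    and "\<And>t. t \<in> S \<Longrightarrow> v t = (\<Sum>c\<in>J. u t c *s e t c)" and "c \<in> J"
  shows "continuous_on S (\<lambda>t. u t c)"
proof (rule continuous_on_def[THEN iffD2], rule ballI)
  fix s assume s: "s \<in> S"
  obtain \<iota> :: "'b \<Rightarrow> 'n" and A where A: "inj_on \<iota> J" "\<And>c. c \<in> J \<Longrightarrow> A $ \<iota> c = e s c" "det A \<noteq> 0"
    using indep_imp_inj_index[OF assms(3)[OF s]] by metis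
  let ?M = "\<lambda>t. replace_rows \<iota> J A (e t)"
  let ?U = "{t \<in> S. det (?M t) \<noteq> 0}"
  have M: "continuous_on S ?M" by (rule continuous_on_replace_rows) (rule assms(1))
  have "openin (top_of_set S) (S \<inter> (\<lambda>t. det (?M t)) -` (- {0}))"
    by (intro continuous_openin_preimage_gen continuous_on_det M) (simp add: open_Compl)
  then have U: "openin (top_of_set S) ?U"
    by (simp add: vimage_def Int_def)
  have sU: "s \<in> ?U" using s A replace_rows_self[of \<iota> J A "e s"] by simp
  have fin: "finite J" using assms(3)[OF s] indep_finite by blast
  have "continuous_on ?U (\<lambda>t. matrix_inv (?M t))"
    by (rule continuous_on_compose2[OF continuous_on_matrix_inv continuous_on_subset[OF M]]) auto
  then have "continuous_on ?U (\<lambda>t. (v t v* matrix_inv (?M t)) $ \<iota> c)"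
    unfolding vector_matrix_mult_def vec_lambda_beta
    by (intro continuous_on_sum continuous_on_mult continuous_on_component continuous_on_subset[OF assms(2)]) auto
  moreover have "(v t v* matrix_inv (?M t)) $ \<iota> c = u t c" if "t \<in> ?U" for t
    using that coefficient_via_matrix_inv[OF A(1) fin _ assms(5), of A "e t" "u t"] assms(4)[of t] by simp
  ultimately have "continuous_on ?U (\<lambda>t. u t c)"
    by (metis (no_types, lifting) continuous_on_cong)
  then have "((\<lambda>t. u t c) \<longlongrightarrow> u s c) (at s within ?U)"
    using sU unfolding continuous_on_def by blast
  moreover have "at s within ?U = at s within S"
  proof -
    obtain W where "open W" "?U = S \<inter> W" using U by (auto simp: openin_open)
    then show ?thesis using sU by (intro at_within_nhd[of s W]) auto
  qed
  ultimately show "((\<lambda>t. u t c) \<longlongrightarrow> u s c) (at s within S)" by simp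
qed

subsection \<open>Vectors avoiding moving subspaces\<close>

lemma norm_vector_scalar_mult: "norm (a *s v) = norm a * norm (v :: complex ^ 'n)"
  by (simp add: norm_vec_def norm_mult L2_set_right_distrib)

lemma bounded_bilinear_vector_scalar_mult:
  "bounded_bilinear ((*s) :: complex \<Rightarrow> complex ^ 'n \<Rightarrow> complex ^ 'n)"
proof
  show "\<exists>K. \<forall>a (b :: complex ^ 'n). norm (a *s b) \<le> norm a * norm b * K"
    by (intro exI[of _ 1]) (simp add: norm_vector_scalar_mult)
qed (auto simp: vec_eq_iff algebra_simps)

lemmas continuous_on_vector_scalar_mult [continuous_intros] =
  bounded_bilinear.continuous_on[OF bounded_bilinear_vector_scalar_mult]

lemma differentiable_on_vector_scalar_mult:
  assumes "f differentiable_on S" "g differentiable_on S"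
  shows "(\<lambda>z. f z *s (g z :: complex ^ 'n)) differentiable_on S"
  unfolding differentiable_on_def
proof
  fix z assume "z \<in> S"
  then obtain f' g' where "(f has_derivative f') (at z within S)" "(g has_derivative g') (at z within S)"
    using assms unfolding differentiable_on_def differentiable_def by blast
  from bounded_bilinear.FDERIV[OF bounded_bilinear_vector_scalar_mult this]
  show "(\<lambda>z. f z *s (g z :: complex ^ 'n)) differentiable at z within S"
    by (rule differentiableI)
qed

text \<open>The coefficients of fewer than \<open>CARD('n)\<close> vectors leave one complex
  coordinate spare, whose real part can hold the time. So the set is covered by a differentiable
  image of the negligible real hyperplane on which the spare coordinate is real.\<close>

lemma negligible_moving_span:
  fixes f :: "real \<Rightarrow> complex ^ 'n"
  assumes J: "finite J" "card J < CARD('n)"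
    and diff: "f differentiable_on UNIV" "\<And>g. g \<in> J \<Longrightarrow> g differentiable_on UNIV"
  shows "negligible {q. \<exists>t. f t + q \<in> vec.span ((\<lambda>g. g t) ` J)}"
proof -
  obtain \<iota> :: "(real \<Rightarrow> complex ^ 'n) \<Rightarrow> 'n" where \<iota>: "inj_on \<iota> J"
    using J finite_class.finite_UNIV inj_on_iff_card_le[of J "UNIV :: 'n set"] by auto
  have "\<iota> ` J \<noteq> UNIV"
    using J \<iota> card_image[of \<iota> J] by (metis less_irrefl)
  then obtain o' where o': "o' \<notin> \<iota> ` J" by blast
  \<comment> \<open>The inner product with \<open>axis o' \<i>\<close> is the imaginary part of the
    spare coordinate.\<close>
  define S :: "(complex ^ 'n) set" where "S = {z. axis o' \<i> \<bullet> z = 0}"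
  define \<Phi> where "\<Phi> = (\<lambda>z :: complex ^ 'n.
    (\<Sum>g\<in>J. z $ \<iota> g *s g (Re (z $ o'))) - f (Re (z $ o')))"
  have "axis o' \<i> \<noteq> (0 :: complex ^ 'n)" by (simp add: axis_eq_0_iff)
  then have "negligible S" unfolding S_def by (intro negligible_hyperplane) simp
  moreover have "\<Phi> differentiable_on S"
  proof -
    have bl: "bounded_linear (\<lambda>z :: complex ^ 'n. Re (z $ o'))"
      by (intro bounded_linear_compose[OF bounded_linear_Re] bounded_linear_vec_nth)
    have "(\<lambda>z :: complex ^ 'n. Re (z $ o')) differentiable_on S"
      using bounded_linear_imp_differentiable_on[OF bl] .
    then have *: "(\<lambda>z. g (Re (z $ o'))) differentiable_on S" 
      if "g differentiable_on UNIV" for g :: "real \<Rightarrow> complex ^ 'n"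
      using that differentiable_on_compose[of "\<lambda>z :: complex ^ 'n. Re (z $ o')" S g] 
        differentiable_on_subset by blast
    have "(\<lambda>z :: complex ^ 'n. z $ r) differentiable_on S" for r
      by (rule bounded_linear_imp_differentiable_on) (rule bounded_linear_vec_nth)
    then have "(\<lambda>z. z $ \<iota> g *s g (Re (z $ o'))) differentiable_on S" if "g \<in> J" for g
      using that by (intro differentiable_on_vector_scalar_mult * diff)
    then have "(\<lambda>z. \<Sum>g\<in>J. z $ \<iota> g *s g (Re (z $ o'))) differentiable_on S"
      using J(1) unfolding differentiable_on_def by (intro ballI differentiable_sum) auto
    then show ?thesis unfolding \<Phi>_def 
      by (intro differentiable_on_diff * diff)
  qed
  ultimately have neg: "negligible (\<Phi> ` S)"
    by (intro negligible_differentiable_image_negligible) auto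
  show ?thesis
  proof (rule negligible_subset[OF neg], clarify)
    fix q t assume "f t + q \<in> vec.span ((\<lambda>g. g t) ` J)"
    then obtain u where u: "f t + q = (\<Sum>g\<in>J. u g *s g t)"
      using in_span_image_iff[OF J(1), of "f t + q" "\<lambda>g. g t"] by blast
    define z :: "complex ^ 'n" where "z = (\<chi> r. if r = o' then of_real t else u (inv_into J \<iota> r))"
    have "z $ o' = of_real t" by (simp add: z_def)
    moreover have "z $ \<iota> g = u g" if "g \<in> J" for g
      using that \<iota> o' by (auto simp: z_def)
    ultimately have "\<Phi> z = q" "z \<in> S"
      using u by (auto simp: \<Phi>_def S_def inner_axis' algebra_simps)
    then show "q \<in> \<Phi> ` S" by blast
  qed
qed

text \<open>A real curve of complex hyperplanes sweeps out a set of real codimension at least one.\<close>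

lemma generic_vector:
  fixes F :: "(real \<Rightarrow> complex ^ 'n) set"
  assumes "finite F" "\<And>f. f \<in> F \<Longrightarrow> f differentiable_on UNIV" "\<epsilon> > 0"
  shows "\<exists>q. norm q < \<epsilon> \<and> (\<forall>t. \<forall>J\<subseteq>F. \<forall>f\<in>F. vec.span ((\<lambda>g. g t) ` J) \<noteq> UNIV \<longrightarrow>
    f t + q \<notin> vec.span ((\<lambda>g. g t) ` J))"
proof -
  define \<J> where "\<J> = {J \<in> Pow F. card J < CARD('n)}"
  define B where "B = (\<Union>J\<in>\<J>. \<Union>f\<in>F. {q. \<exists>t. f t + q \<in> vec.span ((\<lambda>g. g t) ` J)})"
  have "negligible B"
    unfolding B_def
  proof (intro negligible_Union finite_imageI ballI, goal_cases)
    case 1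
    then show ?case using assms(1) by (simp add: \<J>_def)
  next
    case (2 X)
    then obtain J where J: "J \<subseteq> F" "card J < CARD('n)"
      and X: "X = (\<Union>f\<in>F. {q. \<exists>t. f t + q \<in> vec.span ((\<lambda>g. g t) ` J)})"
      by (auto simp: \<J>_def)
    have "negligible {q. \<exists>t. f t + q \<in> vec.span ((\<lambda>g. g t) ` J)}" if "f \<in> F" for f
      using that J assms(1,2) by (intro negligible_moving_span) (auto intro: finite_subset)
    then show ?case unfolding X using assms(1) by (intro negligible_Union) auto
  qed
  moreover have "\<not> negligible (ball 0 \<epsilon> :: (complex ^ 'n) set)"
    using assms(3) by (intro open_not_negligible) auto
  ultimately obtain q where q: "q \<in> ball 0 \<epsilon>" "q \<notin> B"
    by (meson negligible_subset subsetI)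
  have "f t + q \<notin> vec.span ((\<lambda>g. g t) ` J)"
    if "J \<subseteq> F" "f \<in> F" "vec.span ((\<lambda>g. g t) ` J) \<noteq> UNIV" for t J f
  proof -
    \<comment> \<open>\<open>J\<close> may have many members and still fail to span at time
      \<open>t\<close>. Thinning it to a \<open>K\<close> that is independent at \<open>t\<close>
      leads to one of the finitely many small families collected in \<open>B\<close>; that
      \<open>K\<close> depends on \<open>t\<close> does no harm.\<close>
    obtain C where C: "C \<subseteq> (\<lambda>g. g t) ` J" "vec.independent C" "vec.span C = vec.span ((\<lambda>g. g t) ` J)"
    proof -
      obtain C where C: "C \<subseteq> (\<lambda>g. g t) ` J" "vec.independent C" "(\<lambda>g. g t) ` J \<subseteq> vec.span C"
        using vec.maximal_independent_subset[of "(\<lambda>g. g t) ` J"] by blast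
      then have "vec.span C = vec.span ((\<lambda>g. g t) ` J)"
        by (intro subset_antisym vec.span_mono vec.span_minimal vec.subspace_span)
      with C that show ?thesis by blast
    qed
    obtain K where K: "K \<subseteq> J" "C = (\<lambda>g. g t) ` K" "inj_on (\<lambda>g. g t) K"
      using C(1) by (meson subset_image_inj)
    have "card K = card C" using K card_image by metis
    also have "\<dots> = vec.dim C" using C(2) by (simp add: vec.dim_eq_card_independent)
    also have "\<dots> < vec.dim (UNIV :: (complex ^ 'n) set)"
      using C(3) that(3) vec.dim_psubset[of C UNIV] by auto
    finally have "card K < CARD('n)" by (simp add: vec.dim_UNIV card_cart_basis)
    then have "K \<in> \<J>" using K(1) that(1) by (auto simp: \<J>_def)
    then have "f t + q \<notin> vec.span C" using q(2) that(2) K(2) by (auto simp: B_def)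
    then show ?thesis using C(3) by simp
  qed
  then show ?thesis using q(1) by (intro exI[of _ q]) auto
qed

lemma scaleR_vec_conv_scale: "r *\<^sub>R v = complex_of_real r *s v"
  unfolding vec_eq_iff vector_scaleR_component vector_smult_component
  by (simp add: scaleR_conv_of_real)

lemma linear_imp_bounded_linear:
  assumes "Vector_Spaces.linear (*s) (*s) (f :: complex ^ 'n \<Rightarrow> complex ^ 'm)"
  shows "bounded_linear f"
proof -
  interpret f: Vector_Spaces.linear "(*s)" "(*s)" f by (rule assms)
  have "linear f"
    by (intro linearI) (simp_all add: f.add f.scale scaleR_vec_conv_scale)
  then show ?thesis by (simp add: linear_conv_bounded_linear)
qed

text \<open>Add finitely many constant curves spanning a complement of \<open>E\<close>, and project along it.\<close>

lemma generic_vector_in_subspace: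
  fixes F :: "(real \<Rightarrow> complex ^ 'n) set"
  assumes E: "vec.subspace E" and F: "finite F" "\<And>f. f \<in> F \<Longrightarrow> f differentiable_on UNIV"
    and FE: "\<And>f t. f \<in> F \<Longrightarrow> f t \<in> E" and "\<epsilon> > 0"
  shows "\<exists>p\<in>E. norm p < \<epsilon> \<and> (\<forall>t. \<forall>J\<subseteq>F. \<forall>f\<in>F. vec.span ((\<lambda>g. g t) ` J) \<noteq> E \<longrightarrow>
    f t + p \<notin> vec.span ((\<lambda>g. g t) ` J))"
proof -
  obtain B where B: "B \<subseteq> E" "vec.independent B" "vec.span B = E"
  proof -
    obtain B where B: "B \<subseteq> E" "vec.independent B" "E \<subseteq> vec.span B"
      using vec.maximal_independent_subset[of E] by blast
    then have "vec.span B = E" using E by (intro subset_antisym vec.span_minimal)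
    with B that show ?thesis by blast
  qed
  obtain C where C: "B \<subseteq> C" "vec.independent C" "vec.span C = UNIV"
    using B(2) vec.extend_basis_superset vec.independent_extend_basis vec.span_extend_basis by metis
  define D where "D = C - B"
  obtain \<pi> :: "complex ^ 'n \<Rightarrow> complex ^ 'n" where \<pi>: "Vector_Spaces.linear (*s) (*s) \<pi>"
    "\<And>x. x \<in> C \<Longrightarrow> \<pi> x = (if x \<in> B then x else 0)"
    using vec.linear_independent_extend[OF C(2), of "\<lambda>x. if x \<in> B then x else 0"] by blast
  interpret \<pi>: Vector_Spaces.linear "(*s)" "(*s)" \<pi> by (rule \<pi>(1))
  have \<pi>E: "\<pi> x = x" if "x \<in> E" for x
  proof (rule vec.linear_eq_on[OF \<pi>(1) vec.linear_ident])
    show "x \<in> vec.span B" using that B(3) by simp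
  qed (use \<pi>(2) C(1) in auto)
  have \<pi>D: "\<pi> x = 0" if "x \<in> vec.span D" for x
    by (rule vec.linear_eq_on[OF \<pi>(1) vec.linear_zero that]) (use \<pi>(2) in \<open>auto simp: D_def\<close>)
  have split: "\<exists>e d. x = e + d \<and> e \<in> E \<and> d \<in> vec.span D" for x
  proof -
    have "B \<union> D = C" using C(1) by (auto simp: D_def)
    then have "x \<in> vec.span (B \<union> D)" using C(3) by simp
    then show ?thesis using B(3) by (auto simp: vec.span_Un)
  qed
  have \<pi>_range: "\<pi> x \<in> E" "x - \<pi> x \<in> vec.span D" for x
  proof -
    obtain e d where "x = e + d" "e \<in> E" "d \<in> vec.span D" using split by blast
    then show "\<pi> x \<in> E" "x - \<pi> x \<in> vec.span D"
      using \<pi>E \<pi>D by (simp_all add: \<pi>.add)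
  qed
  \<comment> \<open>The projection can lengthen vectors by a factor up to \<open>K\<close>, so
    \<open>q\<close> is chosen smaller than \<open>\<epsilon> / K\<close>.\<close>
  obtain K where K: "K > 0" "\<And>x. norm (\<pi> x) \<le> norm x * K"
    using bounded_linear.pos_bounded[OF linear_imp_bounded_linear[OF \<pi>(1)]] by blast
  let ?F = "F \<union> (\<lambda>d t. d) ` D"
  have fin: "finite C" using C vec.finiteI_independent by blast
  have "finite ?F" using fin F(1) by (simp add: D_def)
  moreover have "f differentiable_on UNIV" if "f \<in> ?F" for f
    using that F(2) by (auto simp: differentiable_on_const)
  moreover have "\<epsilon> / K > 0" using \<open>\<epsilon> > 0\<close> K by simp
  ultimately obtain q where q: "norm q < \<epsilon> / K"
    "\<forall>t. \<forall>J\<subseteq>?F. \<forall>f\<in>?F. vec.span ((\<lambda>g. g t) ` J) \<noteq> UNIV \<longrightarrow>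
       f t + q \<notin> vec.span ((\<lambda>g. g t) ` J)"
    using generic_vector[of ?F "\<epsilon> / K"] by blast
  have "norm (\<pi> q) < \<epsilon>"
    using K(2)[of q] q(1) K(1) by (simp add: pos_less_divide_eq)
  moreover have "f t + \<pi> q \<notin> vec.span ((\<lambda>g. g t) ` J)"
    if J: "J \<subseteq> F" "f \<in> F" "vec.span ((\<lambda>g. g t) ` J) \<noteq> E" for t J f
  proof
    assume *: "f t + \<pi> q \<in> vec.span ((\<lambda>g. g t) ` J)"
    let ?J = "J \<union> (\<lambda>d t. d) ` D"
    have im: "(\<lambda>g. g t) ` ?J = (\<lambda>g. g t) ` J \<union> D" by (auto simp: image_Un image_image)
    have JE: "vec.span ((\<lambda>g. g t) ` J) \<subseteq> E"
      using J(1) FE E by (intro vec.span_minimal) auto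
    \<comment> \<open>Enlarging \<open>J\<close> by \<open>D\<close> absorbs the difference of
      \<open>q\<close> and \<open>\<pi> q\<close>. As \<open>q\<close> is generic, the enlarged
      family must span everything, and projecting to \<open>E\<close> shows that \<open>J\<close>
      alone spans \<open>E\<close>.\<close>
    have "f t + q = (f t + \<pi> q) + (q - \<pi> q)" by simp
    then have "f t + q \<in> vec.span ((\<lambda>g. g t) ` ?J)"
      unfolding im vec.span_Un using * \<pi>_range(2) by blast
    then have full: "vec.span ((\<lambda>g. g t) ` ?J) = UNIV"
      using q(2)[rule_format, of ?J f t] J by blast
    have "E \<subseteq> vec.span ((\<lambda>g. g t) ` J)"
    proof
      fix x assume x: "x \<in> E"
      have "x \<in> vec.span ((\<lambda>g. g t) ` J \<union> D)" using full im by simp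
      then obtain y d where yd: "x = y + d" "y \<in> vec.span ((\<lambda>g. g t) ` J)" "d \<in> vec.span D"
        by (auto simp: vec.span_Un)
      then have "\<pi> x = \<pi> y + \<pi> d" by (simp add: \<pi>.add)
      then have "x = y" using x yd JE \<pi>E \<pi>D by auto
      then show "x \<in> vec.span ((\<lambda>g. g t) ` J)" using yd by simp
    qed
    then show False using JE J(3) by blast
  qed
  ultimately show ?thesis using \<pi>_range(1) by blast
qed

text \<open>Used in two ways: \<open>f = 0\<close> yields one constant vector outside all proper
  spans at all times, and \<open>f\<close> a given curve yields a small constant translation that
  moves the curve off them.\<close>

corollary generic_vector_for_family:
  fixes x :: "'b \<Rightarrow> real \<Rightarrow> complex ^ 'n"
  assumes "vec.subspace E" "finite I" "\<epsilon> > 0"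
    and "\<And>c. c \<in> I \<Longrightarrow> x c differentiable_on UNIV" "f differentiable_on UNIV"
    and "\<And>c t. c \<in> I \<Longrightarrow> x c t \<in> E" "\<And>t. f t \<in> E"
  shows "\<exists>p\<in>E. norm p < \<epsilon> \<and> (\<forall>t. \<forall>J\<subseteq>I. vec.span ((\<lambda>c. x c t) ` J) \<noteq> E \<longrightarrow>
    f t + p \<notin> vec.span ((\<lambda>c. x c t) ` J))"
proof -
  have "\<exists>p\<in>E. norm p < \<epsilon> \<and> (\<forall>t. \<forall>K\<subseteq>insert f (x ` I). \<forall>g\<in>insert f (x ` I).
    vec.span ((\<lambda>g. g t) ` K) \<noteq> E \<longrightarrow> g t + p \<notin> vec.span ((\<lambda>g. g t) ` K))"
    using assms by (intro generic_vector_in_subspace) auto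
  then obtain p where p: "p \<in> E" "norm p < \<epsilon>" "\<forall>t. \<forall>K\<subseteq>insert f (x ` I). \<forall>g\<in>insert f (x ` I).
    vec.span ((\<lambda>g. g t) ` K) \<noteq> E \<longrightarrow> g t + p \<notin> vec.span ((\<lambda>g. g t) ` K)"
    by blast
  have "f t + p \<notin> vec.span ((\<lambda>c. x c t) ` J)" if "J \<subseteq> I" "vec.span ((\<lambda>c. x c t) ` J) \<noteq> E" for t J
    using p(3)[rule_format, of "x ` J" f t] that by (auto simp: image_image)
  with p(1,2) show ?thesis by blast
qed

subsection \<open>Configurations spanned by families of vectors\<close>

definition block :: "nat \<Rightarrow> nat \<Rightarrow> nat set" where
  "block k j = {j * k..<j * k + k}"

lemma finite_block [simp]: "finite (block k j)" and card_block [simp]: "card (block k j) = k"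
  by (auto simp: block_def)

lemma block_eq_image: "block k j = (\<lambda>a. j * k + a) ` {..<k}"
  by (simp add: block_def lessThan_atLeast0 add.commute)

lemma block_subset: 
  assumes "j < h"
  shows "block k j \<subseteq> {..<h * k}"
proof -
  have "Suc j * k \<le> h * k" using assms by (intro mult_le_mono1) simp
  then show ?thesis by (auto simp: block_def)
qed

lemma mem_block: "c \<in> block k (c div k)" if "k > 0"
  using that div_mult_mod_eq[of c k] mod_less_divisor[of k c] unfolding block_def
  by (metis atLeastLessThan_iff le_add1 nat_add_left_cancel_less)

lemma mem_block_iff: "c \<in> block k j \<longleftrightarrow> k > 0 \<and> c div k = j"
proof
  assume *: "c \<in> block k j"
  then have "k > 0" by (auto simp: block_def)
  moreover have "c div k = j"
    using * by (intro div_nat_eqI) (auto simp: block_def mult.commute)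
  ultimately show "k > 0 \<and> c div k = j" ..
qed (use mem_block in blast)

lemma UN_block: "(\<Union>j<h. block k j) = {..<h * k}"
proof (cases "k = 0")
  case False
  then show ?thesis
    by (auto simp: mem_block_iff div_less_iff_less_mult)
qed (auto simp: block_def)

text \<open>Restricted because the points of a \<open>product_topology\<close> are extensional
  functions.\<close>

definition config_of :: "nat \<Rightarrow> nat \<Rightarrow> (nat \<Rightarrow> complex ^ 'n) \<Rightarrow> nat \<Rightarrow> (complex ^ 'n) set" where
  "config_of h k x = (\<lambda>j\<in>{..<h}. vec.span (x ` block k j))"

text \<open>The families that represent points of the configuration space, see
  \<open>good_frames_iff\<close>; the dimension of the sum is read off from all vectors
  together.\<close>

definition good_frames :: "nat \<Rightarrow> nat \<Rightarrow> nat \<Rightarrow> (nat \<Rightarrow> complex ^ 'n) \<Rightarrow> bool" where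
  "good_frames h i k x \<longleftrightarrow> (\<forall>j<h. indep (block k j) x) \<and>
     (\<forall>j<h. \<forall>l<h. j \<noteq> l \<longrightarrow> vec.span (x ` block k j) \<noteq> vec.span (x ` block k l)) \<and>
     vec.dim (x ` {..<h * k}) = i"

lemma sum_span:
  "(\<Sum>j<(h::nat). vec.span (B j)) = vec.span (\<Union>j<h. B j :: (complex ^ 'n) set)"
proof (induction h)
  case 0
  then show ?case by (simp add: set_zero)
next
  case (Suc h)
  have "(\<Union>j<Suc h. B j) = (\<Union>j<h. B j) \<union> B h" by (auto simp: less_Suc_eq)
  with Suc show ?case by (auto simp: vec.span_Un set_plus_def)
qed

lemma sum_config_of:
  "(\<Sum>j<h. config_of h k x j) = vec.span (x ` {..<h * k})"
proof -
  have "(\<Sum>j<h. config_of h k x j) = (\<Sum>j<h. vec.span (x ` block k j))"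
    by (simp add: config_of_def)
  also have "\<dots> = vec.span (\<Union>j<h. x ` block k j)" by (rule sum_span)
  also have "(\<Union>j<h. x ` block k j) = x ` {..<h * k}" by (simp flip: UN_block add: image_UN)
  finally show ?thesis .
qed

lemma topspace_grassmann_config:
  "topspace (grassmann_config h i k :: (nat \<Rightarrow> (complex ^ 'n) set) topology) =
    {H \<in> {..<h} \<rightarrow>\<^sub>E Gr k. inj_on H {..<h} \<and> vec.dim (\<Sum>j<h. H j) = i}"
  by (auto simp: grassmann_config_def)

lemma span_in_Gr: "indep J x \<Longrightarrow> card J = k \<Longrightarrow> vec.span (x ` J) \<in> Gr k"
  using dim_indep[of J x] by (simp add: Gr_def)

lemma config_of_in_topspace:
  assumes "good_frames h i k (x :: nat \<Rightarrow> complex ^ 'n)"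
  shows "config_of h k x \<in> topspace (grassmann_config h i k)"
proof -
  have "inj_on (config_of h k x) {..<h}"
    using assms unfolding inj_on_def good_frames_def config_of_def by auto
  moreover have "config_of h k x \<in> {..<h} \<rightarrow>\<^sub>E Gr k"
    using assms span_in_Gr unfolding good_frames_def config_of_def by fastforce
  moreover have "vec.dim (\<Sum>j<h. config_of h k x j) = i"
    using assms unfolding sum_config_of by (simp add: good_frames_def)
  ultimately show ?thesis unfolding topspace_grassmann_config by blast
qed

lemma continuous_map_span_block:
  assumes "\<And>c. c \<in> block k j \<Longrightarrow> continuous_map X euclidean (\<lambda>t. x t c)"
    and "\<And>t. t \<in> topspace X \<Longrightarrow> indep (block k j) (x t :: nat \<Rightarrow> complex ^ 'n)"
  shows "continuous_map X (grassmannian k) (\<lambda>t. vec.span (x t ` block k j))"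
proof -
  \<comment> \<open>The block is shifted to start at 0 and made extensional, to become a point of
    \<open>frames k\<close>.\<close>
  let ?v = "\<lambda>t. \<lambda>a\<in>{..<k}. x t (j * k + a)"
  have ind: "indep {..<k} (?v t)" if "t \<in> topspace X" for t
  proof -
    have "indep (block k j) (x t)" using assms(2) that .
    then have "indep {..<k} (\<lambda>a. x t (j * k + a))"
      by (subst indep_bij_betw[of _ _ "block k j"]) (auto simp: bij_betw_def block_eq_image inj_on_def)
    then show ?thesis using indep_cong[of "{..<k}" "?v t" "\<lambda>a. x t (j * k + a)"] by simp
  qed
  have "continuous_map X (product_topology (\<lambda>_. euclidean) {..<k}) ?v"
    unfolding continuous_map_componentwise
    using assms(1) by (auto simp: block_eq_image)
  then have "continuous_map X (frames k) ?v"
    unfolding frames_def continuous_map_in_subtopology using ind by (auto simp: indep_def)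
  then have "continuous_map X (grassmannian k) (span_frame k \<circ> ?v)"
    using continuous_map_compose quotient_imp_continuous_map[OF quotient_map_span_frame] by blast
  moreover have "span_frame k \<circ> ?v = (\<lambda>t. vec.span (x t ` block k j))"
  proof
    fix t
    have "?v t ` {..<k} = x t ` block k j" by (auto simp: block_eq_image)
    then show "(span_frame k \<circ> ?v) t = vec.span (x t ` block k j)" by (simp add: span_frame_def)
  qed
  ultimately show ?thesis by simp
qed

lemma continuous_map_config_of:
  assumes "\<And>c. c < h * k \<Longrightarrow> continuous_map X euclidean (\<lambda>t. x t c)"
    and "\<And>t. t \<in> topspace X \<Longrightarrow> good_frames h i k (x t :: nat \<Rightarrow> complex ^ 'n)"
  shows "continuous_map X (grassmann_config h i k) (\<lambda>t. config_of h k (x t))"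
proof -
  have "continuous_map X (grassmannian k) (\<lambda>t. vec.span (x t ` block k j))" if "j < h" for j
    using that assms block_subset[OF that, of k]
    by (intro continuous_map_span_block) (auto simp: good_frames_def)
  then have "continuous_map X (product_topology (\<lambda>_. grassmannian k) {..<h}) (\<lambda>t. config_of h k (x t))"
    unfolding continuous_map_componentwise by (auto simp: config_of_def)
  moreover have "config_of h k (x t) \<in> topspace (grassmann_config h i k)" if "t \<in> topspace X" for t
    using config_of_in_topspace assms(2) that by blast
  ultimately show ?thesis
    unfolding grassmann_config_def continuous_map_in_subtopology by auto
qed

text \<open>The flag \<open>b\<close> distinguishes loops (\<open>T = {0..1}\<close>) from mere pairs of points (\<open>T = {0, 1}\<close>),
  so that one contraction argument yields both simple connectedness and path-connectedness.\<close>

abbreviation config_homotopic ::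
  "nat \<Rightarrow> nat \<Rightarrow> nat \<Rightarrow> bool \<Rightarrow> real set \<Rightarrow> (real \<Rightarrow> nat \<Rightarrow> (complex ^ 'n) set) \<Rightarrow>
   (real \<Rightarrow> nat \<Rightarrow> (complex ^ 'n) set) \<Rightarrow> bool" where
  "config_homotopic h i k b T \<equiv>
    homotopic_with (\<lambda>r. b \<longrightarrow> r 0 = r 1) (top_of_set T) (grassmann_config h i k)"

lemma config_homotopicI:
  fixes x :: "real \<Rightarrow> real \<Rightarrow> nat \<Rightarrow> complex ^ 'n"
  assumes T: "0 \<in> T" "1 \<in> T"
    and cont: "\<And>c. c < h * k \<Longrightarrow> continuous_on ({0..1} \<times> T) (\<lambda>z. x (fst z) (snd z) c)"
    and good: "\<And>s t. s \<in> {0..1} \<Longrightarrow> t \<in> T \<Longrightarrow> good_frames h i k (x s t)"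
    and loop: "\<And>s. b \<Longrightarrow> s \<in> {0..1} \<Longrightarrow> config_of h k (x s 0) = config_of h k (x s 1)"
    and "\<And>t. t \<in> T \<Longrightarrow> p t = config_of h k (x 0 t)"
    and "\<And>t. t \<in> T \<Longrightarrow> q t = config_of h k (x 1 t)"
  shows "config_homotopic h i k b T p q"
proof (subst homotopic_with)
  let ?h = "\<lambda>z. config_of h k (x (fst z) (snd z))"
  have "continuous_map (top_of_set ({0..1} \<times> T)) (grassmann_config h i k) ?h"
    using cont good by (intro continuous_map_config_of) auto
  then have "continuous_map (prod_topology (top_of_set {0..1}) (top_of_set T)) (grassmann_config h i k) ?h"
    by (simp only: prod_topology_subtopology_eu)
  moreover have "\<forall>t\<in>T. ?h (0, t) = p t" "\<forall>t\<in>T. ?h (1, t) = q t"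
    "\<forall>s\<in>{0..1}. b \<longrightarrow> ?h (s, 0) = ?h (s, 1)"
    using assms(6,7) loop by simp_all
  ultimately have "continuous_map (prod_topology (top_of_set {0..1}) (top_of_set T)) (grassmann_config h i k) ?h \<and>
      (\<forall>t\<in>T. ?h (0, t) = p t) \<and> (\<forall>t\<in>T. ?h (1, t) = q t) \<and> (\<forall>s\<in>{0..1}. b \<longrightarrow> ?h (s, 0) = ?h (s, 1))"
    by (intro conjI)
  then show "\<exists>g. continuous_map (prod_topology (top_of_set {0..1}) (top_of_set T)) (grassmann_config h i k) g \<and>
      (\<forall>t\<in>topspace (top_of_set T). g (0, t) = p t) \<and> (\<forall>t\<in>topspace (top_of_set T). g (1, t) = q t) \<and>
      (\<forall>s\<in>{0..1::real}. b \<longrightarrow> g (s, 0) = g (s, 1))"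
    unfolding topspace_euclidean_subtopology by (rule exI[where x = ?h])
qed (use T in auto)

lemma config_of_cong:
  assumes "\<And>c. c < h * k \<Longrightarrow> x c = y c"
  shows "config_of h k x = config_of h k y"
proof -
  have "x ` block k j = y ` block k j" if "j < h" for j
    using block_subset[OF that, of k] assms by (intro image_cong) auto
  then show ?thesis unfolding config_of_def by (intro restrict_ext) simp
qed

lemma span_image_upd_scale:
  fixes x :: "'b \<Rightarrow> complex ^ 'n"
  assumes "a \<noteq> 0"
  shows "vec.span ((x(n := a *s x n)) ` B) = vec.span (x ` B)"
proof -
  have "vec.span ((x(n := a *s x n)) ` B) \<subseteq> vec.span (x ` B)" for a x
    by (intro vec.span_minimal vec.subspace_span) (auto intro: vec.span_base vec.span_scale)
  from this[of x a] this[of "x(n := a *s x n)" "inverse a"] assms show ?thesis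
    by (auto simp: fun_upd_idem)
qed

lemma config_of_upd_scale:
  "a \<noteq> 0 \<Longrightarrow> config_of h k (x(n := a *s x n)) = config_of h k x"
  unfolding config_of_def by (intro restrict_ext span_image_upd_scale)

subsection \<open>Contraction of smooth families\<close>

lemma span_neq_if_dim_less: "vec.dim S < vec.dim E \<Longrightarrow> vec.span S \<noteq> E"
  using vec.dim_span by (metis less_irrefl)

lemma dim_image_le_card: "finite J \<Longrightarrow> vec.dim (x ` J :: (complex ^ 'n) set) \<le> card J"
  by (meson card_image_le finite_imageI order_trans vec.dim_le_card vec.span_superset)

lemma span_eq_if_indep:
  fixes x :: "'b \<Rightarrow> complex ^ 'n"
  assumes "vec.subspace E" "x ` J \<subseteq> E" "indep J x" "card J = vec.dim E"
  shows "vec.span (x ` J) = E"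
proof (rule vec.subspace_dim_equal)
  show "vec.span (x ` J) \<subseteq> E" using assms by (intro vec.span_minimal)
qed (use assms dim_indep[OF assms(3)] in auto)

lemma good_frames_if_indep:
  assumes "k > 0" "indep {..<h * k} (x :: nat \<Rightarrow> complex ^ 'n)"
  shows "good_frames h (h * k) k x"
  unfolding good_frames_def
proof (intro conjI allI impI)
  fix j assume j: "j < h"
  show "indep (block k j) x" using assms(2) block_subset[OF j] by (rule indep_mono)
  fix l assume l: "l < h" "j \<noteq> l"
  define c where "c = j * k"
  have c: "c \<in> block k j" using assms(1) by (simp add: c_def block_def)
  have "x c \<notin> vec.span (x ` ({..<h * k} - {c}))"
    using assms(2) indep_remove[of c "{..<h * k}" x] c block_subset[OF j, of k] by auto
  moreover have "vec.span (x ` block k l) \<subseteq> vec.span (x ` ({..<h * k} - {c}))"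
    using block_subset[OF l(1), of k] c l(2) by (intro vec.span_mono image_mono) (auto simp: mem_block_iff)
  moreover have "x c \<in> vec.span (x ` block k j)" using c by (intro vec.span_base) auto
  ultimately show "vec.span (x ` block k j) \<noteq> vec.span (x ` block k l)" by blast
qed (use dim_indep[OF assms(2)] in simp)

section \<open>Contraction when all \<open>h k\<close> vectors are independent\<close>

lemma continuous_on_fst_snd:
  assumes "continuous_on T f"
  shows "continuous_on (A \<times> T) (\<lambda>z. f (snd z))"
  by (rule continuous_on_compose2[OF assms continuous_on_snd]) (auto intro: continuous_on_id)

lemma contract_independent:
  fixes m :: "nat \<Rightarrow> real \<Rightarrow> complex ^ 'n"
  assumes T: "0 \<in> T" "1 \<in> T" and k: "k > 0"
    and E: "vec.subspace E" "vec.dim E = h * k"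
    and diff: "\<And>c. c < h * k \<Longrightarrow> m c differentiable_on UNIV"
    and mE: "\<And>c t. c < h * k \<Longrightarrow> m c t \<in> E"
    and ind: "\<And>t. t \<in> T \<Longrightarrow> indep {..<h * k} (\<lambda>c. m c t)"
    and loop: "\<And>c. b \<Longrightarrow> m c 0 = m c 1"
  shows "\<exists>a. config_homotopic h (h * k) k b T (\<lambda>t. config_of h k (\<lambda>c. m c t)) (\<lambda>_. a)"
proof -
  let ?N = "h * k"
  have "\<exists>p. (\<forall>c<n. p c \<in> E) \<and> (\<forall>t\<in>T. indep {..<?N} (\<lambda>c. if c < n then p c else m c t)) \<and>
      config_homotopic h ?N k b T (\<lambda>t. config_of h k (\<lambda>c. m c t))
        (\<lambda>t. config_of h k (\<lambda>c. if c < n then p c else m c t))" if "n \<le> ?N" for n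
    using that
  proof (induction n)
    case 0
    have "continuous_map (top_of_set T) (grassmann_config h ?N k) (\<lambda>t. config_of h k (\<lambda>c. m c t))"
      using diff ind k
      by (intro continuous_map_config_of good_frames_if_indep)
        (auto intro: continuous_on_subset[OF differentiable_imp_continuous_on])
    then show ?case using ind loop by (auto simp: homotopic_with_refl)
  next
    case (Suc n)
    then obtain p where p: "\<forall>c<n. p c \<in> E" 
      "\<And>t. t \<in> T \<Longrightarrow> indep {..<?N} (\<lambda>c. if c < n then p c else m c t)"
      "config_homotopic h ?N k b T (\<lambda>t. config_of h k (\<lambda>c. m c t))
        (\<lambda>t. config_of h k (\<lambda>c. if c < n then p c else m c t))" by auto
    define x where "x = (\<lambda>t c. if c < n then p c else m c t)"
    have n: "n < ?N" using Suc.prems by simp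
    have xE: "x t c \<in> E" if "c < ?N" for t c using that mE p(1) by (auto simp: x_def)
    have xdiff: "(\<lambda>t. x t c) differentiable_on UNIV" if "c < ?N" for c
      using that diff by (cases "c < n") (auto simp: x_def differentiable_on_const)
    then have xcont: "continuous_on T (\<lambda>t. x t c)" if "c < ?N" for c
      using that by (meson continuous_on_subset differentiable_imp_continuous_on subset_UNIV)
    have xind: "indep {..<?N} (x t)" if "t \<in> T" for t using p(2) that by (simp add: x_def)
    let ?J = "{..<?N} - {n}"
    \<comment> \<open>The vector \<open>x t n\<close> is left out of the family: the others number
      one less than the dimension of \<open>E\<close>, so they never span \<open>E\<close> and
      \<open>q\<close> avoids their span at all times.\<close>
    have "\<exists>q\<in>E. norm q < 1 \<and> (\<forall>t. \<forall>J\<subseteq>?J. vec.span ((\<lambda>c. x t c) ` J) \<noteq> E \<longrightarrow>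
        0 + q \<notin> vec.span ((\<lambda>c. x t c) ` J))"
      using xdiff xE E(1)
      by (intro generic_vector_for_family) (auto simp: vec.subspace_0 differentiable_on_const)
    then obtain q where q: "q \<in> E" "\<forall>t. \<forall>J\<subseteq>?J. vec.span ((\<lambda>c. x t c) ` J) \<noteq> E \<longrightarrow>
        0 + q \<notin> vec.span ((\<lambda>c. x t c) ` J)" by blast
    have qJ: "q \<notin> vec.span (x t ` ?J)" for t
    proof -
      have "vec.dim (x t ` ?J) < vec.dim E"
        using dim_image_le_card[of ?J "x t"] n E(2) by simp
      then have "vec.span (x t ` ?J) \<noteq> E" by (rule span_neq_if_dim_less)
      then show ?thesis using q(2) by simp
    qed
    define y where "y = (\<lambda>t. (x t)(n := q))"
    have yJ: "y t ` ?J = x t ` ?J" for t by (auto simp: y_def)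
    have ins: "insert n ?J = {..<?N}" using n by auto
    have yind: "indep {..<?N} (y t)" if "t \<in> T" for t
    proof -
      have "indep ?J (x t)" using xind[OF that] by (rule indep_mono) auto
      then have "indep ?J (y t)" by (subst indep_cong[of _ _ "x t"]) (auto simp: y_def)
      then have "indep (insert n ?J) (y t)" using qJ yJ by (subst indep_insert) (auto simp: y_def)
      then show ?thesis using ins by simp
    qed
    \<comment> \<open>The choice depends on \<open>t\<close> only through \<open>x t n\<close> and
      \<open>y t\<close>, so it takes the same value at 0 and 1 for a loop.\<close>
    define u where "u = (\<lambda>t. SOME u. x t n = (\<Sum>c<?N. u c *s y t c))"
    have u: "x t n = (\<Sum>c<?N. u t c *s y t c)" if "t \<in> T" for t
    proof -
      have "vec.span (y t ` {..<?N}) = E"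
        using yind[OF that] E xE q(1) by (intro span_eq_if_indep) (auto simp: y_def)
      then have "x t n \<in> vec.span (y t ` {..<?N})" using xE n by auto
      then have "\<exists>u. x t n = (\<Sum>c<?N. u c *s y t c)" by (subst (asm) in_span_image_iff) auto
      then show ?thesis unfolding u_def by (rule someI_ex)
    qed
    define coef where "coef = (\<lambda>t. u t n)"
    have coefcont: "continuous_on T coef"
      unfolding coef_def using n
    proof (intro continuous_on_coefficients[of "{..<?N}" T y "\<lambda>t. x t n" u n] xcont yind u)
      fix c assume "c \<in> {..<?N}"
      then show "continuous_on T (\<lambda>t. y t c)"
        using xcont by (cases "c = n") (auto simp: y_def)
    qed auto
    have split: "x t n = coef t *s q + (\<Sum>c\<in>?J. u t c *s x t c)" if "t \<in> T" for t
    proof -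
      have "(\<Sum>c<?N. u t c *s y t c) = u t n *s y t n + (\<Sum>c\<in>?J. u t c *s y t c)"
        using n by (intro sum.remove) auto
      also have "(\<Sum>c\<in>?J. u t c *s y t c) = (\<Sum>c\<in>?J. u t c *s x t c)"
        by (intro sum.cong) (auto simp: y_def)
      finally show ?thesis using u[OF that] by (simp add: coef_def y_def)
    qed
    have w: "(\<Sum>c\<in>?J. u t c *s x t c) \<in> vec.span (x t ` ?J)" for t
      by (intro vec.span_sum vec.span_scale vec.span_base) auto
    have xn: "x t n \<notin> vec.span (x t ` ?J)" if "t \<in> T" for t
      using xind[OF that] n indep_remove[of n "{..<?N}" "x t"] by simp
    have coef0: "coef t \<noteq> 0" if "t \<in> T" for t
      using split[OF that] xn[OF that] w[of t] by auto
    \<comment> \<open>Without the division the component along \<open>q\<close>, modulo the other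
      vectors, would be \<open>(1 - s) coef t + s\<close>, which vanishes for some \<open>s\<close>
      when \<open>coef t\<close> is a negative real. The division does not change the configuration
      at \<open>s = 0\<close>.\<close>
    define X where "X = (\<lambda>s t. (x t)(n := of_real (1 - s) *s (inverse (coef t) *s x t n) + of_real s *s q))"
    have Xind: "indep {..<?N} (X s t)" if "t \<in> T" for s t
    proof -
      let ?w = "\<Sum>c\<in>?J. u t c *s x t c"
      have "inverse (coef t) *s x t n = q + inverse (coef t) *s ?w"
        using split[OF that] coef0[OF that] by (simp add: vec.scale_right_distrib)
      moreover have "of_real (1 - s) *s (q + v) + of_real s *s q = q + of_real (1 - s) *s v" for v
        by (simp add: vec_eq_iff algebra_simps)
      ultimately have "X s t n = q + of_real (1 - s) *s (inverse (coef t) *s ?w)"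
        by (simp only: X_def fun_upd_same)
      moreover have "of_real (1 - s) *s (inverse (coef t) *s ?w) \<in> vec.span (x t ` ?J)"
        using w by (intro vec.span_scale)
      ultimately have "X s t n \<notin> vec.span (x t ` ?J)"
        using qJ[of t] by (simp only: vec.span_add_eq2 not_False_eq_True)
      moreover have "X s t ` ?J = x t ` ?J" by (auto simp: X_def)
      moreover have "indep ?J (X s t)"
      proof -
        have "indep ?J (x t)" using xind[OF that] by (rule indep_mono) auto
        then show ?thesis by (subst indep_cong[of _ _ "x t"]) (auto simp: X_def)
      qed
      ultimately have "indep (insert n ?J) (X s t)" by (subst indep_insert) auto
      then show ?thesis using ins by simp
    qed
    have "config_homotopic h ?N k b T (\<lambda>t. config_of h k (x t)) (\<lambda>t. config_of h k (y t))"
    proof (rule config_homotopicI[of T h k X ?N b, OF T])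
      fix c assume c: "c < ?N"
      have "continuous_on ({0..1} \<times> T) (\<lambda>z. x (snd z) c)" by (rule continuous_on_fst_snd[OF xcont[OF c]])
      moreover have "continuous_on ({0..1} \<times> T) (\<lambda>z. complex_of_real (1 - fst z) *s (inverse (coef (snd z)) *s x (snd z) n) + complex_of_real (fst z) *s q)"
        using coef0 by (intro continuous_intros continuous_on_fst_snd xcont n coefcont) auto
      ultimately show "continuous_on ({0..1} \<times> T) (\<lambda>z. X (fst z) (snd z) c)"
        by (cases "c = n") (simp_all add: X_def)
    next
      fix s t :: real assume "t \<in> T"
      then show "good_frames h ?N k (X s t)" using Xind good_frames_if_indep k by blast
    next
      fix s :: real assume b
      then have "x 0 = x 1" using loop by (auto simp: x_def)
      then have "y 0 = y 1" by (simp only: y_def)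
      with \<open>x 0 = x 1\<close> have "u 0 = u 1" by (simp only: u_def)
      with \<open>x 0 = x 1\<close> have "X s 0 = X s 1" by (simp add: X_def coef_def)
      then show "config_of h k (X s 0) = config_of h k (X s 1)" by simp
    next
      fix t assume "t \<in> T"
      then show "config_of h k (x t) = config_of h k (X 0 t)"
        using config_of_upd_scale[of "inverse (coef t)" h k "x t" n] coef0 by (simp add: X_def)
      show "config_of h k (y t) = config_of h k (X 1 t)"
        by (simp add: X_def y_def)
    qed
    then have "config_homotopic h ?N k b T (\<lambda>t. config_of h k (\<lambda>c. m c t)) (\<lambda>t. config_of h k (y t))"
      using p(3) homotopic_with_trans unfolding x_def by blast
    moreover have "y t = (\<lambda>c. if c < Suc n then (p(n := q)) c else m c t)" for t
      by (auto simp: y_def x_def)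
    ultimately show ?case
      using yind q(1) p(1) by (intro exI[of _ "p(n := q)"]) (auto simp: less_Suc_eq)
  qed
  from this[of ?N] obtain p where
    "config_homotopic h ?N k b T (\<lambda>t. config_of h k (\<lambda>c. m c t))
        (\<lambda>t. config_of h k (\<lambda>c. if c < ?N then p c else m c t))" by auto
  moreover have "config_of h k (\<lambda>c. if c < ?N then p c else m c t) = config_of h k p" for t
    by (rule config_of_cong) simp
  ultimately show ?thesis by auto
qed

text \<open>Linear general position inside a space of dimension \<open>i\<close>. With
  \<open>card J = i\<close> instead, the condition would be vacuous for fewer than \<open>i\<close>
  vectors, through which the induction in \<open>generic_perturbation\<close> passes.\<close>

definition generic_frames :: "nat \<Rightarrow> nat \<Rightarrow> (nat \<Rightarrow> complex ^ 'n) \<Rightarrow> bool" where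
  "generic_frames N i x \<longleftrightarrow> (\<forall>J\<subseteq>{..<N}. card J \<le> i \<longrightarrow> indep J x)"

lemma indep_move:
  fixes x :: "'b \<Rightarrow> complex ^ 'n"
  assumes x: "indep I x" and n: "n \<in> I" and p: "p \<notin> vec.span (x ` I)"
  shows "indep I (x(n := of_real (1 - s) *s x n + of_real s *s p))"
proof -
  define y where "y = x(n := of_real (1 - s) *s x n + of_real s *s p)"
  let ?J = "I - {n}"
  have xn: "indep ?J x" "x n \<notin> vec.span (x ` ?J)" using x n indep_remove[of n I x] by auto
  then have "indep ?J y" by (subst indep_cong[of _ _ x]) (auto simp: y_def)
  moreover have "y n \<notin> vec.span (x ` ?J)"
  proof
    assume *: "y n \<in> vec.span (x ` ?J)"
    show False
    proof (cases "s = 0")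
      case True
      then show False using * xn by (simp add: y_def)
    next
      case False
      have "y n \<in> vec.span (x ` I)"
        using * vec.span_mono[of "x ` ?J" "x ` I"] by blast
      moreover have "x n \<in> vec.span (x ` I)" using n by (intro vec.span_base) auto
      ultimately have "inverse (of_real s) *s (y n - of_real (1 - s) *s x n) \<in> vec.span (x ` I)"
        by (intro vec.span_scale vec.span_diff)
      moreover have "inverse (of_real s) *s (y n - of_real (1 - s) *s x n) = p"
        using False by (simp add: y_def)
      ultimately show False using p by simp
    qed
  qed
  moreover have "y ` ?J = x ` ?J" by (auto simp: y_def)
  ultimately have "indep (insert n ?J) y" by (subst indep_insert) auto
  then show ?thesis using n by (simp add: insert_absorb y_def)
qed

text \<open>General position is claimed only at the end of the segment. In between, the moving
  vector may fall into the span of \<open>i - 1\<close> others, so \<open>good_frames\<close> has to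
  be checked there directly.\<close>

lemma good_frames_move:
  fixes x :: "nat \<Rightarrow> complex ^ 'n"
  assumes k: "2 \<le> k" "k < i" "i < h * k" and E: "vec.subspace E" "vec.dim E = i"
    and xE: "\<And>c. c < h * k \<Longrightarrow> x c \<in> E" and gen: "generic_frames (h * k) i x"
    and p: "p \<in> E" "\<And>J. J \<subseteq> {..<h * k} \<Longrightarrow> vec.span (x ` J) \<noteq> E \<Longrightarrow> p \<notin> vec.span (x ` J)"
    and n: "n < h * k"
  shows "generic_frames (h * k) i (x(n := p))"
    and "good_frames h i k (x(n := of_real (1 - s) *s x n + of_real s *s p))"
proof -
  let ?N = "h * k"
  have dimJ: "p \<notin> vec.span (x ` J)" if "J \<subseteq> {..<?N}" "card J < i" for J
  proof -
    have "finite J" using that finite_subset by blast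
    then have "vec.dim (x ` J) < vec.dim E"
      using dim_image_le_card[of J x] that E(2) by linarith
    then show ?thesis using p(2)[OF that(1)] span_neq_if_dim_less by blast
  qed
  have ind: "indep J x" if "J \<subseteq> {..<?N}" "card J \<le> i" for J
    using gen that by (simp add: generic_frames_def)
  show "generic_frames (h * k) i (x(n := p))"
    unfolding generic_frames_def
  proof (intro allI impI)
    fix J assume J: "J \<subseteq> {..<?N}" "card J \<le> i"
    show "indep J (x(n := p))"
    proof (cases "n \<in> J")
      case True
      have fin: "finite J" using J finite_subset by blast
      let ?J = "J - {n}"
      have *: "?J \<subseteq> {..<?N}" "card ?J < i"
        using J True fin k by (auto simp: card_Diff_singleton)
      have "indep ?J (x(n := p))"
        using ind[of ?J] * by (subst indep_cong[of _ _ x]) auto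
      moreover have "(x(n := p)) ` ?J = x ` ?J" by auto
      ultimately show ?thesis
        using dimJ[OF *] True by (subst indep_remove[of n]) auto
    next
      case False
      then show ?thesis using ind[OF J] by (subst indep_cong[of _ _ x]) auto
    qed
  qed
  define y where "y = x(n := of_real (1 - s) *s x n + of_real s *s p)"
  have yJ: "y ` J = x ` J" if "n \<notin> J" for J using that by (auto simp: y_def)
  have yc: "y c = x c" if "c \<noteq> n" for c using that by (simp add: y_def)
  have yblock: "indep (block k j) y" if j: "j < h" for j
  proof (cases "n \<in> block k j")
    case True
    have "indep (block k j) x" using ind block_subset[OF j] k by simp
    then show ?thesis
      unfolding y_def using True dimJ[OF block_subset[OF j]] k by (intro indep_move) auto
  next
    case False
    have "indep (block k j) x" using ind block_subset[OF j] k by simp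
    then show ?thesis using False by (subst indep_cong[of _ _ x]) (auto simp: y_def)
  qed
  \<comment> \<open>A vector \<open>d \<noteq> n\<close> of block \<open>j\<close> together with
    block \<open>l\<close> makes \<open>k + 1 \<le> i\<close> vectors, none of them moving, hence
    independent. By symmetry it is enough that one of the two disjoint blocks omits
    \<open>n\<close>.\<close>
  have separate: "vec.span (y ` block k j) \<noteq> vec.span (y ` block k l)"
    if jl: "j < h" "l < h" "j \<noteq> l" "n \<notin> block k l" for j l
  proof -
    have "\<not> block k j \<subseteq> {n}"
      using k card_mono[of "{n}" "block k j"] by auto
    then obtain d where d: "d \<in> block k j" "d \<noteq> n" by blast
    have dl: "d \<notin> block k l" using d jl by (auto simp: mem_block_iff)
    have "indep (insert d (block k l)) x"
      using block_subset[OF jl(1), of k] block_subset[OF jl(2), of k] d dl k by (intro ind) auto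
    then have "x d \<notin> vec.span (x ` block k l)" using dl by (simp add: indep_insert)
    then have "y d \<notin> vec.span (y ` block k l)" using d jl(4) yJ yc by simp
    moreover have "y d \<in> vec.span (y ` block k j)" using d by (intro vec.span_base) auto
    ultimately show ?thesis by metis
  qed
  have dim: "vec.dim (y ` {..<?N}) = i"
  proof (rule antisym)
    have "y n \<in> E"
      unfolding y_def fun_upd_same using xE[OF n] p(1) E(1)
      by (intro vec.subspace_add vec.subspace_scale)
    then have "y c \<in> E" if "c < ?N" for c
      using that xE yc by (cases "c = n") auto
    then show "vec.dim (y ` {..<?N}) \<le> i" using E(2) vec.dim_subset[of "y ` {..<?N}" E] by auto
    have "i \<le> card ({..<?N} - {n})" using k n by simp
    then obtain J where J: "J \<subseteq> {..<?N} - {n}" "card J = i" by (meson obtain_subset_with_card_n)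
    have "vec.dim (x ` J) = i" using dim_indep[of J x] ind[of J] J by auto
    moreover have "y ` J = x ` J" using J(1) by (intro yJ) auto
    ultimately show "i \<le> vec.dim (y ` {..<?N})"
      using vec.dim_subset[of "y ` J" "y ` {..<?N}"] J(1) by auto
  qed
  have "vec.span (y ` block k j) \<noteq> vec.span (y ` block k l)" if "j < h" "l < h" "j \<noteq> l" for j l
  proof (cases "n \<in> block k l")
    case True
    then have "n \<notin> block k j" using that by (auto simp: mem_block_iff)
    then show ?thesis using separate[of l j] that by metis
  qed (use separate that in blast)
  with yblock dim show "good_frames h i k (x(n := of_real (1 - s) *s x n + of_real s *s p))"
    unfolding good_frames_def y_def by blast
qed

lemma contract_generic:
  fixes m :: "nat \<Rightarrow> real \<Rightarrow> complex ^ 'n"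
  assumes T: "0 \<in> T" "1 \<in> T" and k: "2 \<le> k" "k < i" "i < h * k"
    and E: "vec.subspace E" "vec.dim E = i"
    and diff: "\<And>c. c < h * k \<Longrightarrow> m c differentiable_on UNIV"
    and mE: "\<And>c t. c < h * k \<Longrightarrow> m c t \<in> E"
    and gen: "\<And>t. t \<in> T \<Longrightarrow> generic_frames (h * k) i (\<lambda>c. m c t)"
    and good: "\<And>t. t \<in> T \<Longrightarrow> good_frames h i k (\<lambda>c. m c t)"
    and loop: "\<And>c. b \<Longrightarrow> m c 0 = m c 1"
  shows "\<exists>a. config_homotopic h i k b T (\<lambda>t. config_of h k (\<lambda>c. m c t)) (\<lambda>_. a)"
proof -
  let ?N = "h * k"
  have "\<exists>p. (\<forall>c<n. p c \<in> E) \<and> (\<forall>t\<in>T. generic_frames ?N i (\<lambda>c. if c < n then p c else m c t)) \<and>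
      config_homotopic h i k b T (\<lambda>t. config_of h k (\<lambda>c. m c t))
        (\<lambda>t. config_of h k (\<lambda>c. if c < n then p c else m c t))" if "n \<le> ?N" for n
    using that
  proof (induction n)
    case 0
    have "continuous_map (top_of_set T) (grassmann_config h i k) (\<lambda>t. config_of h k (\<lambda>c. m c t))"
      using diff good
      by (intro continuous_map_config_of)
        (auto intro: continuous_on_subset[OF differentiable_imp_continuous_on])
    then show ?case using gen loop by (auto simp: homotopic_with_refl)
  next
    case (Suc n)
    then obtain p where p: "\<forall>c<n. p c \<in> E" 
      "\<And>t. t \<in> T \<Longrightarrow> generic_frames ?N i (\<lambda>c. if c < n then p c else m c t)"
      "config_homotopic h i k b T (\<lambda>t. config_of h k (\<lambda>c. m c t))
        (\<lambda>t. config_of h k (\<lambda>c. if c < n then p c else m c t))" by auto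
    define x where "x = (\<lambda>t c. if c < n then p c else m c t)"
    have n: "n < ?N" using Suc.prems by simp
    have xE: "x t c \<in> E" if "c < ?N" for t c using that mE p(1) by (auto simp: x_def)
    have xdiff: "(\<lambda>t. x t c) differentiable_on UNIV" if "c < ?N" for c
      using that diff by (cases "c < n") (auto simp: x_def differentiable_on_const)
    then have xcont: "continuous_on T (\<lambda>t. x t c)" if "c < ?N" for c
      using that by (meson continuous_on_subset differentiable_imp_continuous_on subset_UNIV)
    have xgen: "generic_frames ?N i (x t)" if "t \<in> T" for t using p(2) that by (simp add: x_def)
    \<comment> \<open>Now \<open>J\<close> may contain the moving index \<open>n\<close>, as
      \<open>indep_move\<close> requires.\<close>
    have "\<exists>q\<in>E. norm q < 1 \<and> (\<forall>t. \<forall>J\<subseteq>{..<?N}. vec.span ((\<lambda>c. x t c) ` J) \<noteq> E \<longrightarrow>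
        0 + q \<notin> vec.span ((\<lambda>c. x t c) ` J))"
      using xdiff xE E(1)
      by (intro generic_vector_for_family) (auto simp: vec.subspace_0 differentiable_on_const)
    then obtain q where q: "q \<in> E" "\<And>t J. J\<subseteq>{..<?N} \<Longrightarrow> vec.span (x t ` J) \<noteq> E \<Longrightarrow>
        q \<notin> vec.span (x t ` J)" by auto
    define X where "X = (\<lambda>s t. (x t)(n := of_real (1 - s) *s x t n + of_real s *s q))"
    have "config_homotopic h i k b T (\<lambda>t. config_of h k (x t)) (\<lambda>t. config_of h k ((x t)(n := q)))"
    proof (rule config_homotopicI[of T h k X i b, OF T])
      fix c assume c: "c < ?N"
      have "continuous_on ({0..1} \<times> T) (\<lambda>z. x (snd z) c)"
        by (rule continuous_on_fst_snd[OF xcont[OF c]])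
      moreover have "continuous_on ({0..1} \<times> T) (\<lambda>z. complex_of_real (1 - fst z) *s x (snd z) n + complex_of_real (fst z) *s q)"
        by (intro continuous_intros continuous_on_fst_snd xcont n)
      ultimately show "continuous_on ({0..1} \<times> T) (\<lambda>z. X (fst z) (snd z) c)"
        by (cases "c = n") (simp_all add: X_def)
    next
      fix s t :: real assume "t \<in> T"
      then show "good_frames h i k (X s t)"
        unfolding X_def using k E xE xgen q n by (intro good_frames_move(2)[of k i h E]) auto
    next
      fix s :: real assume b
      then have "x 0 = x 1" using loop by (auto simp: x_def)
      then show "config_of h k (X s 0) = config_of h k (X s 1)" by (simp add: X_def)
    qed (simp_all add: X_def)
    then have "config_homotopic h i k b T (\<lambda>t. config_of h k (\<lambda>c. m c t)) (\<lambda>t. config_of h k ((x t)(n := q)))"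
      using p(3) homotopic_with_trans unfolding x_def by blast
    moreover have "(x t)(n := q) = (\<lambda>c. if c < Suc n then (p(n := q)) c else m c t)" for t
      by (auto simp: x_def)
    moreover have "generic_frames ?N i ((x t)(n := q))" if "t \<in> T" for t
      using k E xE xgen q n that by (intro good_frames_move(1)[of k i h E]) auto
    ultimately show ?case
      using q(1) p(1) by (intro exI[of _ "p(n := q)"]) (auto simp: less_Suc_eq)
  qed
  from this[of ?N] obtain p where
    "config_homotopic h i k b T (\<lambda>t. config_of h k (\<lambda>c. m c t))
        (\<lambda>t. config_of h k (\<lambda>c. if c < ?N then p c else m c t))" by auto
  moreover have "config_of h k (\<lambda>c. if c < ?N then p c else m c t) = config_of h k p" for t
    by (rule config_of_cong) simp
  ultimately show ?thesis by auto
qed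

text \<open>Each new curve is translated off the spans of fewer than \<open>i\<close> of the
  earlier, already translated ones; these spans are proper in \<open>E\<close>. The translations are
  constant in \<open>t\<close>, so loops stay loops.\<close>

lemma generic_perturbation:
  fixes m :: "nat \<Rightarrow> real \<Rightarrow> complex ^ 'n"
  assumes E: "vec.subspace E" "vec.dim E = i" and "\<epsilon> > 0"
    and diff: "\<And>c. c < N \<Longrightarrow> m c differentiable_on UNIV"
    and mE: "\<And>c t. c < N \<Longrightarrow> m c t \<in> E"
  shows "\<exists>p. (\<forall>c<N. p c \<in> E \<and> norm (p c) < \<epsilon>) \<and> (\<forall>t. generic_frames N i (\<lambda>c. m c t + p c))"
proof -
  have "\<exists>p. (\<forall>c<n. p c \<in> E \<and> norm (p c) < \<epsilon>) \<and> (\<forall>t. generic_frames n i (\<lambda>c. m c t + p c))"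
    if "n \<le> N" for n
    using that
  proof (induction n)
    case 0
    then show ?case by (auto simp: generic_frames_def)
  next
    case (Suc n)
    then obtain p where p: "\<forall>c<n. p c \<in> E \<and> norm (p c) < \<epsilon>" "\<And>t. generic_frames n i (\<lambda>c. m c t + p c)"
      by auto
    have "\<exists>q\<in>E. norm q < \<epsilon> \<and> (\<forall>t. \<forall>J\<subseteq>{..<n}. vec.span ((\<lambda>c. m c t + p c) ` J) \<noteq> E \<longrightarrow>
        m n t + q \<notin> vec.span ((\<lambda>c. m c t + p c) ` J))"
      using diff mE p(1) Suc.prems E(1) \<open>\<epsilon> > 0\<close>
      by (intro generic_vector_for_family[of E "{..<n}" \<epsilon> "\<lambda>c t. m c t + p c"])
        (auto intro!: differentiable_on_add differentiable_on_const vec.subspace_add)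
    then obtain q where q: "q \<in> E" "norm q < \<epsilon>" "\<And>t J. J\<subseteq>{..<n} \<Longrightarrow> vec.span ((\<lambda>c. m c t + p c) ` J) \<noteq> E \<Longrightarrow>
        m n t + q \<notin> vec.span ((\<lambda>c. m c t + p c) ` J)" by auto
    let ?p = "p(n := q)"
    have "generic_frames (Suc n) i (\<lambda>c. m c t + ?p c)" for t
      unfolding generic_frames_def
    proof (intro allI impI)
      fix J assume J: "J \<subseteq> {..<Suc n}" "card J \<le> i"
      let ?J = "J - {n}"
      have fin: "finite J" using J finite_subset by blast
      have sub: "?J \<subseteq> {..<n}" using J by auto
      have "card ?J \<le> i" using J(2) card_Diff1_le[of J n] by linarith
      then have "indep ?J (\<lambda>c. m c t + p c)" using p(2) sub by (simp add: generic_frames_def)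
      then have ind: "indep ?J (\<lambda>c. m c t + ?p c)"
        by (subst indep_cong[of _ _ "\<lambda>c. m c t + p c"]) auto
      show "indep J (\<lambda>c. m c t + ?p c)"
      proof (cases "n \<in> J")
        case True
        then have "card ?J < i" using fin J(2) card_Diff1_less[of J n] by linarith
        then have "vec.dim ((\<lambda>c. m c t + p c) ` ?J) < vec.dim E"
          using dim_image_le_card[of ?J "\<lambda>c. m c t + p c"] fin E(2) by simp
        then have "m n t + q \<notin> vec.span ((\<lambda>c. m c t + p c) ` ?J)"
          using q(3)[OF sub] span_neq_if_dim_less by blast
        moreover have "(\<lambda>c. m c t + ?p c) ` ?J = (\<lambda>c. m c t + p c) ` ?J" by auto
        ultimately show ?thesis using True ind by (subst indep_remove[of n]) auto
      next
        case False
        then show ?thesis using ind by simp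
      qed
    qed
    then show ?case using p(1) q(1,2) by (intro exI[of _ ?p]) (auto simp: less_Suc_eq)
  qed
  then show ?thesis by blast
qed

subsection \<open>Contraction of continuous families\<close>

lemma indep_if_dim_eq_card:
  fixes x :: "'b \<Rightarrow> complex ^ 'n"
  assumes "finite J" "vec.dim (x ` J) = card J"
  shows "indep J x"
proof -
  have "card (x ` J) \<le> card J" using assms(1) by (rule card_image_le)
  moreover have "vec.dim (x ` J) \<le> card (x ` J)"
    using assms(1) by (intro vec.dim_le_card vec.span_superset) auto
  ultimately have *: "card (x ` J) = card J" using assms(2) by simp
  then have "inj_on x J" using assms(1) by (simp add: eq_card_imp_inj_on)
  moreover have "vec.independent (x ` J)"
    using assms * vec.card_le_dim_spanning[of "x ` J" "x ` J"] by (auto intro: vec.span_base)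
  ultimately show ?thesis by (simp add: indep_def)
qed

lemma obtain_indep_spanning:
  fixes x :: "'b \<Rightarrow> complex ^ 'n"
  obtains J where "J \<subseteq> I" "indep J x" "vec.span (x ` J) = vec.span (x ` I)"
proof -
  obtain C where C: "C \<subseteq> x ` I" "vec.independent C" "x ` I \<subseteq> vec.span C"
    using vec.maximal_independent_subset[of "x ` I"] by blast
  obtain J where J: "J \<subseteq> I" "C = x ` J" "inj_on x J"
    using C(1) by (meson subset_image_inj)
  have "vec.span C = vec.span (x ` I)"
    using C by (intro subset_antisym vec.span_mono vec.span_minimal vec.subspace_span)
  then show ?thesis using that[of J] J C by (simp add: indep_def)
qed

lemma span_image_eq_if_subset:
  fixes x :: "'b \<Rightarrow> complex ^ 'n"
  assumes "indep I x" "indep J x" "card I = card J" "x ` I \<subseteq> vec.span (x ` J)"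
  shows "vec.span (x ` I) = vec.span (x ` J)"
proof (rule span_eq_if_indep)
  show "card I = vec.dim (vec.span (x ` J))" using assms dim_indep[OF assms(2)] by simp
qed (use assms in auto)

text \<open>All requirements but one are certified by independent subfamilies: two blocks differ
  because one of them stays independent after adding a vector of the other, and the dimension is at
  least \<open>i\<close> because of \<open>i\<close> independent vectors. The upper bound on the
  dimension has no such certificate and comes from \<open>E\<close>.\<close>

lemma good_frames_mono:
  fixes x y :: "nat \<Rightarrow> complex ^ 'n"
  assumes E: "vec.subspace E" "vec.dim E = i" and x: "good_frames h i k x"
    and xy: "\<And>J. J \<subseteq> {..<h * k} \<Longrightarrow> indep J x \<Longrightarrow> indep J y"
    and yE: "\<And>c. c < h * k \<Longrightarrow> y c \<in> E"
  shows "good_frames h i k y"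
  unfolding good_frames_def
proof (intro conjI allI impI)
  have block: "indep (block k j) x" "block k j \<subseteq> {..<h * k}" if "j < h" for j
    using x that block_subset[OF that] by (auto simp: good_frames_def)
  show "indep (block k j) y" if "j < h" for j
    using block that xy by blast
  show "vec.span (y ` block k j) \<noteq> vec.span (y ` block k l)" if jl: "j < h" "l < h" "j \<noteq> l" for j l
  proof -
    have "\<not> x ` block k j \<subseteq> vec.span (x ` block k l)"
      using span_image_eq_if_subset[of "block k j" x "block k l"] block jl x
      by (auto simp: good_frames_def)
    then obtain d where d: "d \<in> block k j" "x d \<notin> vec.span (x ` block k l)" by blast
    then have dl: "d \<notin> block k l" by (auto intro: vec.span_base)
    have "indep (insert d (block k l)) y"
      using d dl block jl by (intro xy) (auto simp: indep_insert)
    then have "y d \<notin> vec.span (y ` block k l)" using dl by (simp add: indep_insert)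
    moreover have "y d \<in> vec.span (y ` block k j)" using d by (intro vec.span_base) auto
    ultimately show ?thesis by metis
  qed
  show "vec.dim (y ` {..<h * k}) = i"
  proof (rule antisym)
    show "vec.dim (y ` {..<h * k}) \<le> i" using E yE vec.dim_subset[of "y ` {..<h * k}" E] by auto
    obtain J where J: "J \<subseteq> {..<h * k}" "indep J x" "vec.span (x ` J) = vec.span (x ` {..<h * k})"
      using obtain_indep_spanning by blast
    have "card J = i" using dim_indep[OF J(2)] J(3) x by (metis good_frames_def vec.dim_span)
    then have "vec.dim (y ` J) = i" using dim_indep xy J by metis
    then show "i \<le> vec.dim (y ` {..<h * k})"
      using vec.dim_subset[of "y ` J" "y ` {..<h * k}"] J(1) by auto
  qed
qed

lemma indep_open_all:
  fixes x :: "'b \<Rightarrow> complex ^ 'n"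
  assumes "finite I"
  shows "\<exists>\<epsilon>>0. \<forall>y. (\<forall>c\<in>I. dist (y c) (x c) < \<epsilon>) \<longrightarrow> (\<forall>J\<subseteq>I. indep J x \<longrightarrow> indep J y)"
proof -
  have "\<exists>\<epsilon>>0. \<forall>y. (\<forall>c\<in>I. dist (y c) (x c) < \<epsilon>) \<longrightarrow> indep J x \<longrightarrow> indep J y" if "J \<subseteq> I" for J
  proof (cases "indep J x")
    case True
    obtain \<epsilon> where "\<epsilon> > 0" "\<And>y. (\<And>c. c \<in> J \<Longrightarrow> dist (y c) (x c) < \<epsilon>) \<Longrightarrow> indep J y"
      using indep_open[OF True] by metis
    then show ?thesis using that by (intro exI[of _ \<epsilon>]) blast
  qed (auto intro: exI[of _ 1])
  then have "\<forall>J\<in>Pow I. \<exists>\<epsilon>>0. \<forall>y. (\<forall>c\<in>I. dist (y c) (x c) < \<epsilon>) \<longrightarrow> indep J x \<longrightarrow> indep J y" by blast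
  then obtain e where e: "\<And>J. J \<subseteq> I \<Longrightarrow> e J > 0 \<and> (\<forall>y. (\<forall>c\<in>I. dist (y c) (x c) < e J) \<longrightarrow> indep J x \<longrightarrow> indep J y)"
    unfolding Pow_iff bchoice_iff by blast
  define \<epsilon> where "\<epsilon> = Min (e ` Pow I)"
  have "\<epsilon> \<le> e J" if "J \<subseteq> I" for J unfolding \<epsilon>_def using assms that by (intro Min_le) auto
  moreover have "\<epsilon> > 0" unfolding \<epsilon>_def using assms e by (subst Min_gr_iff) auto
  ultimately show ?thesis using e by (intro exI[of _ \<epsilon>]) (meson less_le_trans)
qed

text \<open>A Lebesgue number argument: half of the local radius works for all nearby times, and
  finitely many times suffice.\<close>

lemma uniform_neighbourhood:
  fixes m :: "real \<Rightarrow> 'b \<Rightarrow> 'z::metric_space"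
  assumes T: "compact T" "finite I" and cont: "\<And>c. c \<in> I \<Longrightarrow> continuous_on T (\<lambda>t. m t c)"
    and loc: "\<And>t. t \<in> T \<Longrightarrow> \<exists>\<epsilon>>0. \<forall>y. (\<forall>c\<in>I. dist (y c) (m t c) < \<epsilon>) \<longrightarrow> G y"
  shows "\<exists>\<epsilon>>0. \<forall>t\<in>T. \<forall>y. (\<forall>c\<in>I. dist (y c) (m t c) < \<epsilon>) \<longrightarrow> G y"
proof -
  have "\<exists>\<epsilon> \<delta>. 0 < \<epsilon> \<and> 0 < \<delta> \<and> (\<forall>s\<in>T. dist s t < \<delta> \<longrightarrow> (\<forall>y. (\<forall>c\<in>I. dist (y c) (m s c) < \<epsilon>) \<longrightarrow> G y))"
    if t: "t \<in> T" for t
  proof -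
    obtain \<epsilon> where \<epsilon>: "\<epsilon> > 0" "\<And>y. (\<forall>c\<in>I. dist (y c) (m t c) < \<epsilon>) \<Longrightarrow> G y" using loc[OF t] by blast
    have "\<forall>c\<in>I. eventually (\<lambda>s. dist (m s c) (m t c) < \<epsilon> / 2) (at t within T)"
      using cont t \<epsilon>(1) by (intro ballI tendstoD) (auto simp: continuous_on_def)
    then have "eventually (\<lambda>s. \<forall>c\<in>I. dist (m s c) (m t c) < \<epsilon> / 2) (at t within T)"
      using T(2) by (simp add: eventually_ball_finite)
    then obtain \<delta> where \<delta>: "\<delta> > 0" "\<And>s. s \<in> T \<Longrightarrow> s \<noteq> t \<Longrightarrow> dist s t < \<delta> \<Longrightarrow> \<forall>c\<in>I. dist (m s c) (m t c) < \<epsilon> / 2"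
      unfolding eventually_at by blast
    have "G y" if "s \<in> T" "dist s t < \<delta>" "\<forall>c\<in>I. dist (y c) (m s c) < \<epsilon> / 2" for s y
    proof (rule \<epsilon>(2), rule ballI)
      fix c assume c: "c \<in> I"
      have "dist (m s c) (m t c) < \<epsilon> / 2" using \<delta>(2)[of s] that c \<epsilon>(1) by (cases "s = t") auto
      moreover have "dist (y c) (m s c) < \<epsilon> / 2" using that c by blast
      ultimately show "dist (y c) (m t c) < \<epsilon>"
        using dist_triangle[of "y c" "m t c" "m s c"] by linarith
    qed
    then show ?thesis using \<epsilon>(1) \<delta>(1) by (intro exI[of _ "\<epsilon> / 2"] exI[of _ \<delta>]) auto
  qed
  then obtain e d where ed: "\<And>t. t \<in> T \<Longrightarrow> 0 < e t" "\<And>t. t \<in> T \<Longrightarrow> 0 < d t"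
    "\<And>t s y. t \<in> T \<Longrightarrow> s \<in> T \<Longrightarrow> dist s t < d t \<Longrightarrow> (\<forall>c\<in>I. dist (y c) (m s c) < e t) \<Longrightarrow> G y"
    by metis
  have "T \<subseteq> (\<Union>t\<in>T. ball t (d t))" using ed(2) by force
  with T(1) obtain C where C: "C \<subseteq> T" "finite C" "T \<subseteq> (\<Union>t\<in>C. ball t (d t))"
    using compactE_image[of T T "\<lambda>t. ball t (d t)"] by auto
  \<comment> \<open>The 1 keeps the minimum meaningful when \<open>C\<close> is empty.\<close>
  define \<epsilon> where "\<epsilon> = Min (insert 1 (e ` C))"
  have "\<epsilon> > 0" unfolding \<epsilon>_def using C ed(1) by (subst Min_gr_iff) auto
  moreover have "\<epsilon> \<le> e t" if "t \<in> C" for t unfolding \<epsilon>_def using C that by (intro Min_le) auto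
  moreover have "\<exists>t\<in>C. dist s t < d t" if "s \<in> T" for s
  proof -
    have "s \<in> (\<Union>t\<in>C. ball t (d t))" using C(3) that by blast
    then show ?thesis by (auto simp: dist_commute)
  qed
  ultimately show ?thesis using ed(3) C(1) by (intro exI[of _ \<epsilon>]) (meson less_le_trans subsetD)
qed

text \<open>Extend from \<open>T\<close> to the line by Tietze, then approximate by a polynomial
  path. The exact values at 0 and 1 preserve loops; differentiability on the whole line is what the
  genericity results ask for.\<close>

lemma polynomial_approx_on:
  fixes f :: "real \<Rightarrow> 'a::euclidean_space"
  assumes "closed T" "T \<subseteq> {0..1}" "0 \<in> T" "1 \<in> T" "continuous_on T f" "\<epsilon> > 0"
  shows "\<exists>g. g differentiable_on UNIV \<and> g 0 = f 0 \<and> g 1 = f 1 \<and> (\<forall>t\<in>T. norm (g t - f t) < \<epsilon>)"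
proof -
  obtain f' where f': "continuous_on UNIV f'" "\<And>t. t \<in> T \<Longrightarrow> f' t = f t"
    using Tietze_unbounded[of T f UNIV] assms by auto
  have "path f'" using f'(1) continuous_on_subset by (auto simp: path_def)
  then obtain g where "polynomial_function g" "pathstart g = pathstart f'" "pathfinish g = pathfinish f'"
    "\<And>t. t \<in> {0..1} \<Longrightarrow> norm (g t - f' t) < \<epsilon>"
    using path_approx_polynomial_function[of f' \<epsilon>] assms(6) by metis
  moreover from this have "g differentiable_on UNIV"
    by (simp add: differentiable_on_polynomial_function)
  moreover have "\<And>t. t \<in> T \<Longrightarrow> t \<in> {0..1}" using assms(2) by blast
  ultimately show ?thesis using f'(2) assms(3,4)
    by (intro exI[of _ g]) (metis pathstart_def pathfinish_def)
qed

text \<open>If \<open>i = k\<close>, every block spans the whole sum, whereas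
  \<open>i < h * k\<close> then provides a second block, which must span something else.\<close>

lemma good_frames_bounds:
  assumes "good_frames h i k (x :: nat \<Rightarrow> complex ^ 'n)"
  shows "i \<le> h * k" and "i < h * k \<Longrightarrow> k < i"
proof -
  show "i \<le> h * k"
    using assms dim_image_le_card[of "{..<h * k}" x] by (simp add: good_frames_def)
  assume less: "i < h * k"
  let ?E = "vec.span (x ` {..<h * k})"
  have dimE: "vec.dim ?E = i" using assms by (simp add: good_frames_def)
  have block: "indep (block k j) x" "x ` block k j \<subseteq> ?E" if "j < h" for j
    using assms that block_subset[OF that, of k] by (auto simp: good_frames_def intro!: vec.span_base)
  have "h > 0" using less by (cases h) auto
  then have "k \<le> i"
    using dim_indep[OF block(1)[of 0]] vec.dim_subset[OF block(2)[of 0]] dimE by simp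
  moreover have "k \<noteq> i"
  proof
    assume "k = i"
    then have "1 < h" using less by (cases h; cases "h - 1") auto
    have "vec.span (x ` block k j) = ?E" if "j < h" for j
      using block[OF that] \<open>k = i\<close> dimE by (intro span_eq_if_indep) auto
    then have "vec.span (x ` block k 0) = vec.span (x ` block k 1)" using \<open>1 < h\<close> by simp
    then show False using assms \<open>1 < h\<close> by (auto simp: good_frames_def)
  qed
  ultimately show "k < i" by simp
qed

text \<open>The sum is the constant space \<open>E\<close> spanned by \<open>P\<close>. Smoothing
  the coefficients rather than the vectors keeps the approximating curves inside
  \<open>E\<close>.\<close>

lemma contract_in_frame:
  fixes i :: nat and P :: "nat \<Rightarrow> complex ^ 'n" and B :: "nat \<Rightarrow> nat \<Rightarrow> real \<Rightarrow> complex"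
  defines "m \<equiv> \<lambda>t c. \<Sum>b<i. B c b t *s P b"
  assumes T: "compact T" "T \<subseteq> {0..1}" "0 \<in> T" "1 \<in> T" and k: "2 \<le> k"
    and P: "indep {..<i} P" and B: "\<And>c b. c < h * k \<Longrightarrow> b < i \<Longrightarrow> continuous_on T (B c b)"
    and good: "\<And>t. t \<in> T \<Longrightarrow> good_frames h i k (m t)"
    and loop: "\<And>c b. b' \<Longrightarrow> B c b 0 = B c b 1"
  shows "\<exists>a. config_homotopic h i k b' T (\<lambda>t. config_of h k (m t)) (\<lambda>_. a)"
proof -
  let ?N = "h * k"
  define E where "E = vec.span (P ` {..<i})"
  have E: "vec.subspace E" "vec.dim E = i"
    using dim_indep[OF P] by (simp_all add: E_def)
  have inE: "(\<Sum>b<i. u b *s P b) \<in> E" for u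
    unfolding E_def by (intro vec.span_sum vec.span_scale vec.span_base) auto
  have mcont: "continuous_on T (\<lambda>t. m t c)" if "c < ?N" for c
    unfolding m_def using B that by (intro continuous_intros) auto
  \<comment> \<open>Goodness is an open condition only among families in \<open>E\<close>, hence the
    implication in place of plain \<open>good_frames\<close>.\<close>
  have "\<exists>\<epsilon>>0. \<forall>t\<in>T. \<forall>y. (\<forall>c\<in>{..<?N}. dist (y c) (m t c) < \<epsilon>) \<longrightarrow>
      ((\<forall>c<?N. y c \<in> E) \<longrightarrow> good_frames h i k y)"
  proof (rule uniform_neighbourhood)
    fix t assume t: "t \<in> T"
    obtain \<epsilon> where "\<epsilon> > 0" "\<forall>y. (\<forall>c\<in>{..<?N}. dist (y c) (m t c) < \<epsilon>) \<longrightarrow> (\<forall>J\<subseteq>{..<?N}. indep J (m t) \<longrightarrow> indep J y)"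
      using indep_open_all[of "{..<?N}" "m t"] by auto
    then show "\<exists>\<epsilon>>0. \<forall>y. (\<forall>c\<in>{..<?N}. dist (y c) (m t c) < \<epsilon>) \<longrightarrow>
      ((\<forall>c<?N. y c \<in> E) \<longrightarrow> good_frames h i k y)"
      using good_frames_mono[OF E good[OF t]] by (intro exI[of _ \<epsilon>]) blast
  qed (use T mcont in auto)
  then obtain \<epsilon> where \<epsilon>: "\<epsilon> > 0"
    "\<And>t y. t \<in> T \<Longrightarrow> (\<And>c. c < ?N \<Longrightarrow> y c \<in> E \<and> dist (y c) (m t c) < \<epsilon>) \<Longrightarrow> good_frames h i k y"
    by blast
  \<comment> \<open>Errors below \<open>\<eta>\<close> in the coefficients amount to less than
    \<open>\<epsilon> / 2\<close> in each vector; the other half is reserved for the perturbation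
    \<open>p\<close>. Adding 1 keeps the denominator positive.\<close>
  define \<eta> where "\<eta> = \<epsilon> / (2 * (1 + (\<Sum>b<i. norm (P b))))"
  have pos: "1 + (\<Sum>b<i. norm (P b)) > 0" by (smt (verit) norm_ge_zero sum_nonneg)
  then have "\<eta> > 0" using \<epsilon>(1) by (simp add: \<eta>_def)
  define A where "A = (\<lambda>c b. SOME g. g differentiable_on UNIV \<and> g 0 = B c b 0 \<and> g 1 = B c b 1 \<and>
    (\<forall>t\<in>T. norm (g t - B c b t) < \<eta>))"
  have A: "A c b differentiable_on UNIV" "A c b 0 = B c b 0" "A c b 1 = B c b 1"
    "\<And>t. t \<in> T \<Longrightarrow> norm (A c b t - B c b t) < \<eta>" if "c < ?N" "b < i" for c b
  proof -
    have "\<exists>g. g differentiable_on UNIV \<and> g 0 = B c b 0 \<and> g 1 = B c b 1 \<and> (\<forall>t\<in>T. norm (g t - B c b t) < \<eta>)"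
      using T \<open>\<eta> > 0\<close> B[OF that] by (intro polynomial_approx_on) (auto simp: compact_imp_closed)
    from someI_ex[OF this] show "A c b differentiable_on UNIV" "A c b 0 = B c b 0" "A c b 1 = B c b 1"
      "\<And>t. t \<in> T \<Longrightarrow> norm (A c b t - B c b t) < \<eta>"
      by (auto simp: A_def)
  qed
  \<comment> \<open>The value 0 beyond \<open>?N\<close> makes the loop condition true for every
    index, as the contraction lemmas demand.\<close>
  define a where "a = (\<lambda>c t. if c < ?N then \<Sum>b<i. A c b t *s P b else 0)"
  have aE: "a c t \<in> E" for c t using inE E(1) by (auto simp: a_def vec.subspace_0)
  have adiff: "a c differentiable_on UNIV" if "c < ?N" for c
  proof -
    have "(\<lambda>t. A c b t *s P b) differentiable_on UNIV" if "b < i" for b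
      using A(1)[OF \<open>c < ?N\<close> that] by (intro differentiable_on_vector_scalar_mult differentiable_on_const)
    then have "(\<lambda>t. \<Sum>b<i. A c b t *s P b) differentiable_on UNIV"
      unfolding differentiable_on_def by (intro ballI differentiable_sum) auto
    then show ?thesis using that by (simp add: a_def)
  qed
  have aloop: "a c 0 = a c 1" if b' for c
    using A(2,3) loop[OF that] by (auto simp: a_def)
  have adist: "dist (a c t) (m t c) < \<epsilon> / 2" if "c < ?N" "t \<in> T" for c t
  proof -
    have "dist (a c t) (m t c) = norm (\<Sum>b<i. (A c b t - B c b t) *s P b)"
      using that by (simp add: a_def m_def dist_norm vec.scale_left_diff_distrib sum_subtractf)
    also have "\<dots> \<le> (\<Sum>b<i. \<eta> * norm (P b))"
    proof (rule sum_norm_le)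
      fix b assume "b \<in> {..<i}"
      then have "norm (A c b t - B c b t) \<le> \<eta>" using A(4)[OF that(1) _ that(2)] by (simp add: less_imp_le)
      then show "norm ((A c b t - B c b t) *s P b) \<le> \<eta> * norm (P b)"
        unfolding norm_vector_scalar_mult by (intro mult_right_mono) auto
    qed
    also have "\<dots> = \<eta> * (\<Sum>b<i. norm (P b))" by (simp add: sum_distrib_left)
    also have "\<dots> < \<eta> * (1 + (\<Sum>b<i. norm (P b)))" using \<open>\<eta> > 0\<close> by simp
    also have "\<dots> = \<epsilon> / 2" using pos by (simp add: \<eta>_def field_simps)
    finally show ?thesis .
  qed
  \<comment> \<open>Stated for any small \<open>p\<close>: zero is used when \<open>i = ?N\<close>,
    a perturbation into general position otherwise.\<close>
  have straight: "config_homotopic h i k b' T (\<lambda>t. config_of h k (m t)) (\<lambda>t. config_of h k (\<lambda>c. a c t + p c))"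
    and pgood: "\<And>t. t \<in> T \<Longrightarrow> good_frames h i k (\<lambda>c. a c t + p c)"
    if p: "\<And>c. c < ?N \<Longrightarrow> p c \<in> E \<and> norm (p c) < \<epsilon> / 2" for p
  proof -
    define X where "X = (\<lambda>s t c. m t c + of_real s *s (a c t + p c - m t c))"
    have X: "good_frames h i k (X s t)" if "t \<in> T" "s \<in> {0..1}" for s t
    proof (rule \<epsilon>(2)[OF that(1)], rule conjI)
      fix c assume c: "c < ?N"
      have "m t c \<in> E" using inE by (simp add: m_def)
      then show "X s t c \<in> E" unfolding X_def using aE p[OF c] E(1)
        by (intro vec.subspace_add vec.subspace_scale vec.subspace_diff) auto
      have "dist (X s t c) (m t c) = \<bar>s\<bar> * norm (a c t + p c - m t c)"
        by (simp only: X_def dist_norm add_diff_cancel_left' norm_vector_scalar_mult norm_of_real)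
      also have "\<dots> \<le> 1 * norm (a c t + p c - m t c)" using that by (intro mult_right_mono) auto
      also have "\<dots> \<le> dist (a c t) (m t c) + norm (p c)"
        using norm_triangle_ineq[of "a c t - m t c" "p c"] by (simp add: dist_norm algebra_simps)
      also have "\<dots> < \<epsilon>" using adist[OF c that(1)] p[OF c] by linarith
      finally show "dist (X s t c) (m t c) < \<epsilon>" .
    qed
    have X1: "X 1 t = (\<lambda>c. a c t + p c)" and X0: "X 0 t = m t" for t by (auto simp: X_def)
    show "good_frames h i k (\<lambda>c. a c t + p c)" if "t \<in> T" for t
      using X[OF that, of 1] by (simp add: X1)
    show "config_homotopic h i k b' T (\<lambda>t. config_of h k (m t)) (\<lambda>t. config_of h k (\<lambda>c. a c t + p c))"
    proof (rule config_homotopicI[of T h k X i b', OF T(3,4)])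
      fix c assume c: "c < ?N"
      have "continuous_on T (a c)"
        using adiff[OF c] by (meson continuous_on_subset differentiable_imp_continuous_on subset_UNIV)
      then show "continuous_on ({0..1} \<times> T) (\<lambda>z. X (fst z) (snd z) c)"
        unfolding X_def by (intro continuous_intros continuous_on_fst_snd[of T "\<lambda>t. m t c"] continuous_on_fst_snd[of T "a c"] mcont c)
    next
      fix s :: real assume b'
      then have "X s 0 c = X s 1 c" for c using aloop loop by (simp add: X_def m_def)
      then show "config_of h k (X s 0) = config_of h k (X s 1)" by presburger
    qed (use X in \<open>auto simp: X0 X1\<close>)
  qed
  have bounds: "i \<le> ?N" "i < ?N \<Longrightarrow> k < i" using good_frames_bounds good T(3) by blast+
  show ?thesis
  proof (cases "i = ?N")
    case True
    have ind: "indep {..<?N} (\<lambda>c. a c t)" if "t \<in> T" for t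
      using pgood[of "\<lambda>_. 0", OF _ that] \<epsilon>(1) E True
      by (intro indep_if_dim_eq_card) (auto simp: good_frames_def vec.subspace_0)
    have "\<exists>q. config_homotopic h ?N k b' T (\<lambda>t. config_of h k (\<lambda>c. a c t)) (\<lambda>_. q)"
      using T(3,4) k E True adiff aE ind aloop by (intro contract_independent[of T k E]) auto
    moreover have "config_homotopic h i k b' T (\<lambda>t. config_of h k (m t)) (\<lambda>t. config_of h k (\<lambda>c. a c t))"
      using straight[of "\<lambda>_. 0"] \<epsilon>(1) E(1) by (simp add: vec.subspace_0)
    ultimately show ?thesis using True homotopic_with_trans by blast
  next
    case False
    then have ki: "k < i" "i < ?N" using bounds by auto
    obtain p where p: "\<forall>c<?N. p c \<in> E \<and> norm (p c) < \<epsilon> / 2" "\<forall>t. generic_frames ?N i (\<lambda>c. a c t + p c)"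
      using generic_perturbation[OF E, of "\<epsilon> / 2" ?N a] \<epsilon>(1) adiff aE by auto
    have "\<exists>q. config_homotopic h i k b' T (\<lambda>t. config_of h k (\<lambda>c. a c t + p c)) (\<lambda>_. q)"
    proof (rule contract_generic[OF T(3,4) k ki E])
      show "(\<lambda>t. a c t + p c) differentiable_on UNIV" if "c < ?N" for c
        using adiff[OF that] by (intro differentiable_on_add differentiable_on_const)
      show "a c t + p c \<in> E" if "c < ?N" for c t
        using aE p(1) that E(1) by (intro vec.subspace_add) auto
      show "good_frames h i k (\<lambda>c. a c t + p c)" if "t \<in> T" for t
        using pgood p(1) that by blast
    qed (use p aloop in auto)
    then show ?thesis using straight[of p] p(1) homotopic_with_trans by blast
  qed
qed

section \<open>Exchanging the frame of the sum\<close>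

lemma good_frames_inj_linear:
  fixes x :: "nat \<Rightarrow> complex ^ 'n"
  assumes g: "Vector_Spaces.linear (*s) (*s) g" "inj g" and x: "good_frames h i k x"
  shows "good_frames h i k (\<lambda>c. g (x c) :: complex ^ 'n)"
  unfolding good_frames_def
proof (intro conjI allI impI)
  interpret g: Vector_Spaces.linear "(*s)" "(*s)" g by (rule g(1))
  have span: "vec.span ((\<lambda>c. g (x c)) ` J) = g ` vec.span (x ` J)" for J
    using g.span_image[of "x ` J"] by (simp add: image_image)
  show "indep (block k j) (\<lambda>c. g (x c))" if "j < h" for j
    using x that by (intro indep_inj_linear[OF g]) (simp add: good_frames_def)
  show "vec.span ((\<lambda>c. g (x c)) ` block k j) \<noteq> vec.span ((\<lambda>c. g (x c)) ` block k l)"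
    if "j < h" "l < h" "j \<noteq> l" for j l
    using x that unfolding span inj_image_eq_iff[OF g(2)] good_frames_def by blast
  obtain J where J: "indep J x" "vec.span (x ` J) = vec.span (x ` {..<h * k})"
    by (rule obtain_indep_spanning[of "{..<h * k}" x])
  have "indep J (\<lambda>c. g (x c))" by (rule indep_inj_linear[OF g J(1)])
  then have "vec.dim ((\<lambda>c. g (x c)) ` J) = vec.dim (x ` J)"
    using dim_indep[of J x] dim_indep[of J "\<lambda>c. g (x c)"] J(1) by simp
  moreover have "vec.span ((\<lambda>c. g (x c)) ` J) = vec.span ((\<lambda>c. g (x c)) ` {..<h * k})"
    unfolding span J(2) ..
  ultimately have "vec.dim ((\<lambda>c. g (x c)) ` {..<h * k}) = vec.dim (x ` {..<h * k})"
    using J(2) vec.dim_span[of "x ` J"] vec.dim_span[of "x ` {..<h * k}"]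
      vec.dim_span[of "(\<lambda>c. g (x c)) ` J"] vec.dim_span[of "(\<lambda>c. g (x c)) ` {..<h * k}"] by simp
  then show "vec.dim ((\<lambda>c. g (x c)) ` {..<h * k}) = i" using x by (simp add: good_frames_def)
qed

lemma good_frames_cong:
  assumes "\<And>c. c < h * k \<Longrightarrow> x c = y c"
  shows "good_frames h i k x \<longleftrightarrow> good_frames h i k y"
proof -
  have *: "x ` block k j = y ` block k j" "indep (block k j) x \<longleftrightarrow> indep (block k j) y" if "j < h" for j
    using assms block_subset[OF that, of k] by (auto intro!: image_cong indep_cong)
  have "x ` {..<h * k} = y ` {..<h * k}" using assms by (intro image_cong) auto
  with * show ?thesis unfolding good_frames_def by simp
qed

lemma linear_change_of_frame:
  fixes e e' :: "'b \<Rightarrow> complex ^ 'n"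
  assumes e: "indep I e" "indep I e'"
  shows "\<exists>g. Vector_Spaces.linear (*s) (*s) g \<and> inj g \<and>
    (\<forall>u. g (\<Sum>b\<in>I. u b *s e b) = (\<Sum>b\<in>I. u b *s e' b))"
proof -
  let ?f = "\<lambda>v. e' (inv_into I e v)"
  have f: "?f (e b) = e' b" if "b \<in> I" for b
    using e(1) that by (simp add: indep_def)
  have "vec.independent (e ` I)" "vec.independent (?f ` e ` I)" "inj_on ?f (e ` I)"
    using e f by (auto simp: indep_def image_image inj_on_def)
  then obtain g where g: "Vector_Spaces.linear (*s) (*s) g" "inj g" "\<forall>v\<in>e ` I. g v = ?f v"
    using vec.linear_independent_extend_inj[of "e ` I" ?f] by blast
  interpret g: Vector_Spaces.linear "(*s)" "(*s)" g by (rule g(1))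
  have "g (\<Sum>b\<in>I. u b *s e b) = (\<Sum>b\<in>I. u b *s e' b)" for u
    using g(3) f by (simp add: g.sum g.scale)
  then show ?thesis using g by blast
qed

text \<open>Some injective linear map carries \<open>e\<close> to \<open>e'\<close>, so goodness
  depends on the coefficients alone. Any motion of the frame through independent families is
  therefore admissible.\<close>

lemma good_frames_change_frame:
  fixes e e' :: "nat \<Rightarrow> complex ^ 'n"
  assumes e: "indep I e" "indep I e'" and good: "good_frames h i k (\<lambda>c. \<Sum>b\<in>I. u c b *s e b)"
  shows "good_frames h i k (\<lambda>c. \<Sum>b\<in>I. u c b *s e' b)"
proof -
  obtain g where g: "Vector_Spaces.linear (*s) (*s) g" "inj g"
    "\<And>u. g (\<Sum>b\<in>I. u b *s e b) = (\<Sum>b\<in>I. u b *s e' b)"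
    using linear_change_of_frame[OF e] by blast
  from good_frames_inj_linear[OF g(1,2) good] show ?thesis by (simp only: g(3))
qed

lemma contract_family:
  fixes m e :: "real \<Rightarrow> nat \<Rightarrow> complex ^ 'n"
  assumes T: "compact T" "T \<subseteq> {0..1}" "0 \<in> T" "1 \<in> T" and k: "2 \<le> k"
    and mcont: "\<And>c. c < h * k \<Longrightarrow> continuous_on T (\<lambda>t. m t c)"
    and econt: "\<And>b. b < i \<Longrightarrow> continuous_on T (\<lambda>t. e t b)"
    and good: "\<And>t. t \<in> T \<Longrightarrow> good_frames h i k (m t)"
    and ind: "\<And>t. t \<in> T \<Longrightarrow> indep {..<i} (e t)"
    and span: "\<And>t. t \<in> T \<Longrightarrow> vec.span (e t ` {..<i}) = vec.span (m t ` {..<h * k})"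
    and loop: "b' \<Longrightarrow> m 0 = m 1" "b' \<Longrightarrow> e 0 = e 1"
  shows "\<exists>a. config_homotopic h i k b' T (\<lambda>t. config_of h k (m t)) (\<lambda>_. a)"
proof -
  let ?N = "h * k"
  \<comment> \<open>The choice sees \<open>t\<close> only through \<open>m t c\<close> and
    \<open>e t\<close>, so the coefficients close up whenever these do; uniqueness makes them
    continuous.\<close>
  define B where "B = (\<lambda>c b t. (SOME u. m t c = (\<Sum>b<i. u b *s e t b)) b)"
  have m: "m t c = (\<Sum>b<i. B c b t *s e t b)" if "t \<in> T" "c < ?N" for t c
  proof -
    have "m t c \<in> vec.span (m t ` {..<?N})" using that by (intro vec.span_base) auto
    then have "m t c \<in> vec.span (e t ` {..<i})" using span[OF that(1)] by simp
    then have "\<exists>u. m t c = (\<Sum>b<i. u b *s e t b)" by (subst (asm) in_span_image_iff) auto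
    then show ?thesis unfolding B_def by (rule someI_ex)
  qed
  have B: "continuous_on T (B c b)" if "c < ?N" "b < i" for c b
    using continuous_on_coefficients[of "{..<i}" T e "\<lambda>t. m t c" "\<lambda>t b. B c b t" b]
      econt mcont ind m that by auto
  have Bloop: "B c b 0 = B c b 1" if b' for c b
    using loop[OF that] unfolding B_def by (simp only:)
  \<comment> \<open>The coefficients at time \<open>t\<close> applied to an arbitrary frame
    \<open>f\<close>.\<close>
  define Y where "Y = (\<lambda>t f c. \<Sum>b<i. B c b t *s f b :: complex ^ 'n)"
  have Y0: "config_of h k (Y t (e t)) = config_of h k (m t)" if "t \<in> T" for t
    using m[OF that] by (intro config_of_cong) (simp add: Y_def)
  have Ygood: "good_frames h i k (Y t f)" if "t \<in> T" "indep {..<i} f" for t f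
  proof -
    have "good_frames h i k (Y t (e t))"
      using good[OF that(1)] m[OF that(1)] good_frames_cong[of h k "m t" "Y t (e t)" i] by (simp add: Y_def)
    then show ?thesis using good_frames_change_frame[OF ind[OF that(1)] that(2)] by (simp add: Y_def)
  qed
  have move: "config_homotopic h i k b' T (\<lambda>t. config_of h k (Y t (F 0 t))) (\<lambda>t. config_of h k (Y t (F 1 t)))"
    if F: "\<And>b. b < i \<Longrightarrow> continuous_on ({0..1} \<times> T) (\<lambda>z. F (fst z) (snd z) b)"
      "\<And>s t. s \<in> {0..1} \<Longrightarrow> t \<in> T \<Longrightarrow> indep {..<i} (F s t)"
      "\<And>s. b' \<Longrightarrow> F s 0 = F s 1" for F :: "real \<Rightarrow> real \<Rightarrow> nat \<Rightarrow> complex ^ 'n"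
  proof (rule config_homotopicI[of T h k "\<lambda>s t. Y t (F s t)" i b', OF T(3,4)])
    fix c assume c: "c < ?N"
    then show "continuous_on ({0..1} \<times> T) (\<lambda>z. Y (snd z) (F (fst z) (snd z)) c)"
      unfolding Y_def using B F(1) by (intro continuous_intros continuous_on_fst_snd) auto
  next
    fix s :: real assume b'
    then have "Y 0 = Y 1" using Bloop by (simp add: Y_def)
    with F(3)[OF \<open>b'\<close>] show "config_of h k (Y 0 (F s 0)) = config_of h k (Y 1 (F s 1))" by simp
  qed (use F Ygood in auto)
  have final: ?thesis
    if P: "indep {..<i} P" and C: "\<And>c b. c < ?N \<Longrightarrow> b < i \<Longrightarrow> continuous_on T (C c b)"
      "\<And>c b. b' \<Longrightarrow> C c b 0 = C c b 1" and gC: "\<And>t. t \<in> T \<Longrightarrow> good_frames h i k (\<lambda>c. \<Sum>b<i. C c b t *s P b)"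
      and hom: "config_homotopic h i k b' T (\<lambda>t. config_of h k (m t)) (\<lambda>t. config_of h k (\<lambda>c. \<Sum>b<i. C c b t *s P b))"
    for P C
    using contract_in_frame[OF T k P C(1) gC C(2)] hom homotopic_with_trans by blast
  have "i \<le> CARD('n)"
    using dim_indep[OF ind[OF T(3)]] vec.dim_subset_UNIV[of "e 0 ` {..<i}"] card_cart_basis[where 'i='n and 'a=complex]
    by (simp add: vec.dimension_def)
  show ?thesis
  proof (cases "i = CARD('n)")
    case True
    \<comment> \<open>No vector lies outside the span of a frame of the whole space, but none is
      needed: the sum is already constant, and the vectors are simply rewritten in the fixed frame
      \<open>e 0\<close>.\<close>
    define P where "P = e 0"
    have P: "indep {..<i} P" using ind T(3) by (simp add: P_def)
    have "vec.span (P ` {..<i}) = UNIV"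
      using P True by (intro span_eq_if_indep) (simp_all add: vec.dim_UNIV card_cart_basis)
    define C where "C = (\<lambda>c b t. (SOME u. m t c = (\<Sum>b<i. u b *s P b)) b)"
    have mC: "m t c = (\<Sum>b<i. C c b t *s P b)" for t c
    proof -
      have "m t c \<in> vec.span (P ` {..<i})" using \<open>vec.span (P ` {..<i}) = UNIV\<close> by simp
      then have "\<exists>u. m t c = (\<Sum>b<i. u b *s P b)" by (subst (asm) in_span_image_iff) auto
      then show ?thesis unfolding C_def by (rule someI_ex)
    qed
    then have mC': "(\<lambda>c. \<Sum>b<i. C c b t *s P b) = m t" for t by (intro ext) simp
    show ?thesis
    proof (rule final[OF P, of C])
      show "continuous_on T (C c b)" if "c < ?N" "b < i" for c b
        using continuous_on_coefficients[of "{..<i}" T "\<lambda>_. P" "\<lambda>t. m t c" "\<lambda>t b. C c b t" b]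
          mcont P mC that by auto
      show "C c b 0 = C c b 1" if b' for c b using loop(1)[OF that] unfolding C_def by (simp only:)
      have "continuous_map (top_of_set T) (grassmann_config h i k) (\<lambda>t. config_of h k (m t))"
        using mcont good by (intro continuous_map_config_of) auto
      then show "config_homotopic h i k b' T (\<lambda>t. config_of h k (m t)) (\<lambda>t. config_of h k (\<lambda>c. \<Sum>b<i. C c b t *s P b))"
        unfolding mC' using loop(1) by (simp add: homotopic_with_refl)
    qed (use good in \<open>simp add: mC'\<close>)
  next
    case False
    then have less: "i < CARD('n)" using \<open>i \<le> CARD('n)\<close> by simp
    have "\<exists>\<epsilon>>0. \<forall>t\<in>T. \<forall>y. (\<forall>b\<in>{..<i}. dist (y b) (e t b) < \<epsilon>) \<longrightarrow> indep {..<i} y"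
      using T(1) econt
    proof (intro uniform_neighbourhood)
      fix t assume "t \<in> T"
      obtain \<epsilon> where "\<epsilon> > 0" "\<And>y. (\<And>b. b \<in> {..<i} \<Longrightarrow> dist (y b) (e t b) < \<epsilon>) \<Longrightarrow> indep {..<i} y"
        using indep_open[OF ind[OF \<open>t \<in> T\<close>]] by metis
      then show "\<exists>\<epsilon>>0. \<forall>y. (\<forall>b\<in>{..<i}. dist (y b) (e t b) < \<epsilon>) \<longrightarrow> indep {..<i} y" by blast
    qed auto
    then obtain \<epsilon> where \<epsilon>: "\<epsilon> > 0"
      "\<And>t y. t \<in> T \<Longrightarrow> (\<And>b. b < i \<Longrightarrow> dist (y b) (e t b) < \<epsilon>) \<Longrightarrow> indep {..<i} y" by auto
    \<comment> \<open>The zero curve beyond \<open>i\<close> makes the loop condition hold at every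
      index.\<close>
    define A where "A = (\<lambda>b. if b < i then SOME g. g differentiable_on UNIV \<and> g 0 = e 0 b \<and> g 1 = e 1 b \<and>
      (\<forall>t\<in>T. norm (g t - e t b) < \<epsilon>) else (\<lambda>t. 0))"
    have A: "A b differentiable_on UNIV" "A b 0 = e 0 b" "A b 1 = e 1 b"
      "\<And>t. t \<in> T \<Longrightarrow> norm (A b t - e t b) < \<epsilon>" if "b < i" for b
    proof -
      have "\<exists>g. g differentiable_on UNIV \<and> g 0 = e 0 b \<and> g 1 = e 1 b \<and> (\<forall>t\<in>T. norm (g t - e t b) < \<epsilon>)"
        using T \<epsilon>(1) econt[OF that] by (intro polynomial_approx_on) (auto simp: compact_imp_closed)
      from someI_ex[OF this] show "A b differentiable_on UNIV" "A b 0 = e 0 b" "A b 1 = e 1 b"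
        "\<And>t. t \<in> T \<Longrightarrow> norm (A b t - e t b) < \<epsilon>"
        using that by (auto simp: A_def)
    qed
    have Aloop: "A b 0 = A b 1" if b' for b
      using A(2,3)[of b] loop(2)[OF that] by (cases "b < i") (auto simp: A_def)
    have Acont: "continuous_on T (A b)" if "b < i" for b
      using A(1)[OF that] by (meson continuous_on_subset differentiable_imp_continuous_on subset_UNIV)
    define F where "F = (\<lambda>s t b. e t b + of_real s *s (A b t - e t b))"
    have Find: "indep {..<i} (F s t)" if "s \<in> {0..1}" "t \<in> T" for s t
    proof (rule \<epsilon>(2)[OF that(2)])
      fix b assume b: "b < i"
      have "dist (F s t b) (e t b) = \<bar>s\<bar> * norm (A b t - e t b)"
        by (simp only: F_def dist_norm add_diff_cancel_left' norm_vector_scalar_mult norm_of_real)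
      also have "\<dots> \<le> 1 * norm (A b t - e t b)" using that by (intro mult_right_mono) auto
      finally show "dist (F s t b) (e t b) < \<epsilon>" using A(4)[OF b that(2)] by linarith
    qed
    have F01: "F 0 t = e t" "F 1 t = (\<lambda>b. A b t)" for t by (auto simp: F_def)
    have "config_homotopic h i k b' T (\<lambda>t. config_of h k (Y t (F 0 t))) (\<lambda>t. config_of h k (Y t (F 1 t)))"
    proof (rule move)
      show "continuous_on ({0..1} \<times> T) (\<lambda>z. F (fst z) (snd z) b)" if "b < i" for b
        unfolding F_def
        by (intro continuous_intros continuous_on_fst_snd[of T "A b"] continuous_on_fst_snd[of T "\<lambda>t. e t b"] econt Acont that)
      show "F s 0 = F s 1" if b' for s using Aloop loop(2) that by (simp add: F_def)
    qed (use Find in auto)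
    moreover have "config_homotopic h i k b' T (\<lambda>t. config_of h k (m t)) (\<lambda>t. config_of h k (Y t (F 0 t)))"
    proof (rule homotopic_with_eq[where f = "\<lambda>t. config_of h k (m t)" and g = "\<lambda>t. config_of h k (m t)"])
      have "continuous_map (top_of_set T) (grassmann_config h i k) (\<lambda>t. config_of h k (m t))"
        using mcont good by (intro continuous_map_config_of) auto
      then show "config_homotopic h i k b' T (\<lambda>t. config_of h k (m t)) (\<lambda>t. config_of h k (m t))"
        using loop(1) by (simp add: homotopic_with_refl)
    qed (use Y0 F01 T in auto)
    ultimately have start: "config_homotopic h i k b' T (\<lambda>t. config_of h k (m t)) (\<lambda>t. config_of h k (Y t (\<lambda>b. A b t)))"
      using homotopic_with_trans unfolding F01 by blast
    have "\<exists>p. (\<forall>t\<in>T. indep {..<i} (\<lambda>b. if b < n then p b else A b t)) \<and>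
      config_homotopic h i k b' T (\<lambda>t. config_of h k (m t))
        (\<lambda>t. config_of h k (Y t (\<lambda>b. if b < n then p b else A b t)))" if "n \<le> i" for n
      using that
    proof (induction n)
      case 0
      have "indep {..<i} (\<lambda>b. A b t)" if "t \<in> T" for t using Find[of 1 t] that F01 by simp
      then show ?case using start by simp
    next
      case (Suc n)
      then obtain p where p: "\<And>t. t \<in> T \<Longrightarrow> indep {..<i} (\<lambda>b. if b < n then p b else A b t)"
        "config_homotopic h i k b' T (\<lambda>t. config_of h k (m t))
          (\<lambda>t. config_of h k (Y t (\<lambda>b. if b < n then p b else A b t)))" by auto
      define x where "x = (\<lambda>t b. if b < n then p b else A b t)"
      have n: "n < i" using Suc.prems by simp
      have xdiff: "(\<lambda>t. x t b) differentiable_on UNIV" if "b < i" for b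
        using that A(1) by (cases "b < n") (auto simp: x_def differentiable_on_const)
      have xcont: "continuous_on T (\<lambda>t. x t b)" if "b < i" for b
        using that Acont by (cases "b < n") (auto simp: x_def)
      \<comment> \<open>Since \<open>i < CARD('n)\<close>, the frame never spans the whole space, so
        one constant \<open>q\<close> stays outside its span at all times.\<close>
      have "\<exists>q\<in>UNIV. norm q < 1 \<and> (\<forall>t. \<forall>J\<subseteq>{..<i}. vec.span ((\<lambda>b. x t b) ` J) \<noteq> UNIV \<longrightarrow>
          0 + q \<notin> vec.span ((\<lambda>b. x t b) ` J))"
        using xdiff by (intro generic_vector_for_family) (auto simp: differentiable_on_const)
      then obtain q where q: "\<And>t. vec.span (x t ` {..<i}) \<noteq> UNIV \<Longrightarrow> q \<notin> vec.span (x t ` {..<i})" by auto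
      have q: "q \<notin> vec.span (x t ` {..<i})" for t
      proof (rule q, rule span_neq_if_dim_less)
        show "vec.dim (x t ` {..<i}) < vec.dim (UNIV :: (complex ^ 'n) set)"
          using dim_image_le_card[of "{..<i}" "x t"] less by (simp add: vec.dim_UNIV card_cart_basis)
      qed
      define X where "X = (\<lambda>s t. (x t)(n := of_real (1 - s) *s x t n + of_real s *s q))"
      have Xind: "indep {..<i} (X s t)" if "t \<in> T" for s t
        unfolding X_def using p(1)[OF that] n q by (intro indep_move) (auto simp: x_def)
      have "config_homotopic h i k b' T (\<lambda>t. config_of h k (Y t (X 0 t))) (\<lambda>t. config_of h k (Y t (X 1 t)))"
      proof (rule move)
        fix b assume b: "b < i"
        have "continuous_on ({0..1} \<times> T) (\<lambda>z. x (snd z) b)"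
          by (rule continuous_on_fst_snd[OF xcont[OF b]])
        moreover have "continuous_on ({0..1} \<times> T) (\<lambda>z. complex_of_real (1 - fst z) *s x (snd z) n + complex_of_real (fst z) *s q)"
          by (intro continuous_intros continuous_on_fst_snd xcont n)
        ultimately show "continuous_on ({0..1} \<times> T) (\<lambda>z. X (fst z) (snd z) b)"
          by (cases "b = n") (simp_all add: X_def)
      next
        fix s :: real assume b'
        then have "x 0 = x 1" using Aloop by (auto simp: x_def)
        then show "X s 0 = X s 1" by (simp add: X_def)
      qed (use Xind in auto)
      moreover have "X 0 t = x t" for t by (simp add: X_def)
      ultimately have "config_homotopic h i k b' T (\<lambda>t. config_of h k (m t)) (\<lambda>t. config_of h k (Y t (X 1 t)))"
        using p(2) homotopic_with_trans unfolding x_def by simp blast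
      moreover have "X 1 t = (\<lambda>b. if b < Suc n then (p(n := q)) b else A b t)" for t
        by (auto simp: X_def x_def)
      ultimately show ?case using Xind[of _ 1] by (intro exI[of _ "p(n := q)"]) simp
    qed
    from this[of i] obtain p where p': "\<forall>t\<in>T. indep {..<i} (\<lambda>b. if b < i then p b else A b t)"
      "config_homotopic h i k b' T (\<lambda>t. config_of h k (m t))
        (\<lambda>t. config_of h k (Y t (\<lambda>b. if b < i then p b else A b t)))" by blast
    have "Y t (\<lambda>b. if b < i then p b else A b t) = Y t p" for t
      unfolding Y_def by (intro ext sum.cong) auto
    moreover have "indep {..<i} (\<lambda>b. if b < i then p b else A b t) \<longleftrightarrow> indep {..<i} p" for t
      by (intro indep_cong) auto
    ultimately have p: "indep {..<i} p"
      "config_homotopic h i k b' T (\<lambda>t. config_of h k (m t)) (\<lambda>t. config_of h k (Y t p))"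
      using p' T(3) by auto
    show ?thesis
      using p(2) Ygood[OF _ p(1)] by (intro final[OF p(1), of B] B Bloop) (auto simp: Y_def)
  qed
qed

subsection \<open>Lifting paths to frames\<close>

lemma indep_change_frame:
  fixes e e' :: "'b \<Rightarrow> complex ^ 'n"
  assumes "indep I e" "indep I e'" "indep J (\<lambda>c. \<Sum>b\<in>I. u c b *s e b)"
  shows "indep J (\<lambda>c. \<Sum>b\<in>I. u c b *s e' b)"
proof -
  obtain g where g: "Vector_Spaces.linear (*s) (*s) g" "inj g"
    "\<And>u. g (\<Sum>b\<in>I. u b *s e b) = (\<Sum>b\<in>I. u b *s e' b)"
    using linear_change_of_frame[OF assms(1,2)] by blast
  from indep_inj_linear[OF g(1,2) assms(3)] show ?thesis by (simp only: g(3))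
qed

definition frame_path :: "real set \<Rightarrow> nat \<Rightarrow> (real \<Rightarrow> (complex ^ 'n) set) \<Rightarrow> (real \<Rightarrow> nat \<Rightarrow> complex ^ 'n) \<Rightarrow> bool" where
  "frame_path S k V e \<longleftrightarrow> (\<forall>b<k. continuous_on S (\<lambda>t. e t b)) \<and>
     (\<forall>t\<in>S. indep {..<k} (e t) \<and> vec.span (e t ` {..<k}) = V t)"

text \<open>The constant matrix that expresses \<open>w\<close> in \<open>e a\<close> is applied
  along the whole path.\<close>

lemma frame_path_restart:
  fixes e :: "real \<Rightarrow> nat \<Rightarrow> complex ^ 'n"
  assumes e: "frame_path S k V e" and a: "a \<in> S"
    and w: "indep {..<k} w" "vec.span (w ` {..<k}) = V a"
  shows "\<exists>e'. frame_path S k V e' \<and> (\<forall>c<k. e' a c = w c)"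
proof -
  have "\<exists>u. w c = (\<Sum>b<k. u b *s e a b)" if "c < k" for c
  proof -
    have "w c \<in> vec.span (w ` {..<k})" using that by (intro vec.span_base) auto
    then have "w c \<in> vec.span (e a ` {..<k})" using w e a by (simp add: frame_path_def)
    then show ?thesis by (subst (asm) in_span_image_iff) auto
  qed
  then obtain U where U: "\<And>c. c < k \<Longrightarrow> w c = (\<Sum>b<k. U c b *s e a b)" by metis
  define e' where "e' = (\<lambda>t c. \<Sum>b<k. U c b *s e t b)"
  have cont: "continuous_on S (\<lambda>t. e' t c)" if "c < k" for c
    unfolding e'_def using e by (intro continuous_intros) (auto simp: frame_path_def)
  have "indep {..<k} (e' a)" using w(1) U by (subst indep_cong[of _ _ w]) (auto simp: e'_def)
  then have ind: "indep {..<k} (e' t)" if "t \<in> S" for t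
    unfolding e'_def using e a that
    by (intro indep_change_frame[of "{..<k}" "e a" "e t"]) (auto simp: frame_path_def)
  have "vec.span (e' t ` {..<k}) = V t" if "t \<in> S" for t
  proof (rule span_eq_if_indep[OF _ _ ind[OF that]])
    have V: "V t = vec.span (e t ` {..<k})" "indep {..<k} (e t)" using e that by (auto simp: frame_path_def)
    show "vec.subspace (V t)" "card {..<k} = vec.dim (V t)" using dim_indep[OF V(2)] by (simp_all add: V(1))
    show "e' t ` {..<k} \<subseteq> V t"
      unfolding V(1) e'_def by (auto intro!: vec.span_sum vec.span_scale intro: vec.span_base)
  qed
  then show ?thesis using cont ind U by (intro exI[of _ e']) (auto simp: frame_path_def e'_def)
qed

text \<open>Bisection of the interval. Allowing every initial frame \<open>w\<close> makes the
  statement additive over adjacent intervals, since the second path can start where the first one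
  ends.\<close>

lemma frame_path_global:
  fixes V :: "real \<Rightarrow> (complex ^ 'n) set"
  assumes loc: "\<And>s. s \<in> {0..1} \<Longrightarrow> \<exists>d>0. \<exists>e. frame_path ({0..1} \<inter> ball s d) k V e"
  shows "\<exists>e. frame_path {0..1} k V e"
proof -
  \<comment> \<open>The bounds are built into \<open>Q\<close> because the bisection principle also
    tests intervals that leave the unit interval.\<close>
  define Q where "Q = (\<lambda>a b. 0 \<le> a \<and> a \<le> b \<and> b \<le> (1::real) \<longrightarrow> (\<forall>w. indep {..<k} w \<and> vec.span (w ` {..<k}) = V a \<longrightarrow>
    (\<exists>e. frame_path {a..b} k V e \<and> (\<forall>c<k. e a c = w c))))"
  have "Q 0 1"
  proof (rule Bolzano)
    fix a b c assume Q: "Q a b" "Q b c" and abc: "a \<le> b" "b \<le> c"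
    show "Q a c"
      unfolding Q_def
    proof (intro impI allI)
      fix w assume bd: "0 \<le> a \<and> a \<le> c \<and> c \<le> 1" and w: "indep {..<k} w \<and> vec.span (w ` {..<k}) = V a"
      obtain e1 where e1: "frame_path {a..b} k V e1" "\<And>c. c < k \<Longrightarrow> e1 a c = w c"
        using Q(1) abc bd w unfolding Q_def by force
      have "indep {..<k} (e1 b) \<and> vec.span (e1 b ` {..<k}) = V b"
        using e1(1) abc by (auto simp: frame_path_def)
      then obtain e2 where e2: "frame_path {b..c} k V e2" "\<And>c. c < k \<Longrightarrow> e2 b c = e1 b c"
        using Q(2) abc bd unfolding Q_def by force
      define e where "e = (\<lambda>t. if t \<le> b then e1 t else e2 t)"
      have "continuous_on {a..c} (\<lambda>t. e t j)" if "j < k" for j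
      proof -
        have "continuous_on {a..c} (\<lambda>t. if t \<le> b then e1 t j else e2 t j)"
        proof (rule continuous_on_cases_le)
          show "continuous_on {t \<in> {a..c}. t \<le> b} (\<lambda>t. e1 t j)"
            using e1(1) that by (auto simp: frame_path_def intro: continuous_on_subset)
          show "continuous_on {t \<in> {a..c}. b \<le> t} (\<lambda>t. e2 t j)"
            using e2(1) that by (auto simp: frame_path_def intro: continuous_on_subset)
        qed (use e2(2) that in \<open>auto simp: continuous_on_id\<close>)
        then show ?thesis by (simp add: e_def if_distribR cong: if_cong)
      qed
      moreover have "indep {..<k} (e t) \<and> vec.span (e t ` {..<k}) = V t" if "t \<in> {a..c}" for t
        using e1(1) e2(1) that by (cases "t \<le> b") (auto simp: e_def frame_path_def)
      ultimately have "frame_path {a..c} k V e" unfolding frame_path_def by blast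
      moreover have "\<forall>j<k. e a j = w j" using e1(2) abc by (auto simp: e_def)
      ultimately show "\<exists>e. frame_path {a..c} k V e \<and> (\<forall>j<k. e a j = w j)" by blast
    qed
  next
    fix x :: real assume x: "0 \<le> x" "x \<le> 1"
    then obtain d e where de: "d > 0" "frame_path ({0..1} \<inter> ball x d) k V e" using loc[of x] by auto
    have "Q a b" if ab: "a \<le> x" "x \<le> b" "b - a < d" for a b
      unfolding Q_def
    proof (intro impI allI)
      fix w assume bd: "0 \<le> a \<and> a \<le> b \<and> b \<le> 1" and w: "indep {..<k} w \<and> vec.span (w ` {..<k}) = V a"
      have "{a..b} \<subseteq> {0..1} \<inter> ball x d" using ab bd by (auto simp: dist_real_def)
      then have "frame_path {a..b} k V e"
        using de(2) unfolding frame_path_def by (meson continuous_on_subset subsetD)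
      then show "\<exists>e. frame_path {a..b} k V e \<and> (\<forall>c<k. e a c = w c)"
        using w bd by (intro frame_path_restart) auto
    qed
    then show "\<exists>d>0. \<forall>a b. a \<le> x \<and> x \<le> b \<and> b - a < d \<longrightarrow> Q a b" using de(1) by blast
  qed simp
  moreover obtain d e where "d > 0" "frame_path ({0..1} \<inter> ball 0 d) k V e" using loc[of 0] by auto
  then have "indep {..<k} (e 0) \<and> vec.span (e 0 ` {..<k}) = V 0" by (auto simp: frame_path_def)
  ultimately show ?thesis unfolding Q_def by force
qed

section \<open>Path-connectedness of frames and local sections of the Grassmannian\<close>

lemma span_Un_span: "vec.span (vec.span S \<union> R) = vec.span (S \<union> R)"
  by (simp add: vec.span_Un vec.span_span)

lemma range_replace_rows:
  assumes "inj_on \<iota> J"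
  shows "range (\<lambda>r. replace_rows \<iota> J A y $ r) = y ` J \<union> (\<lambda>r. A $ r) ` (- \<iota> ` J)"
proof -
  have "range (\<lambda>r. replace_rows \<iota> J A y $ r) = (\<lambda>r. replace_rows \<iota> J A y $ r) ` (\<iota> ` J) \<union> (\<lambda>r. replace_rows \<iota> J A y $ r) ` (- \<iota> ` J)"
    by (simp add: image_Un[symmetric] Compl_partition)
  also have "(\<lambda>r. replace_rows \<iota> J A y $ r) ` (\<iota> ` J) = y ` J"
    using assms by (auto simp: image_image)
  also have "(\<lambda>r. replace_rows \<iota> J A y $ r) ` (- \<iota> ` J) = (\<lambda>r. A $ r) ` (- \<iota> ` J)"
    by (intro image_cong) (auto simp: replace_rows_def)
  finally show ?thesis .
qed

text \<open>The right-hand side sees \<open>y\<close> only through the subspace that it spans, so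
  the determinant condition descends from frames to the Grassmannian.\<close>

lemma det_replace_rows_iff:
  fixes \<iota> :: "'b \<Rightarrow> 'n::finite" and A :: "complex ^ 'n ^ 'n"
  assumes "inj_on \<iota> J"
  shows "det (replace_rows \<iota> J A y) \<noteq> 0 \<longleftrightarrow> vec.span (vec.span (y ` J) \<union> (\<lambda>r. A $ r) ` (- \<iota> ` J)) = UNIV"
proof -
  let ?M = "replace_rows \<iota> J A y"
  have dimU: "vec.dim (UNIV :: (complex ^ 'n) set) = CARD('n)"
    by (simp add: vec.dim_UNIV card_cart_basis)
  have "det ?M \<noteq> 0 \<longleftrightarrow> vec.span (range (\<lambda>r. ?M $ r)) = UNIV"
    unfolding indep_rows_iff_det[symmetric]
  proof
    assume "indep UNIV (\<lambda>r. ?M $ r)"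
    then show "vec.span (range (\<lambda>r. ?M $ r)) = UNIV" using dimU by (intro span_eq_if_indep) auto
  next
    assume "vec.span (range (\<lambda>r. ?M $ r)) = UNIV"
    then have "vec.dim (range (\<lambda>r. ?M $ r)) = CARD('n)"
      using vec.dim_span[of "range (\<lambda>r. ?M $ r)"] dimU by simp
    then show "indep UNIV (\<lambda>r. ?M $ r)" by (intro indep_if_dim_eq_card) auto
  qed
  then show ?thesis by (simp add: range_replace_rows[OF assms] span_Un_span)
qed

text \<open>With finitely many exceptions, the complex affine combinations of two frames of a subspace are
  frames of it: the exceptions are roots of a polynomial.\<close>

lemma frames_path_connected:
  fixes v w :: "'b \<Rightarrow> complex ^ 'n"
  assumes v: "indep I v" and w: "indep I w" and vw: "vec.span (v ` I) = vec.span (w ` I)"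
  shows "\<exists>g. (\<forall>c. continuous_on {0..1} (\<lambda>t::real. g t c)) \<and> g 0 = v \<and> g 1 = w \<and>
    (\<forall>t\<in>{0..1}. indep I (g t) \<and> vec.span (g t ` I) = vec.span (v ` I))"
proof -
  obtain \<iota> :: "'b \<Rightarrow> 'n" and A where A: "inj_on \<iota> I" "\<And>c. c \<in> I \<Longrightarrow> A $ \<iota> c = v c" "det A \<noteq> 0"
    using indep_imp_inj_index[OF v] by metis
  define B where "B = replace_rows \<iota> I A w"
  have Av: "replace_rows \<iota> I A v = A" using A by (intro replace_rows_self) auto
  have "det B \<noteq> 0"
    using A(3) det_replace_rows_iff[OF A(1), of A v] det_replace_rows_iff[OF A(1), of A w] vw
    by (simp add: B_def Av)
  define f where "f = (\<lambda>z c. v c + z *s (w c - v c))"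
  \<comment> \<open>The Leibniz formula for the determinant of \<open>A + z (B - A)\<close>, entry
    by entry a polynomial in \<open>z\<close> of degree at most one.\<close>
  define q :: "complex poly" where "q = (\<Sum>p\<in>{p. p permutes UNIV}. [:of_int (sign p):] *
    (\<Prod>r\<in>UNIV. [:A $ r $ p r, B $ r $ p r - A $ r $ p r:]))"
  have rows: "replace_rows \<iota> I A (f z) = A + (\<chi> r s. z * (B $ r $ s - A $ r $ s))" for z
    using A(1,2) by (auto simp: vec_eq_iff replace_rows_def B_def f_def algebra_simps)
  have q: "poly q z = det (replace_rows \<iota> I A (f z))" for z
    unfolding rows det_def q_def by (simp add: poly_sum poly_prod algebra_simps)
  have "f 0 = v" "f 1 = w" by (auto simp: f_def)
  then have q01: "poly q 0 \<noteq> 0" "poly q 1 \<noteq> 0"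
    using A(3) \<open>det B \<noteq> 0\<close> by (simp_all add: q Av B_def)
  then have "finite {z. poly q z = 0}" by (intro poly_roots_finite) auto
  \<comment> \<open>Here complex scalars are essential: finitely many points do not disconnect the
    plane, while they would disconnect the real line.\<close>
  then have "path_connected (- {z. poly q z = 0})"
    by (intro path_connected_complement_countable) (auto simp: countable_finite)
  then obtain \<gamma> where \<gamma>: "path \<gamma>" "path_image \<gamma> \<subseteq> - {z. poly q z = 0}" "pathstart \<gamma> = 0" "pathfinish \<gamma> = 1"
    using q01 unfolding path_connected_def by blast
  have ind: "indep I (f (\<gamma> t))" if "t \<in> {0..1}" for t
  proof (rule indep_if_det_replace_rows[OF A(1), of A])
    have "\<gamma> t \<in> path_image \<gamma>" using that by (auto simp: path_image_def)
    then show "det (replace_rows \<iota> I A (f (\<gamma> t))) \<noteq> 0" using \<gamma>(2) by (auto simp flip: q)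
  qed
  have "vec.span (f z ` I) = vec.span (v ` I)" if "indep I (f z)" for z
  proof (rule span_eq_if_indep[OF _ _ that])
    have "f z c \<in> vec.span (v ` I)" if "c \<in> I" for c
      unfolding f_def using that vw
      by (intro vec.span_add vec.span_scale vec.span_diff) (auto intro: vec.span_base)
    then show "f z ` I \<subseteq> vec.span (v ` I)" by blast
    show "card I = vec.dim (vec.span (v ` I))" using dim_indep[OF v] by simp
  qed auto
  moreover have "continuous_on {0..1} (\<lambda>t. f (\<gamma> t) c)" for c
    unfolding f_def using \<gamma>(1) by (intro continuous_intros) (simp add: path_def)
  ultimately show ?thesis
    using ind \<gamma>(3,4) \<open>f 0 = v\<close> \<open>f 1 = w\<close>
    by (intro exI[of _ "\<lambda>t. f (\<gamma> t)"]) (simp add: pathstart_def pathfinish_def)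
qed

lemma continuous_map_vec_lambda:
  fixes f :: "'a \<Rightarrow> 'i::finite \<Rightarrow> 'z::topological_space"
  assumes "\<And>r. continuous_map X euclidean (\<lambda>x. f x r)"
  shows "continuous_map X euclidean (\<lambda>x. \<chi> r. f x r)"
proof -
  have "continuous_map X euclidean f"
    using assms by (simp flip: euclidean_product_topology add: continuous_map_componentwise_UNIV)
  moreover have "continuous_on UNIV (\<lambda>g :: 'i \<Rightarrow> 'z. \<chi> r. g r)"
    by (intro continuous_on_vec_lambda continuous_on_product_coordinates)
  ultimately show ?thesis
    using continuous_map_compose[of X euclidean f euclidean "\<lambda>g. \<chi> r. g r"] by (simp add: comp_def)
qed

lemma continuous_map_replace_rows:
  fixes \<iota> :: "'b \<Rightarrow> 'n::finite"
  assumes "\<And>c. c \<in> J \<Longrightarrow> continuous_map X euclidean (\<lambda>x. y x c)"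
  shows "continuous_map X euclidean (\<lambda>x. replace_rows \<iota> J A (y x))"
  unfolding replace_rows_def
proof (rule continuous_map_vec_lambda)
  show "continuous_map X euclidean (\<lambda>x. if r \<in> \<iota> ` J then y x (inv_into J \<iota> r) else A $ r)" for r
    by (cases "r \<in> \<iota> ` J") (auto intro!: assms inv_into_into)
qed

text \<open>Nearby subspaces are graphs over \<open>V\<^sub>0\<close> along a fixed complement, spanned by the constant rows of \<open>A\<close>;
  projecting a frame of \<open>V\<^sub>0\<close> to them along that complement gives the section.\<close>

lemma local_section_grassmannian:
  fixes V\<^sub>0 :: "(complex ^ 'n) set"
  assumes "V\<^sub>0 \<in> Gr k"
  shows "\<exists>U \<sigma>. openin (grassmannian k) U \<and> V\<^sub>0 \<in> U \<and>
    (\<forall>a<k. continuous_map (subtopology (grassmannian k) U) euclidean (\<lambda>V. \<sigma> V a)) \<and>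
    (\<forall>V\<in>U. indep {..<k} (\<sigma> V :: nat \<Rightarrow> complex ^ 'n) \<and> vec.span (\<sigma> V ` {..<k}) = V)"
proof -
  let ?K = "{..<k}"
  have "V\<^sub>0 \<in> span_frame k ` topspace (frames k)" using assms span_frame_image by blast
  then obtain v where v: "indep ?K v" "vec.span (v ` ?K) = V\<^sub>0"
    by (auto simp: frames_def indep_def span_frame_def)
  obtain \<iota> :: "nat \<Rightarrow> 'n" and A where A: "inj_on \<iota> ?K" "\<And>c. c \<in> ?K \<Longrightarrow> A $ \<iota> c = v c" "det A \<noteq> 0"
    using indep_imp_inj_index[OF v(1)] by metis
  let ?M = "replace_rows \<iota> ?K A"
  define L where "L = - \<iota> ` ?K"
  define R where "R = (\<lambda>r. A $ r) ` L"
  \<comment> \<open>The subspaces complementary to the span of \<open>R\<close>, a standard affine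
    chart of the Grassmannian.\<close>
  define U where "U = {V \<in> Gr k. vec.span (V \<union> R) = UNIV}"
  have det: "det (?M w) \<noteq> 0 \<longleftrightarrow> vec.span (vec.span (w ` ?K) \<union> R) = UNIV" for w
    unfolding R_def L_def by (rule det_replace_rows_iff[OF A(1)])
  have Mv: "?M v = A" using A by (intro replace_rows_self) auto
  have V0: "V\<^sub>0 \<in> U" using det[of v] Mv A(3) v(2) assms by (simp add: U_def)
  have preimage: "{w \<in> topspace (frames k). span_frame k w \<in> U} = {w \<in> topspace (frames k). det (?M w) \<noteq> 0}"
    using span_frame_image[of k] by (auto simp: U_def det span_frame_def)
  have Mcont: "continuous_map (frames k) euclidean ?M"
  proof (rule continuous_map_replace_rows)
    fix c assume "c \<in> ?K"
    then show "continuous_map (frames k) euclidean (\<lambda>w :: nat \<Rightarrow> complex ^ 'n. w c)"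
      unfolding frames_def
      by (intro continuous_map_from_subtopology continuous_map_product_projection)
  qed
  have "open {N :: complex ^ 'n ^ 'n. det N \<noteq> 0}"
    by (intro open_Collect_neq continuous_on_det continuous_on_const continuous_on_id)
  then have "openin (frames k) {w \<in> topspace (frames k). ?M w \<in> {N. det N \<noteq> 0}}"
    by (intro openin_continuous_map_preimage[OF Mcont]) simp
  then have openU: "openin (grassmannian k) U"
    unfolding openin_grassmannian preimage by (auto simp: U_def)
  \<comment> \<open>A common vector of \<open>V\<close> and the span of \<open>R\<close> is a
    combination of both groups of rows of the invertible \<open>?M w\<close>; the difference is a
    relation between its rows, hence trivial.\<close>
  have unique: "x = 0" if Vx: "V \<in> U" "x \<in> V" "x \<in> vec.span R" for V x
  proof -
    obtain w where w: "indep ?K w" "vec.span (w ` ?K) = V" "det (?M w) \<noteq> 0"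
    proof -
      have "V \<in> span_frame k ` topspace (frames k)" using Vx(1) span_frame_image by (auto simp: U_def)
      then obtain w where "indep ?K w" "vec.span (w ` ?K) = V"
        by (auto simp: frames_def indep_def span_frame_def)
      then show ?thesis using Vx(1) det[of w] that by (auto simp: U_def)
    qed
    obtain u where u: "x = (\<Sum>b\<in>?K. u b *s w b)" using Vx(2) w(2) in_span_image_iff[of ?K x w] by auto
    obtain z where z: "x = (\<Sum>r\<in>L. z r *s A $ r)"
      using Vx(3) in_span_image_iff[of L x "\<lambda>r. A $ r"] by (auto simp: R_def)
    define c where "c = (\<lambda>r. if r \<in> L then - z r else u (inv_into ?K \<iota> r))"
    have "(\<Sum>r\<in>UNIV. c r *s ?M w $ r) = (\<Sum>r\<in>\<iota> ` ?K. c r *s ?M w $ r) + (\<Sum>r\<in>L. c r *s ?M w $ r)"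
      unfolding L_def by (subst sum.union_disjoint[symmetric]) (auto simp: Compl_partition)
    also have "(\<Sum>r\<in>\<iota> ` ?K. c r *s ?M w $ r) = x"
      unfolding u using A(1) by (subst sum.reindex) (auto simp: c_def L_def intro!: sum.cong)
    also have "(\<Sum>r\<in>L. c r *s ?M w $ r) = - x"
      unfolding z sum_negf[symmetric] by (intro sum.cong) (auto simp: c_def L_def replace_rows_def)
    finally have "(\<Sum>r\<in>UNIV. c r *s ?M w $ r) = 0" by simp
    moreover have "indep UNIV (\<lambda>r. ?M w $ r)" using w(3) by (simp add: indep_rows_iff_det)
    ultimately have "c r = 0" for r using sum_eq_0_indepD[of UNIV "\<lambda>r. ?M w $ r" c r] by simp
    then have "z r = 0" if "r \<in> L" for r using that by (metis c_def neg_equal_0_iff_equal)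
    then show "x = 0" using z by simp
  qed
  \<comment> \<open>Expand \<open>v a\<close> in the rows of \<open>N\<close> and keep only the rows
    \<open>\<iota> b\<close>. For \<open>N = ?M w\<close> this projects \<open>v a\<close> onto the
    span of \<open>w\<close> along \<open>R\<close>, in a form that is visibly continuous.\<close>
  define \<Psi> where "\<Psi> = (\<lambda>a N. \<Sum>b\<in>?K. (v a v* matrix_inv N) $ \<iota> b *s N $ \<iota> b)"
  have \<Psi>cont: "continuous_on {N. det N \<noteq> 0} (\<Psi> a)" for a
    unfolding \<Psi>_def vector_matrix_mult_def vec_lambda_beta
    by (intro continuous_on_sum continuous_on_vector_scalar_mult continuous_on_mult continuous_on_component
        continuous_on_const continuous_on_id continuous_on_matrix_inv)
  have \<Psi>: "\<Psi> a (?M w) \<in> vec.span (w ` ?K)" "v a - \<Psi> a (?M w) \<in> vec.span R" if "det (?M w) \<noteq> 0" for a w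
  proof -
    let ?z = "v a v* matrix_inv (?M w)"
    show "\<Psi> a (?M w) \<in> vec.span (w ` ?K)"
      unfolding \<Psi>_def using A(1) by (intro vec.span_sum vec.span_scale vec.span_base) auto
    have "v a = v a v* (matrix_inv (?M w) ** ?M w)"
      using that matrix_mul_matrix_inv by (metis matrix_left_right_inverse vector_matrix_mul_rid)
    also have "\<dots> = ?z v* ?M w" by (simp add: vector_matrix_mul_assoc)
    also have "\<dots> = (\<Sum>r\<in>UNIV. ?z $ r *s ?M w $ r)"
      by (simp add: vec_eq_iff vector_matrix_mult_def mult.commute)
    also have "\<dots> = (\<Sum>r\<in>\<iota> ` ?K. ?z $ r *s ?M w $ r) + (\<Sum>r\<in>L. ?z $ r *s ?M w $ r)"
      unfolding L_def by (subst sum.union_disjoint[symmetric]) (auto simp: Compl_partition)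
    also have "(\<Sum>r\<in>\<iota> ` ?K. ?z $ r *s ?M w $ r) = \<Psi> a (?M w)"
      unfolding \<Psi>_def using A(1) by (subst sum.reindex) auto
    finally have eq: "v a = \<Psi> a (?M w) + (\<Sum>r\<in>L. ?z $ r *s ?M w $ r)" .
    have "v a - \<Psi> a (?M w) = (\<Sum>r\<in>L. ?z $ r *s ?M w $ r)"
      by (subst (1) eq) (rule add_diff_cancel_left')
    also have "\<dots> = (\<Sum>r\<in>L. ?z $ r *s A $ r)"
      by (intro sum.cong) (auto simp: L_def replace_rows_def)
    also have "\<dots> \<in> vec.span R"
      unfolding R_def by (intro vec.span_sum vec.span_scale vec.span_base) auto
    finally show "v a - \<Psi> a (?M w) \<in> vec.span R" .
  qed
  \<comment> \<open>Defined from \<open>V\<close> alone, hence a function on the Grassmannian. By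
    \<open>unique\<close> the choice is forced, so it agrees with \<open>\<Psi> a (?M w)\<close> for
    every frame \<open>w\<close> of \<open>V\<close>.\<close>
  define \<sigma> where "\<sigma> = (\<lambda>V a. SOME y. y \<in> V \<and> v a - y \<in> vec.span R)"
  have \<sigma>_eq: "\<sigma> (span_frame k w) a = \<Psi> a (?M w)" if w: "w \<in> topspace (frames k)" "det (?M w) \<noteq> 0" for w a
  proof -
    let ?V = "vec.span (w ` ?K)"
    have V: "?V \<in> U" using w preimage by (auto simp: span_frame_def)
    have "\<exists>y. y \<in> ?V \<and> v a - y \<in> vec.span R" using \<Psi>[OF w(2)] by blast
    from someI_ex[OF this] have \<sigma>: "\<sigma> ?V a \<in> ?V" "v a - \<sigma> ?V a \<in> vec.span R" by (auto simp: \<sigma>_def)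
    have "(v a - \<Psi> a (?M w)) - (v a - \<sigma> ?V a) \<in> vec.span R"
      by (rule vec.span_diff[OF \<Psi>(2)[OF w(2)] \<sigma>(2)])
    then have "\<sigma> ?V a - \<Psi> a (?M w) \<in> vec.span R" by simp
    moreover have "\<sigma> ?V a - \<Psi> a (?M w) \<in> ?V" by (rule vec.span_diff[OF \<sigma>(1) \<Psi>(1)[OF w(2)]])
    ultimately have "\<sigma> ?V a - \<Psi> a (?M w) = 0" using unique[OF V] by blast
    then show ?thesis by (simp add: span_frame_def)
  qed
  have \<sigma>: "\<sigma> V a \<in> V" "v a - \<sigma> V a \<in> vec.span R" if "V \<in> U" for V a
  proof -
    have "V \<in> span_frame k ` topspace (frames k)" using that span_frame_image by (auto simp: U_def)
    then obtain w where w: "w \<in> topspace (frames k)" "V = span_frame k w" by blast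
    then have "det (?M w) \<noteq> 0" using preimage that by blast
    then show "\<sigma> V a \<in> V" "v a - \<sigma> V a \<in> vec.span R"
      using \<sigma>_eq[OF w(1)] \<Psi>[of w a] w(2) by (auto simp: span_frame_def)
  qed
  have \<sigma>cont: "continuous_map (subtopology (grassmannian k) U) euclidean (\<lambda>V. \<sigma> V a)" for a
  \<comment> \<open>Continuity is tested on frames: over the open set \<open>U\<close> the map
    \<open>span_frame k\<close> is still a quotient map, and composing with it turns
    \<open>\<sigma>\<close> into \<open>\<Psi>\<close>.\<close>
  proof (rule continuous_compose_quotient_map)
    let ?O = "{w \<in> topspace (frames k). span_frame k w \<in> U}"
    show "quotient_map (subtopology (frames k) ?O) (subtopology (grassmannian k) U) (span_frame k)"
      by (rule quotient_map_restriction[OF quotient_map_span_frame]) (auto simp: openU)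
    have "continuous_map (subtopology (frames k) ?O) (top_of_set {N. det N \<noteq> 0}) ?M"
      using Mcont preimage
      by (auto simp: continuous_map_in_subtopology intro: continuous_map_from_subtopology)
    then have "continuous_map (subtopology (frames k) ?O) euclidean (\<Psi> a \<circ> ?M)"
      by (rule continuous_map_compose) (use \<Psi>cont in simp)
    then show "continuous_map (subtopology (frames k) ?O) euclidean ((\<lambda>V. \<sigma> V a) \<circ> span_frame k)"
      by (rule continuous_map_eq) (use \<sigma>_eq preimage in auto)
  qed
  have "indep ?K (\<sigma> V) \<and> vec.span (\<sigma> V ` ?K) = V" if V: "V \<in> U" for V
  proof -
    have ind: "indep ?K (\<sigma> V)"
    proof (rule indepI_sum)
      fix u assume "(\<Sum>a\<in>?K. u a *s \<sigma> V a) = 0"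
      \<comment> \<open>If a combination of the projections vanishes, the same combination of the
        \<open>v a\<close> lies in the span of \<open>R\<close> as well as in
        \<open>V\<^sub>0\<close>, hence is zero.\<close>
      then have "(\<Sum>a\<in>?K. u a *s v a) = (\<Sum>a\<in>?K. u a *s (v a - \<sigma> V a))"
        by (simp add: vec.scale_right_diff_distrib sum_subtractf)
      also have "\<dots> \<in> vec.span R" using \<sigma>(2)[OF V] by (intro vec.span_sum vec.span_scale)
      finally have "(\<Sum>a\<in>?K. u a *s v a) \<in> vec.span R" .
      moreover have "(\<Sum>a\<in>?K. u a *s v a) \<in> V\<^sub>0"
        unfolding v(2)[symmetric] by (intro vec.span_sum vec.span_scale vec.span_base) auto
      ultimately have "(\<Sum>a\<in>?K. u a *s v a) = 0" using unique[OF V0] by blast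
      then show "\<forall>a\<in>?K. u a = 0" using sum_eq_0_indepD[OF v(1)] by blast
    qed simp
    moreover have "vec.span (\<sigma> V ` ?K) = V"
      using \<sigma>(1)[OF V] V by (intro span_eq_if_indep[OF _ _ ind]) (auto simp: U_def Gr_def)
    ultimately show ?thesis ..
  qed
  then show ?thesis using openU V0 \<sigma>cont by blast
qed

lemma frame_path_grassmannian:
  fixes V :: "real \<Rightarrow> (complex ^ 'n) set"
  assumes "continuous_map (top_of_set {0..1}) (grassmannian k) V"
  shows "\<exists>e. frame_path {0..1} k V e"
proof (rule frame_path_global)
  fix s :: real assume s: "s \<in> {0..1}"
  then have "V s \<in> Gr k" using continuous_map_image_subset_topspace[OF assms] by auto
  from local_section_grassmannian[OF this] obtain U and \<sigma> :: "(complex ^ 'n) set \<Rightarrow> nat \<Rightarrow> complex ^ 'n"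
    where U: "openin (grassmannian k) U" "V s \<in> U"
      "\<forall>a<k. continuous_map (subtopology (grassmannian k) U) euclidean (\<lambda>V. \<sigma> V a)"
      "\<forall>V\<in>U. indep {..<k} (\<sigma> V) \<and> vec.span (\<sigma> V ` {..<k}) = V"
    by (elim exE conjE)
  have "openin (top_of_set {0..1}) {t \<in> topspace (top_of_set {0..1}). V t \<in> U}"
    by (rule openin_continuous_map_preimage[OF assms U(1)])
  then obtain d where d: "d > 0" "{0..1} \<inter> ball s d \<subseteq> {t \<in> {0..1}. V t \<in> U}"
    using s U(2) by (auto simp: openin_contains_ball Int_commute)
  let ?S = "{0..1} \<inter> ball s d"
  have "continuous_map (top_of_set ?S) (subtopology (grassmannian k) U) V"
    using continuous_map_from_subtopology[OF assms, of ?S] d(2)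
    by (auto simp: continuous_map_in_subtopology subtopology_subtopology)
  then have "continuous_on ?S (\<lambda>t. \<sigma> (V t) a)" if "a < k" for a
    using continuous_map_compose[of "top_of_set ?S" _ V euclidean "\<lambda>V. \<sigma> V a"] U(3) that
    by (auto simp: comp_def)
  then show "\<exists>d>0. \<exists>e. frame_path ({0..1} \<inter> ball s d) k V e"
    using d U(4) by (intro exI[of _ d] conjI exI[of _ "\<lambda>t. \<sigma> (V t)"]) (auto simp: frame_path_def)
qed

text \<open>A subfamily that is a basis of the span at time \<open>s\<close> stays independent
  nearby, and since the dimension is constant it still spans.\<close>

lemma frame_path_span:
  fixes m :: "real \<Rightarrow> 'b \<Rightarrow> complex ^ 'n"
  assumes I: "finite I" and cont: "\<And>c. c \<in> I \<Longrightarrow> continuous_on {0..1} (\<lambda>t. m t c)"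
    and dim: "\<And>t. t \<in> {0..1} \<Longrightarrow> vec.dim (m t ` I) = i"
  shows "\<exists>e. frame_path {0..1} i (\<lambda>t. vec.span (m t ` I)) e"
proof (rule frame_path_global)
  fix s :: real assume s: "s \<in> {0..1}"
  obtain J where J: "J \<subseteq> I" "indep J (m s)" "vec.span (m s ` J) = vec.span (m s ` I)"
    by (rule obtain_indep_spanning[of I "m s"])
  have "card J = i"
    using dim_indep[OF J(2)] dim[OF s] J(3) vec.dim_span[of "m s ` J"] vec.dim_span[of "m s ` I"] by simp
  moreover have "finite J" using J(1) I finite_subset by blast
  ultimately obtain f where f: "bij_betw f {..<i} J"
    using ex_bij_betw_nat_finite[of J] by (auto simp: atLeast0LessThan)
  obtain \<epsilon> where \<epsilon>: "\<epsilon> > 0" "\<And>y. (\<And>c. c \<in> J \<Longrightarrow> dist (y c) (m s c) < \<epsilon>) \<Longrightarrow> indep J y"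
    using indep_open[OF J(2)] by metis
  have "\<forall>c\<in>J. eventually (\<lambda>t. dist (m t c) (m s c) < \<epsilon>) (at s within {0..1})"
    using cont J(1) s \<epsilon>(1) by (intro ballI tendstoD) (auto simp: continuous_on_def)
  then have "eventually (\<lambda>t. \<forall>c\<in>J. dist (m t c) (m s c) < \<epsilon>) (at s within {0..1})"
    using \<open>finite J\<close> by (simp add: eventually_ball_finite)
  then obtain d where d: "d > 0"
    "\<And>t. t \<in> {0..1} \<Longrightarrow> t \<noteq> s \<Longrightarrow> dist t s < d \<Longrightarrow> \<forall>c\<in>J. dist (m t c) (m s c) < \<epsilon>"
    unfolding eventually_at by blast
  have "frame_path ({0..1} \<inter> ball s d) i (\<lambda>t. vec.span (m t ` I)) (\<lambda>t b. m t (f b))"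
    unfolding frame_path_def
  proof (intro conjI allI impI ballI)
    fix b assume "b < i"
    then have "f b \<in> I" using f J(1) by (auto simp: bij_betw_def)
    then show "continuous_on ({0..1} \<inter> ball s d) (\<lambda>t. m t (f b))"
      using cont continuous_on_subset by blast
  next
    fix t assume t: "t \<in> {0..1} \<inter> ball s d"
    then have "\<forall>c\<in>J. dist (m t c) (m s c) < \<epsilon>"
      using d(2)[of t] \<epsilon>(1) by (cases "t = s") (auto simp: dist_commute)
    then have ind: "indep J (m t)" using \<epsilon>(2) by blast
    then show "indep {..<i} (\<lambda>b. m t (f b))" by (simp add: indep_bij_betw[OF f])
    have "(\<lambda>b. m t (f b)) ` {..<i} = m t ` J" using f by (auto simp: bij_betw_def)
    moreover have "vec.span (m t ` J) = vec.span (m t ` I)"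
      using dim[of t] t \<open>card J = i\<close> J(1)
      by (intro span_eq_if_indep[OF _ _ ind]) (auto intro: vec.span_base)
    ultimately show "vec.span ((\<lambda>b. m t (f b)) ` {..<i}) = vec.span (m t ` I)" by simp
  qed
  then show "\<exists>d>0. \<exists>e. frame_path ({0..1} \<inter> ball s d) i (\<lambda>t. vec.span (m t ` I)) e"
    using d(1) by blast
qed

section \<open>Lifting paths of configurations and closing up lifted loops\<close>

lemma good_frames_iff:
  "good_frames h i k (x :: nat \<Rightarrow> complex ^ 'n) \<longleftrightarrow>
    (\<forall>j<h. indep (block k j) x) \<and> config_of h k x \<in> topspace (grassmann_config h i k)"
proof
  assume "(\<forall>j<h. indep (block k j) x) \<and> config_of h k x \<in> topspace (grassmann_config h i k)"
  then have *: "\<And>j. j < h \<Longrightarrow> indep (block k j) x" "inj_on (config_of h k x) {..<h}"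
    "vec.dim (\<Sum>j<h. config_of h k x j) = i"
    unfolding topspace_grassmann_config by auto
  then show "good_frames h i k x"
    unfolding good_frames_def sum_config_of by (auto simp: inj_on_def config_of_def)
qed (use config_of_in_topspace in \<open>auto simp: good_frames_def\<close>)

lemma config_lift:
  fixes p :: "real \<Rightarrow> nat \<Rightarrow> (complex ^ 'n) set"
  assumes p: "continuous_map (top_of_set {0..1}) (grassmann_config h i k) p" and k: "k > 0"
  shows "\<exists>m. (\<forall>c. continuous_on {0..1} (\<lambda>t. m t c)) \<and> (\<forall>c\<ge>h * k. \<forall>t. m t c = 0) \<and>
    (\<forall>t\<in>{0..1}. good_frames h i k (m t) \<and> config_of h k (m t) = p t)"
proof -
  have top: "p t \<in> topspace (grassmann_config h i k)" if "t \<in> {0..1}" for t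
    using continuous_map_image_subset_topspace[OF p] that by auto
  have "\<exists>e. frame_path {0..1} k (\<lambda>t. p t j) e" if "j < h" for j
  proof (rule frame_path_grassmannian)
    have "continuous_map (top_of_set {0..1}) (product_topology (\<lambda>_. grassmannian k) {..<h}) p"
      using p by (simp add: grassmann_config_def continuous_map_in_subtopology)
    then show "continuous_map (top_of_set {0..1}) (grassmannian k) (\<lambda>t. p t j)"
      using that by (simp add: continuous_map_componentwise)
  qed
  then obtain e where e: "\<And>j. j < h \<Longrightarrow> frame_path {0..1} k (\<lambda>t. p t j) (e j)" by metis
  \<comment> \<open>Vector \<open>c\<close> is number \<open>c mod k\<close> of block
    \<open>c div k\<close>. The value 0 beyond \<open>h * k\<close> lets families be compared as
    functions when paths are joined.\<close>
  define m where "m = (\<lambda>t c. if c < h * k then e (c div k) t (c mod k) else 0)"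
  have "continuous_on {0..1} (\<lambda>t. m t c)" for c
  proof (cases "c < h * k")
    case True
    then have "c div k < h" "c mod k < k" using k by (auto simp: less_mult_imp_div_less)
    then show ?thesis using e True by (auto simp: m_def frame_path_def)
  qed (simp add: m_def)
  moreover have "good_frames h i k (m t) \<and> config_of h k (m t) = p t" if t: "t \<in> {0..1}" for t
  proof -
    have m: "m t (j * k + a) = e j t a" if "j < h" "a < k" for j a
    proof -
      have "j * k + a \<in> block k j" using that(2) by (simp add: block_def)
      then have "j * k + a < h * k" using block_subset[OF that(1), of k] by blast
      then show ?thesis using that by (simp add: m_def)
    qed
    have "indep (block k j) (m t)" if "j < h" for j
    proof -
      have "bij_betw (\<lambda>a. j * k + a) {..<k} (block k j)"
        by (auto simp: bij_betw_def block_eq_image inj_on_def)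
      moreover have "indep {..<k} (\<lambda>a. m t (j * k + a))"
        using e[OF that] t m[OF that] by (subst indep_cong[of _ _ "e j t"]) (auto simp: frame_path_def)
      ultimately show ?thesis using indep_bij_betw by blast
    qed
    moreover have "config_of h k (m t) = p t"
    proof (rule extensionalityI)
      show "config_of h k (m t) \<in> extensional {..<h}" by (simp add: config_of_def)
      show "p t \<in> extensional {..<h}" using top[OF t] by (auto simp: topspace_grassmann_config PiE_def)
      fix j assume "j \<in> {..<h}"
      then have j: "j < h" by simp
      have "m t ` block k j = e j t ` {..<k}"
        unfolding block_eq_image image_image using m[OF j] by (intro image_cong) auto
      then show "config_of h k (m t) j = p t j"
        using e[OF j] t j by (simp add: config_of_def frame_path_def)
    qed
    ultimately show ?thesis using top[OF t] by (simp add: good_frames_iff)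
  qed
  moreover have "\<forall>c\<ge>h * k. \<forall>t. m t c = 0" by (simp add: m_def)
  ultimately show ?thesis by blast
qed

lemma config_lift_with_sum:
  fixes p :: "real \<Rightarrow> nat \<Rightarrow> (complex ^ 'n) set"
  assumes p: "continuous_map (top_of_set {0..1}) (grassmann_config h i k) p" and k: "k > 0"
  shows "\<exists>m e. (\<forall>c. continuous_on {0..1} (\<lambda>t. m t c)) \<and> (\<forall>c\<ge>h * k. \<forall>t. m t c = 0) \<and>
    (\<forall>t\<in>{0..1}. good_frames h i k (m t) \<and> config_of h k (m t) = p t) \<and>
    frame_path {0..1} i (\<lambda>t. vec.span (m t ` {..<h * k})) e"
proof -
  obtain m :: "real \<Rightarrow> nat \<Rightarrow> complex ^ 'n" where m: "\<forall>c. continuous_on {0..1} (\<lambda>t. m t c)"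
    "\<forall>c\<ge>h * k. \<forall>t. m t c = 0" "\<forall>t\<in>{0..1}. good_frames h i k (m t) \<and> config_of h k (m t) = p t"
    using config_lift[OF assms] by blast
  have "\<exists>e. frame_path {0..1} i (\<lambda>t. vec.span (m t ` {..<h * k})) e"
    using m by (intro frame_path_span) (auto simp: good_frames_def)
  with m show ?thesis by blast
qed

text \<open>The families over one configuration form a product of frame spaces, one for each block,
  and each factor is path-connected.\<close>

lemma frames_path_connected_config:
  fixes x y :: "nat \<Rightarrow> complex ^ 'n"
  assumes x: "good_frames h i k x" and y: "good_frames h i k y" and xy: "config_of h k x = config_of h k y"
    and zero: "\<And>c. c \<ge> h * k \<Longrightarrow> x c = 0 \<and> y c = 0" and k: "k > 0"
  shows "\<exists>g. (\<forall>c. continuous_on {0..1} (\<lambda>t::real. g t c)) \<and> g 0 = x \<and> g 1 = y \<and>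
    (\<forall>t\<in>{0..1}. good_frames h i k (g t) \<and> config_of h k (g t) = config_of h k x)"
proof -
  have span: "vec.span (x ` block k j) = vec.span (y ` block k j)" if "j < h" for j
    using fun_cong[OF xy, of j] that by (simp add: config_of_def)
  have "\<exists>g. (\<forall>c. continuous_on {0..1} (\<lambda>t::real. g t c)) \<and> g 0 = x \<and> g 1 = y \<and>
    (\<forall>t\<in>{0..1}. indep (block k j) (g t) \<and> vec.span (g t ` block k j) = vec.span (x ` block k j))"
    if "j < h" for j
    using x y span[OF that] that by (intro frames_path_connected) (auto simp: good_frames_def)
  then obtain f where f: "\<And>j. j < h \<Longrightarrow> (\<forall>c. continuous_on {0..1} (\<lambda>t::real. f j t c)) \<and> f j 0 = x \<and> f j 1 = y \<and>
    (\<forall>t\<in>{0..1}. indep (block k j) (f j t) \<and> vec.span (f j t ` block k j) = vec.span (x ` block k j))"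
    by metis
  define g where "g = (\<lambda>t c. if c < h * k then f (c div k) t c else 0)"
  have div: "c div k < h" if "c < h * k" for c using that by (simp add: less_mult_imp_div_less)
  have g_block: "g t c = f j t c" if "j < h" "c \<in> block k j" for t c j
    using that block_subset[OF that(1), of k] by (auto simp: g_def mem_block_iff)
  have "continuous_on {0..1} (\<lambda>t. g t c)" for c
    using f[OF div, of c] by (cases "c < h * k") (auto simp: g_def)
  moreover have "g 0 = x" "g 1 = y" using f[OF div] zero by (auto simp: g_def fun_eq_iff)
  moreover have "good_frames h i k (g t) \<and> config_of h k (g t) = config_of h k x" if t: "t \<in> {0..1}" for t
  proof -
    have im: "g t ` block k j = f j t ` block k j" if "j < h" for j
      using g_block[OF that] by (intro image_cong) auto
    have "indep (block k j) (g t)" if "j < h" for j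
      using f[OF that] t g_block[OF that] by (subst indep_cong[of _ _ "f j t"]) auto
    moreover have "config_of h k (g t) = config_of h k x"
      unfolding config_of_def using f t im by (intro restrict_ext) auto
    ultimately show ?thesis using config_of_in_topspace[OF x] by (simp add: good_frames_iff)
  qed
  ultimately show ?thesis by blast
qed

text \<open>The lift ends in a family \<open>m 1\<close> over the same configuration as
  \<open>m 0\<close>. Appending a path \<open>g\<close> inside this fibre closes it and changes the
  loop below only by a pause at its end.\<close>

lemma config_loop_null_homotopic_free:
  fixes p :: "real \<Rightarrow> nat \<Rightarrow> (complex ^ 'n) set"
  assumes p: "continuous_map (top_of_set {0..1}) (grassmann_config h i k) p" and k: "2 \<le> k"
    and loop: "p 1 = p 0"
  shows "\<exists>a. config_homotopic h i k True {0..1} p (\<lambda>_. a)"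
proof -
  let ?N = "h * k"
  obtain m e :: "real \<Rightarrow> nat \<Rightarrow> complex ^ 'n" where m: "\<forall>c. continuous_on {0..1} (\<lambda>t. m t c)"
    "\<forall>c\<ge>?N. \<forall>t. m t c = 0" "\<forall>t\<in>{0..1}. good_frames h i k (m t) \<and> config_of h k (m t) = p t"
    and e: "frame_path {0..1} i (\<lambda>t. vec.span (m t ` {..<?N})) e"
    using config_lift_with_sum[OF p] k by fastforce
  obtain g where g: "\<forall>c. continuous_on {0..1} (\<lambda>t::real. g t c)" "g 0 = m 1" "g 1 = m 0"
    "\<forall>t\<in>{0..1}. good_frames h i k (g t) \<and> config_of h k (g t) = config_of h k (m 1)"
    using frames_path_connected_config[of h i k "m 1" "m 0"] m loop k by fastforce
  \<comment> \<open>Along \<open>g\<close> the sum stands still, so the path \<open>f\<close> that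
    closes up its frame can be chosen independently of \<open>g\<close>.\<close>
  have sum: "vec.span (g t ` {..<?N}) = vec.span (m 1 ` {..<?N})" if "t \<in> {0..1}" for t
    using g(4) that sum_config_of[of h k "g t"] sum_config_of[of h k "m 1"] by simp
  have "indep {..<i} (e 1)" "indep {..<i} (e 0)" "vec.span (e 1 ` {..<i}) = vec.span (e 0 ` {..<i})"
    using e sum[of 1] g(3) by (auto simp: frame_path_def)
  then obtain f where f: "\<forall>c. continuous_on {0..1} (\<lambda>t::real. f t c)" "f 0 = e 1" "f 1 = e 0"
    "\<forall>t\<in>{0..1}. indep {..<i} (f t) \<and> vec.span (f t ` {..<i}) = vec.span (e 1 ` {..<i})"
    using frames_path_connected by blast
  define m' where "m' = (\<lambda>t c. ((\<lambda>t. m t c) +++ (\<lambda>t. g t c)) t)"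
  define e' where "e' = (\<lambda>t c. ((\<lambda>t. e t c) +++ (\<lambda>t. f t c)) t)"
  have m': "m' t = (if t \<le> 1/2 then m (2 * t) else g (2 * t - 1))" for t
    by (auto simp: m'_def joinpaths_def)
  have e': "e' t = (if t \<le> 1/2 then e (2 * t) else f (2 * t - 1))" for t
    by (auto simp: e'_def joinpaths_def)
  have half: "t \<in> {0..1} \<Longrightarrow> t \<le> 1/2 \<Longrightarrow> 2 * t \<in> {0..1}" "t \<in> {0..1} \<Longrightarrow> \<not> t \<le> 1/2 \<Longrightarrow> 2 * t - 1 \<in> {0..1}"
    for t :: real by auto
  have "\<exists>a. config_homotopic h i k True {0..1} (\<lambda>t. config_of h k (m' t)) (\<lambda>_. a)"
  proof (rule contract_family)
    show "continuous_on {0..1} (\<lambda>t. m' t c)" for c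
      using m(1) g(1,2) path_join_imp[of "\<lambda>t. m t c" "\<lambda>t. g t c"]
      by (simp add: m'_def path_def pathstart_def pathfinish_def)
    show "continuous_on {0..1} (\<lambda>t. e' t c)" if "c < i" for c
      using e f(1,2) that path_join_imp[of "\<lambda>t. e t c" "\<lambda>t. f t c"]
      by (simp add: e'_def path_def pathstart_def pathfinish_def frame_path_def)
    show "good_frames h i k (m' t)" if "t \<in> {0..1}" for t
      using m(3) g(4) half[OF that] unfolding m' by (cases "t \<le> 1/2") auto
    show "indep {..<i} (e' t)" if "t \<in> {0..1}" for t
      using e f(4) half[OF that] unfolding e' by (cases "t \<le> 1/2") (auto simp: frame_path_def)
    show "vec.span (e' t ` {..<i}) = vec.span (m' t ` {..<?N})" if "t \<in> {0..1}" for t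
    proof (cases "t \<le> 1/2")
      case True
      then show ?thesis using e half(1)[OF that] by (simp add: m' e' frame_path_def)
    next
      case False
      then have "vec.span (f (2 * t - 1) ` {..<i}) = vec.span (e 1 ` {..<i})" using f(4) half(2)[OF that] by blast
      also have "\<dots> = vec.span (m 1 ` {..<?N})" using e by (simp add: frame_path_def)
      also have "\<dots> = vec.span (g (2 * t - 1) ` {..<?N})" using sum half(2)[OF that] False by simp
      finally show ?thesis using False by (simp add: m' e')
    qed
    show "m' 0 = m' 1" "e' 0 = e' 1" using g(3) f(3) by (simp_all add: m' e')
  qed (use k in auto)
  moreover have "config_homotopic h i k True {0..1} p (\<lambda>t. config_of h k (m' t))"
  proof (subst homotopic_with)
    \<comment> \<open>From \<open>p\<close> at normal speed to \<open>p\<close> at double speed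
      followed by a pause, which is the image of the closed-up lift.\<close>
    let ?h = "\<lambda>z. p (min ((1 + fst z) * snd z) (1::real))"
    have "continuous_map (top_of_set ({0..1} \<times> {0..1})) (top_of_set {0..1}) (\<lambda>z. min ((1 + fst z) * snd z) (1::real))"
      by (auto simp: continuous_map_in_subtopology intro!: continuous_on_min continuous_on_mult continuous_on_add
          continuous_on_fst continuous_on_snd continuous_on_const continuous_on_id)
    from continuous_map_compose[OF this p]
    have "continuous_map (prod_topology (top_of_set {0..1}) (top_of_set {0..1})) (grassmann_config h i k) ?h"
      by (simp add: prod_topology_subtopology_eu comp_def)
    moreover have "p (min (2 * t) 1) = config_of h k (m' t)" if "t \<in> {0..1}" for t
      using m(3) g(4) half[OF that] by (cases "t \<le> 1/2") (simp_all add: m')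
    ultimately show "\<exists>f. continuous_map (prod_topology (top_of_set {0..1}) (top_of_set {0..1})) (grassmann_config h i k) f \<and>
        (\<forall>t\<in>topspace (top_of_set {0..1}). f (0, t) = p t) \<and>
        (\<forall>t\<in>topspace (top_of_set {0..1}). f (1, t) = config_of h k (m' t)) \<and>
        (\<forall>s\<in>{0..1::real}. True \<longrightarrow> f (s, 0) = f (s, 1))"
      by (intro exI[of _ ?h]) (auto simp: loop)
  qed auto
  ultimately show ?thesis using homotopic_with_trans by blast
qed

subsection \<open>Simple connectedness\<close>

text \<open>View the free homotopy as a map on a square with \<open>p\<close> on one side. In the
  square this side deforms, with ends fixed, to the path along the other three; there the map runs
  along the track of the base point, pauses at \<open>a\<close>, and runs back.\<close>

lemma homotopic_with_loop_basepoint: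
  assumes hom: "homotopic_with (\<lambda>r. True \<longrightarrow> r 0 = r 1) (top_of_set {0..1::real}) X p (\<lambda>_. a)"
  shows "homotopic_with (\<lambda>r. r 0 = p 0 \<and> r 1 = p 0) (top_of_set {0..1}) X p (\<lambda>_. p 0)"
proof -
  let ?I = "top_of_set {0..1::real}"
  obtain K where K: "continuous_map (prod_topology ?I ?I) X K" "\<And>t. K (0, t) = p t" "\<And>t. K (1, t) = a"
    "\<And>s. s \<in> {0..1} \<Longrightarrow> K (s, 0) = K (s, 1)"
    using hom unfolding homotopic_with_def by auto
  have "p 0 = p 1" using K(2) K(4)[of 0] by simp
  text \<open>The boundary path of the square other than the side carrying \<open>p\<close>.\<close>
  define f :: "real \<Rightarrow> real" where "f = (\<lambda>t. min 1 (min (3 * t) (3 * (1 - t))))"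
  define g :: "real \<Rightarrow> real" where "g = (\<lambda>t. max 0 (min 1 (3 * t - 1)))"
  have fg: "f t \<in> {0..1}" "g t \<in> {0..1}" if "t \<in> {0..1}" for t
    using that by (auto simp: f_def g_def)
  have fg0: "f 0 = 0" "f 1 = 0" "g 0 = 0" "g 1 = 1" by (auto simp: f_def g_def)
  have contf: "continuous_on A f" and contg: "continuous_on A g" for A
    unfolding f_def g_def
    by (intro continuous_on_min continuous_on_max continuous_on_mult continuous_on_diff continuous_on_const continuous_on_id)+
  have comp: "continuous_map (prod_topology ?I ?I) X (\<lambda>z. K (\<phi> z, \<psi> z))"
    if "continuous_on ({0..1} \<times> {0..1}) \<phi>" "continuous_on ({0..1} \<times> {0..1}) \<psi>"
      "\<And>u t. u \<in> {0..1} \<Longrightarrow> t \<in> {0..1} \<Longrightarrow> \<phi> (u, t) \<in> {0..1} \<and> \<psi> (u, t) \<in> {0..1}" for \<phi> \<psi>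
  proof -
    have "continuous_map (top_of_set ({0..1} \<times> {0..1})) (top_of_set ({0..1} \<times> {0..1})) (\<lambda>z. (\<phi> z, \<psi> z))"
      using that by (auto simp: continuous_map_in_subtopology intro!: continuous_on_Pair)
    from continuous_map_compose[OF this K(1)[unfolded prod_topology_subtopology_eu]]
    show ?thesis by (simp add: prod_topology_subtopology_eu comp_def)
  qed
  have contf': "continuous_on ({0..1} \<times> {0..1}) (\<lambda>z :: real \<times> real. f (snd z))"
    and contg': "continuous_on ({0..1} \<times> {0..1}) (\<lambda>z :: real \<times> real. g (snd z))"
    by (intro continuous_on_fst_snd contf contg)+
  have "homotopic_with (\<lambda>r. r 0 = p 0 \<and> r 1 = p 0) ?I X p (\<lambda>t. K (f t, 0))"
  proof (subst homotopic_with)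
    \<comment> \<open>Straight segments in the square from \<open>(0, t)\<close> to
      \<open>(f t, g t)\<close>.\<close>
    let ?h = "\<lambda>z. K (fst z * f (snd z), (1 - fst z) * snd z + fst z * g (snd z))"
    have "continuous_map (prod_topology ?I ?I) X ?h"
    proof (rule comp)
      fix u t :: real assume ut: "u \<in> {0..1}" "t \<in> {0..1}"
      have "(1 - u) * t + u * g t \<le> (1 - u) * 1 + u * 1"
        using ut fg[OF ut(2)] by (intro add_mono mult_left_mono) auto
      then show "fst (u, t) * f (snd (u, t)) \<in> {0..1} \<and> (1 - fst (u, t)) * snd (u, t) + fst (u, t) * g (snd (u, t)) \<in> {0..1}"
        using ut fg[OF ut(2)] by (auto simp: mult_le_one)
    qed (intro continuous_on_add continuous_on_mult continuous_on_diff continuous_on_const contf' contg'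
        continuous_on_fst continuous_on_snd continuous_on_id)+
    moreover have "K (f t, g t) = K (f t, 0)" if t: "t \<in> {0..1}" for t
    proof -
      \<comment> \<open>On the outer thirds \<open>g\<close> is 0 or 1, where \<open>K\<close> has
        equal values; on the middle third \<open>f = 1\<close>, where \<open>K\<close> is constantly
        \<open>a\<close>.\<close>
      consider "t \<le> 1/3" | "1/3 \<le> t" "t \<le> 2/3" | "2/3 \<le> t" by linarith
      then consider "g t = 0" | "f t = 1" | "g t = 1"
        by cases (auto simp: f_def g_def)
      then show ?thesis using K(3) K(4)[of "f t"] fg[OF t] by cases auto
    qed
    ultimately show "\<exists>h. continuous_map (prod_topology ?I ?I) X h \<and> (\<forall>t\<in>topspace ?I. h (0, t) = p t) \<and>
        (\<forall>t\<in>topspace ?I. h (1, t) = K (f t, 0)) \<and> (\<forall>s\<in>{0..1::real}. h (s, 0) = p 0 \<and> h (s, 1) = p 0)"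
      using K(2) \<open>p 0 = p 1\<close> by (intro exI[of _ ?h]) (auto simp: fg0)
  qed auto
  moreover have "homotopic_with (\<lambda>r. r 0 = p 0 \<and> r 1 = p 0) ?I X (\<lambda>t. K (f t, 0)) (\<lambda>_. p 0)"
  proof (subst homotopic_with)
    \<comment> \<open>The path out and back is drawn in towards its starting point.\<close>
    let ?h = "\<lambda>z. K ((1 - fst z) * f (snd z), 0)"
    have "continuous_map (prod_topology ?I ?I) X ?h"
    proof (rule comp)
      fix u t :: real assume ut: "u \<in> {0..1}" "t \<in> {0..1}"
      then show "(1 - fst (u, t)) * f (snd (u, t)) \<in> {0..1} \<and> (0::real) \<in> {0..1}"
        using fg[OF ut(2)] by (auto simp: mult_le_one)
    qed (intro continuous_on_mult continuous_on_diff continuous_on_const contf'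
        continuous_on_fst continuous_on_id)+
    then show "\<exists>h. continuous_map (prod_topology ?I ?I) X h \<and> (\<forall>t\<in>topspace ?I. h (0, t) = K (f t, 0)) \<and>
        (\<forall>t\<in>topspace ?I. h (1, t) = p 0) \<and> (\<forall>s\<in>{0..1::real}. h (s, 0) = p 0 \<and> h (s, 1) = p 0)"
      using K(2) by (intro exI[of _ ?h]) (auto simp: fg0)
  qed auto
  ultimately show ?thesis by (rule homotopic_with_trans)
qed

lemma path_connected_space_grassmann_config:
  assumes k: "2 \<le> k"
  shows "path_connected_space (grassmann_config h i k :: (nat \<Rightarrow> (complex ^ 'n) set) topology)"
  unfolding path_connected_space_iff_path_component
proof (intro ballI)
  let ?X = "grassmann_config h i k :: (nat \<Rightarrow> (complex ^ 'n) set) topology"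
  let ?N = "h * k"
  fix x y assume xy: "x \<in> topspace ?X" "y \<in> topspace ?X"
  have lift: "\<exists>m e. good_frames h i k m \<and> config_of h k m = z \<and> indep {..<i} e \<and>
      vec.span (e ` {..<i}) = vec.span (m ` {..<?N})" if "z \<in> topspace ?X" for z
  proof -
    \<comment> \<open>A single configuration is lifted as a constant path.\<close>
    have "continuous_map (top_of_set {0..1::real}) ?X (\<lambda>_. z)" using that by simp
    then obtain m e :: "real \<Rightarrow> nat \<Rightarrow> complex ^ 'n" where
      "\<forall>t\<in>{0..1}. good_frames h i k (m t) \<and> config_of h k (m t) = z"
      "frame_path {0..1} i (\<lambda>t. vec.span (m t ` {..<?N})) e"
      using config_lift_with_sum[of h i k "\<lambda>_. z"] k by fastforce
    then show ?thesis by (intro exI[of _ "m 0"] exI[of _ "e 0"]) (auto simp: frame_path_def)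
  qed
  obtain m\<^sub>0 e\<^sub>0 where 0: "good_frames h i k m\<^sub>0" "config_of h k m\<^sub>0 = x" "indep {..<i} e\<^sub>0"
      "vec.span (e\<^sub>0 ` {..<i}) = vec.span (m\<^sub>0 ` {..<?N})" using lift xy by blast
  obtain m\<^sub>1 e\<^sub>1 where 1: "good_frames h i k m\<^sub>1" "config_of h k m\<^sub>1 = y" "indep {..<i} e\<^sub>1"
      "vec.span (e\<^sub>1 ` {..<i}) = vec.span (m\<^sub>1 ` {..<?N})" using lift xy by blast
  define m where "m = (\<lambda>t::real. if t = 0 then m\<^sub>0 else m\<^sub>1)"
  define e where "e = (\<lambda>t::real. if t = 0 then e\<^sub>0 else e\<^sub>1)"
  \<comment> \<open>On a two-point set every family is continuous, so no path between the two lifts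
    is needed beforehand; the contraction takes both points to the same \<open>a\<close>.\<close>
  have "\<exists>a. config_homotopic h i k False {0, 1} (\<lambda>t. config_of h k (m t)) (\<lambda>_. a)"
    using 0 1 k by (intro contract_family[where e = e]) (auto simp: m_def e_def continuous_on_finite)
  then obtain a K where K: "continuous_map (prod_topology (top_of_set {0..1::real}) (top_of_set {0, 1::real})) ?X K"
    "\<And>t. K (0, t) = config_of h k (m t)" "\<And>t. K (1, t) = a"
    unfolding homotopic_with_def by auto
  have "path_component_of ?X (K (0, t)) (K (1, t))" if "t \<in> {0, 1}" for t
  proof -
    have "continuous_map (top_of_set {0..1}) (prod_topology (top_of_set {0..1::real}) (top_of_set {0, 1})) (\<lambda>s. (s, t))"
      using that by (intro continuous_map_pairedI) auto
    from continuous_map_compose[OF this K(1)] show ?thesis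
      unfolding path_component_of_def pathin_def by (intro exI[of _ "K \<circ> (\<lambda>s. (s, t))"]) auto
  qed
  from this[of 0] this[of 1] have "path_component_of ?X x a" "path_component_of ?X y a"
    using 0(2) 1(2) by (simp_all add: K m_def)
  then show "path_component_of ?X x y" by (meson path_component_of_sym path_component_of_trans)
qed

theorem theorem1p1:
  fixes h i k :: nat
  assumes "h \<ge> 1" and "i \<ge> 1" and "1 < k" and "k < CARD('n::finite)"
    and "topspace (grassmann_config h i k :: (nat \<Rightarrow> (complex ^ 'n) set) topology) \<noteq> {}"
  shows "simply_connected_space (grassmann_config h i k :: (nat \<Rightarrow> (complex ^ 'n) set) topology)"
  unfolding simply_connected_space_def
proof (intro conjI allI impI)
  have k: "2 \<le> k" using assms(3) by simp
  show "path_connected_space (grassmann_config h i k :: (nat \<Rightarrow> (complex ^ 'n) set) topology)"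
    using k by (rule path_connected_space_grassmann_config)
  fix p :: "real \<Rightarrow> nat \<Rightarrow> (complex ^ 'n) set"
  assume p: "pathin (grassmann_config h i k) p \<and> p 1 = p 0"
  then obtain a where "config_homotopic h i k True {0..1} p (\<lambda>_. a)"
    using config_loop_null_homotopic_free[of h i k p] k by (auto simp: pathin_def)
  then show "homotopic_with (\<lambda>r. r 0 = p 0 \<and> r 1 = p 0) (top_of_set {0..1}) (grassmann_config h i k) p (\<lambda>_. p 0)"
    by (rule homotopic_with_loop_basepoint)
qed

end
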